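(* Let $G=(V,E)$ be a finite embedded graph with additional edges $E_A$ as described in the context, and let $x=(x_e)_{e\in E}\in\mathbb C^E$. For $uv\in E$ let $d_{uv}$ be the maximum of the degrees of $u$ and $v$ in $G$. If $|x_{uv}|<(d_{uv}-1)^{-1}$ for every $uv\in E$ (with $(d_{uv}-1)^{-1}=\infty$ if $d_{uv}=1$), then the family $\{w(\ell;x)\}$ indexed by all loops $\ell$ in $G$ is absolutely summable and \[ Z(x)=\exp\Big(\sum_{\ell \text{ loop in } G} w(\ell;x)\Big). \]
   Context: Setting: $G=(V,E)$ is a finite graph without self-loops or multiple edges, embedded in $\mathbb R^2$: vertices are distinct points, each edge $uv$ is the straight segment from $u$ to $v$, and no vertex lies in the interior of an edge. $G$ need not be planar: two edges may intersect in a point which is not a vertex, in which case they are said to cross. The edge set is split into a set $E_A$ of "additional" edges and the set $E\setminus E_A$ of "representative" edges, where the graph $(V,E_A)$ contains no cycle. A path of $n$ steps is a sequence $(v_0,\dots,v_{n-1})\in V^n$ with $v_iv_{i+1}\in E$ for $0\le i\le n-2$ and $v_{i+2}\ne v_i$ for $0\le i\le n-3$. It is closed if all its cyclic rotations are also paths. Vertices are ordered lexicographically by their coordinates, and sequences of vertices lexicographically. A loop is a closed path $(v_0,\dots,v_{n-1})$ which is the lexicographically smallest among all rotations of itself and of its reversal $(v_{n-1},\dots,v_0)$. Indices are taken mod $n$. The multiplicity $m(\ell)$ of a loop is $n$ divided by the smallest period of the sequence. For distinct edges $uv,vw$, $\angle(v-u,w-v)\in(-\pi,\pi)$ is the turning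 angle from the vector $v-u$ to $w-v$. The winding angle is $\alpha(\ell)=\sum_{i=0}^{n-1}\angle(v_{i+1}-v_i,v_{i+2}-v_{i+1})$ (a multiple of $2\pi$) and the sign is $\operatorname{sgn}(\ell)=-\exp(i\alpha(\ell)/2)\in\{\pm1\}$. For edge weights $x\in\mathbb C^E$ the weight of a loop is $w(\ell;x)=\frac{\operatorname{sgn}(\ell)}{m(\ell)}\prod_{i=0}^{n-1}x_{v_iv_{i+1}}$. A set $F\subseteq E$ is even if every vertex has even degree in $(V,F)$ ($\emptyset$ is even); $C_F$ is the number of unordered pairs of edges of $F$ that cross. The generating function is $Z(x)=\sum_{F\subseteq E\text{ even}}(-1)^{C_F}\prod_{e\in F}x_e$. *)

theory Defs
  imports "HOL-Analysis.Analysis"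
begin

definition embedded_graph :: "complex set \<Rightarrow> complex set set \<Rightarrow> bool" where
  "embedded_graph V E \<longleftrightarrow> finite V
     \<and> (\<forall>e\<in>E. \<exists>u v. e = {u, v} \<and> u \<in> V \<and> v \<in> V \<and> u \<noteq> v)
     \<and> (\<forall>u v. {u, v} \<in> E \<longrightarrow> (\<forall>p\<in>V. p \<notin> open_segment u v))"

definition acyclic_edges :: "complex set set \<Rightarrow> bool" where
  "acyclic_edges EA \<longleftrightarrow> \<not> (\<exists>cs. 3 \<le> length cs \<and> distinct cs \<and>
      (\<forall>i<length cs. {cs ! i, cs ! ((i + 1) mod length cs)} \<in> EA))"

definition crosses :: "complex set \<Rightarrow> complex set \<Rightarrow> complex set \<Rightarrow> bool" where
  "crosses V e f \<longleftrightarrow> e \<noteq> f \<and> (\<exists>p. p \<in> convex hull e \<and> p \<in> convex hull f \<and> p \<notin> V)"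

definition deg :: "complex set set \<Rightarrow> complex \<Rightarrow> nat" where
  "deg E v = card {e\<in>E. v \<in> e}"

definition even_set :: "complex set \<Rightarrow> complex set set \<Rightarrow> bool" where
  "even_set V F \<longleftrightarrow> (\<forall>v\<in>V. even (deg F v))"

definition crossing_number :: "complex set \<Rightarrow> complex set set \<Rightarrow> nat" where
  "crossing_number V F = card {{e, f} | e f. e \<in> F \<and> f \<in> F \<and> crosses V e f}"

definition Zgen :: "complex set \<Rightarrow> complex set set \<Rightarrow> (complex set \<Rightarrow> complex) \<Rightarrow> complex" where
  "Zgen V E x = (\<Sum>F\<in>{F. F \<subseteq> E \<and> even_set V F}.
       (-1) ^ crossing_number V F * (\<Prod>e\<in>F. x e))"

definition is_path :: "complex set set \<Rightarrow> complex list \<Rightarrow> bool" where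
  "is_path E vs \<longleftrightarrow> vs \<noteq> [] \<and>
     (\<forall>i. i + 1 < length vs \<longrightarrow> {vs ! i, vs ! (i + 1)} \<in> E) \<and>
     (\<forall>i. i + 2 < length vs \<longrightarrow> vs ! (i + 2) \<noteq> vs ! i)"

definition closed_path :: "complex set set \<Rightarrow> complex list \<Rightarrow> bool" where
  "closed_path E vs \<longleftrightarrow> vs \<noteq> [] \<and> is_path E vs \<and>
     (\<forall>i<length vs. {vs ! i, vs ! ((i + 1) mod length vs)} \<in> E \<and>
        vs ! ((i + 2) mod length vs) \<noteq> vs ! i)"

definition vless :: "complex \<Rightarrow> complex \<Rightarrow> bool" where
  "vless p q \<longleftrightarrow> Re p < Re q \<or> (Re p = Re q \<and> Im p < Im q)"

definition seq_le :: "complex list \<Rightarrow> complex list \<Rightarrow> bool" where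
  "seq_le xs ys \<longleftrightarrow> xs = ys \<or> (xs, ys) \<in> lexord {(p, q). vless p q}"

definition is_loop :: "complex set set \<Rightarrow> complex list \<Rightarrow> bool" where
  "is_loop E vs \<longleftrightarrow> closed_path E vs \<and>
     (\<forall>k<length vs. seq_le vs (rotate k vs) \<and> seq_le vs (rotate k (rev vs)))"

definition multiplicity :: "complex list \<Rightarrow> nat" where
  "multiplicity vs = length vs div (LEAST p. 0 < p \<and> rotate p vs = vs)"

definition turn_angle :: "complex \<Rightarrow> complex \<Rightarrow> real" where
  "turn_angle a b = Arg (b / a)"

definition winding_angle :: "complex list \<Rightarrow> real" where
  "winding_angle vs = (let n = length vs in
     \<Sum>i<n. turn_angle (vs ! ((i + 1) mod n) - vs ! i)
                       (vs ! ((i + 2) mod n) - vs ! ((i + 1) mod n)))"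

definition loop_sign :: "complex list \<Rightarrow> complex" where
  "loop_sign vs = - exp (\<i> * of_real (winding_angle vs) / 2)"

definition loop_weight :: "(complex set \<Rightarrow> complex) \<Rightarrow> complex list \<Rightarrow> complex" where
  "loop_weight x vs = loop_sign vs / of_nat (multiplicity vs) *
     (\<Prod>i<length vs. x {vs ! i, vs ! ((i + 1) mod length vs)})"

definition dmax :: "complex set set \<Rightarrow> complex \<Rightarrow> complex \<Rightarrow> nat" where
  "dmax E u v = max (deg E u) (deg E v)"

end

theory Submission
  imports Defs
begin

text \<open>
  Order the half-edges of \<open>G\<close> by the height of their origin (imaginary part, ties broken by decreasing
  real part) and then by the argument of their direction, and measure signs of perfect matchings by
  crossings of arcs in this order. Sweeping the plane by height shows that for even \<open>F\<close> the sign
  \<open>(-1)^C\<^sub>F\<close> is the sign of the matching that joins the two halves of every edge of \<open>F\<close>; moreover the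
  signs of all matchings of \<open>2k\<close> half-edges at one vertex add up to \<open>1\<close>. Hence \<open>Z(tx)\<close> is, up to sign,
  the Pfaffian of \<open>t A + B\<close> with \<open>A\<close> joining half-edges at a common vertex and \<open>B\<close> joining the halves
  of an edge. Cofactor expansion yields \<open>2 Z' = - Z tr(\<Lambda> (1 - t \<Lambda>)\<^sup>-\<^sup>1)\<close> for \<open>\<Lambda> = B A\<close> as formal power
  series. Because \<open>\<Lambda>\<close> is conjugate to the Kac-Ward transition matrix with entries
  \<open>x exp(i \<angle>/2)\<close>, its traces are sums over rooted oriented closed paths, and a loop of length \<open>n\<close>
  and multiplicity \<open>m\<close> accounts for \<open>2n/m\<close> of these. So \<open>Z(tx)\<close> and the exponential of the loop sum
  satisfy the same differential equation; the row sums of the modulus of the transition matrix are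
  below \<open>1\<close>, which gives convergence beyond \<open>t = 1\<close>.
\<close>

section \<open>Signs of pairings and perfect matchings\<close>

text \<open>Crossings of segments live in the plane, whereas a Pfaffian sees only crossings of arcs
  over a line. For two edges these signs agree up to factors that record on which side of one edge
  an end of the other lies at that height. Single pairs therefore cannot be matched; only the total
  over an even set can, because there each vertex occurs as an end an even number of times and the
  side factors square away. At a vertex of even degree the least half-edge has an odd number of
  possible partners whose signs alternate, so the signs add up to 1 whatever the geometry is. Each
  edge weight is split into two square roots, one per half-edge; this makes the weight of a matching
  depend on the half-edges it covers and not on how they are paired. Formal series avoid division:
  the Pfaffian may vanish as a number, while the factor t on \<open>A\<close> determines the
  cofactors coefficient by coefficient. The diagonal conjugation to the Kac-Ward matrix consists of
  the phases exp(i Arg / 2), which telescope around closed paths; what remains are the order signs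
  of half-edges.\<close>

definition pair_sign :: "('a \<Rightarrow> 'a \<Rightarrow> int) \<Rightarrow> 'a set \<Rightarrow> int" where
  "pair_sign c M = (-1) ^ card {{e, f} |e f. e \<in> M \<and> f \<in> M \<and> e \<noteq> f \<and> c e f = -1}"

lemma pair_sign_empty [simp]: "pair_sign c {} = 1"
  by (simp add: pair_sign_def)

text \<open>The relation \<open>c\<close> stays arbitrary because the lemma serves both arcs
  (\<open>chi\<close>) and segments (\<open>crs\<close>). The new unordered pairs are exactly the
  \<open>{a, f}\<close>, so only the values of \<open>c\<close> against \<open>a\<close>
  enter.\<close>

lemma pair_sign_insert:
  fixes c :: "'a \<Rightarrow> 'a \<Rightarrow> int"
  assumes fin: "finite M" and a: "a \<notin> M"
    and sym: "\<And>f. f \<in> M \<Longrightarrow> c f a = c a f"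
    and val: "\<And>f. f \<in> M \<Longrightarrow> c a f = 1 \<or> c a f = -1"
  shows "pair_sign c (insert a M) = pair_sign c M * (\<Prod>f\<in>M. c a f)"
proof -
  let ?P = "\<lambda>M. {{e, f} |e f. e \<in> M \<and> f \<in> M \<and> e \<noteq> f \<and> c e f = -1}"
  let ?N = "{f \<in> M. c a f = -1}"
  have split: "?P (insert a M) = ?P M \<union> (\<lambda>f. {a, f}) ` ?N"
  proof (intro equalityI subsetI)
    fix s assume "s \<in> ?P (insert a M)"
    then obtain e f where s: "s = {e, f}" "e \<in> insert a M" "f \<in> insert a M" "e \<noteq> f" "c e f = -1"
      by blast
    show "s \<in> ?P M \<union> (\<lambda>f. {a, f}) ` ?N"
    proof (cases "e = a \<or> f = a")
      case True
      then show ?thesis using s sym by (auto simp: insert_commute)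
    next
      case False
      then show ?thesis using s by blast
    qed
  next
    fix s assume "s \<in> ?P M \<union> (\<lambda>f. {a, f}) ` ?N"
    then show "s \<in> ?P (insert a M)" using a by blast
  qed
  have disj: "?P M \<inter> (\<lambda>f. {a, f}) ` ?N = {}"
    using a by (auto simp: doubleton_eq_iff)
  have finP: "finite (?P M)"
    by (rule finite_subset[of _ "Pow M"]) (use fin in auto)
  have inj: "inj_on (\<lambda>f. {a, f}) ?N"
    by (auto simp: inj_on_def doubleton_eq_iff)
  have "card (?P (insert a M)) = card (?P M) + card ?N"
    unfolding split using finP fin disj by (subst card_Un_disjoint) (auto simp: card_image inj)
  moreover have "(\<Prod>f\<in>M. c a f) = (-1) ^ card ?N"
  proof -
    have "(\<Prod>f\<in>M. c a f) = (\<Prod>f\<in>M. if c a f = -1 then -1 else 1)"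
      using val by (intro prod.cong) auto
    also have "\<dots> = (\<Prod>f\<in>?N. -1)"
      by (rule prod.inter_filter[symmetric, OF fin])
    finally show ?thesis by simp
  qed
  ultimately show ?thesis by (simp add: pair_sign_def power_add)
qed

lemma pair_sign_Un:
  fixes c :: "'a \<Rightarrow> 'a \<Rightarrow> int"
  assumes "finite M" "finite N" "M \<inter> N = {}"
    and sym: "\<And>e f. e \<in> M \<union> N \<Longrightarrow> f \<in> M \<union> N \<Longrightarrow> e \<noteq> f \<Longrightarrow> c f e = c e f"
    and val: "\<And>e f. e \<in> M \<union> N \<Longrightarrow> f \<in> M \<union> N \<Longrightarrow> e \<noteq> f \<Longrightarrow> c e f = 1 \<or> c e f = -1"
  shows "pair_sign c (M \<union> N) = pair_sign c M * pair_sign c N * (\<Prod>e\<in>M. \<Prod>f\<in>N. c e f)"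
  using assms
proof (induction M rule: finite_induct)
  case empty
  then show ?case by simp
next
  case (insert a M)
  have IH: "pair_sign c (M \<union> N) = pair_sign c M * pair_sign c N * (\<Prod>e\<in>M. \<Prod>f\<in>N. c e f)"
    using insert.prems by (intro insert.IH) auto
  have aMN: "a \<notin> M \<union> N" using insert by auto
  have "pair_sign c (insert a (M \<union> N)) = pair_sign c (M \<union> N) * (\<Prod>f\<in>M \<union> N. c a f)"
  proof (rule pair_sign_insert)
    show "finite (M \<union> N)" using insert by simp
    show "a \<notin> M \<union> N" by (rule aMN)
    fix f assume "f \<in> M \<union> N"
    then have "f \<noteq> a" "f \<in> insert a M \<union> N" using aMN by auto
    then show "c f a = c a f" "c a f = 1 \<or> c a f = -1"
      using insert.prems(3)[of a f] insert.prems(4)[of a f] by auto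
  qed
  moreover have "pair_sign c (insert a M) = pair_sign c M * (\<Prod>f\<in>M. c a f)"
  proof (rule pair_sign_insert)
    fix f assume "f \<in> M"
    then have "f \<noteq> a" "f \<in> insert a M \<union> N" using aMN by auto
    then show "c f a = c a f" "c a f = 1 \<or> c a f = -1"
      using insert.prems(3)[of a f] insert.prems(4)[of a f] by auto
  qed (use insert in auto)
  moreover have "(\<Prod>f\<in>M \<union> N. c a f) = (\<Prod>f\<in>M. c a f) * (\<Prod>f\<in>N. c a f)"
    using insert by (intro prod.union_disjoint) auto
  ultimately show ?case using insert.hyps by (simp add: IH)
qed

definition matchings :: "'a set \<Rightarrow> 'a set set set" where
  "matchings H = {M. \<Union>M = H \<and> (\<forall>m\<in>M. card m = 2) \<and> (\<forall>m\<in>M. \<forall>m'\<in>M. m \<noteq> m' \<longrightarrow> m \<inter> m' = {})}"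

lemma finite_matchings: "finite H \<Longrightarrow> finite (matchings H)"
  by (rule finite_subset[of _ "Pow (Pow H)"]) (auto simp: matchings_def)

lemma matching_finite: "finite H \<Longrightarrow> M \<in> matchings H \<Longrightarrow> finite M"
  by (rule finite_subset[of _ "Pow H"]) (auto simp: matchings_def)

lemma matchings_empty [simp]: "matchings {} = {{}}"
proof (intro equalityI subsetI)
  fix M :: "'a set set" assume "M \<in> matchings {}"
  then have "\<forall>m\<in>M. m = {} \<and> card m = 2" by (auto simp: matchings_def)
  then show "M \<in> {{}}" by fastforce
qed (simp add: matchings_def)

text \<open>A double product over a matching forgets how the points are paired. Hence the sign
  effect of a new arc and the weight of a block matching depend only on the set covered.\<close>

lemma prod_matching:
  assumes "M \<in> matchings H" 
  shows "(\<Prod>m\<in>M. \<Prod>p\<in>m. f p) = (\<Prod>p\<in>H. f p)"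
proof -
  have "(\<Prod>p\<in>\<Union>M. f p) = (\<Prod>m\<in>M. \<Prod>p\<in>m. f p)"
    using assms
    by (subst prod.Union_disjoint) (auto simp: matchings_def intro: card_ge_0_finite)
  then show ?thesis using assms by (simp add: matchings_def)
qed

lemma card_matching:
  assumes "M \<in> matchings H" "finite H"
  shows "card H = 2 * card M"
proof -
  have "card (\<Union>M) = (\<Sum>m\<in>M. card m)"
    using assms by (intro card_Union_disjoint) (auto simp: matchings_def pairwise_def disjnt_def intro: card_ge_0_finite)
  also have "\<dots> = (\<Sum>m\<in>M. 2)"
    using assms(1) by (intro sum.cong) (auto simp: matchings_def)
  finally show ?thesis using assms by (simp add: matchings_def)
qed

lemma matching_insert:
  assumes "N \<in> matchings (H - {k, j})" "k \<in> H" "j \<in> H" "j \<noteq> k"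
  shows "insert {k, j} N \<in> matchings H" "{k, j} \<notin> N"
  using assms by (auto simp: matchings_def)

text \<open>Exactly one pair passes through \<open>k\<close>, and its other element \<open>j\<close>
  classifies the matchings. This is the Laplace expansion behind all cofactor identities and behind
  the block induction.\<close>

lemma sum_matchings_expand:
  fixes \<phi> :: "'a set set \<Rightarrow> 'b::comm_monoid_add"
  assumes fin: "finite H" and k: "k \<in> H"
  shows "(\<Sum>M\<in>matchings H. \<phi> M)
       = (\<Sum>j\<in>H - {k}. \<Sum>N\<in>matchings (H - {k, j}). \<phi> (insert {k, j} N))"
proof -
  let ?S = "SIGMA j:H - {k}. matchings (H - {k, j})"
  let ?g = "\<lambda>(j, N). insert {k, j} N"
  have inj: "inj_on ?g ?S"
  proof (rule inj_onI)
    fix p p' assume p: "p \<in> ?S" "p' \<in> ?S" "?g p = ?g p'"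
    obtain j N j' N' where eq: "p = (j, N)" "p' = (j', N')" by fastforce
    have *: "j \<in> H" "j \<noteq> k" "N \<in> matchings (H - {k, j})"
      "j' \<in> H" "j' \<noteq> k" "N' \<in> matchings (H - {k, j'})"
      "insert {k, j} N = insert {k, j'} N'" using p eq by auto
    have "{k, j} \<notin> N'" using *(6) by (auto simp: matchings_def)
    then have jj: "j = j'" using * by (auto simp: doubleton_eq_iff)
    moreover have "N = N'"
      using *(7) matching_insert(2)[OF *(3) k *(1,2)] matching_insert(2)[OF *(6) k *(4,5)]
      unfolding jj by (metis Diff_insert_absorb)
    ultimately show "p = p'" using eq by simp
  qed
  have im: "?g ` ?S = matchings H"
  proof (intro equalityI subsetI)
    fix M assume "M \<in> ?g ` ?S"
    then show "M \<in> matchings H" using matching_insert(1)[OF _ k] by auto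
  next
    fix M assume M: "M \<in> matchings H"
    then obtain m where m: "m \<in> M" "k \<in> m" using k by (auto simp: matchings_def)
    then have "card m = 2" using M by (auto simp: matchings_def)
    then obtain j where j: "m = {k, j}" "j \<noteq> k" using m(2) by (auto simp: card_2_iff doubleton_eq_iff)
    have jH: "j \<in> H" using m j M by (auto simp: matchings_def)
    have "M - {m} \<in> matchings (H - {k, j})"
    proof -
      have "\<Union>(M - {m}) = H - m"
      proof -
        have "\<Union>M = m \<union> \<Union>(M - {m})" using m(1) by blast
        moreover have "m \<inter> \<Union>(M - {m}) = {}"
        proof -
          have "m \<inter> m' = {}" if "m' \<in> M - {m}" for m'
            using M m(1) that by (auto simp: matchings_def)
          then show ?thesis by blast
        qed
        moreover have "\<Union>M = H" using M by (simp add: matchings_def)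
        ultimately show ?thesis by blast
      qed
      then show ?thesis using M j(1) by (auto simp: matchings_def)
    qed
    moreover have "M = ?g (j, M - {m})" using m j by auto
    ultimately show "M \<in> ?g ` ?S" using j(2) jH by (intro image_eqI[of _ _ "(j, M - {m})"]) auto
  qed
  have "(\<Sum>M\<in>matchings H. \<phi> M) = (\<Sum>p\<in>?S. \<phi> (?g p))"
    unfolding im[symmetric] using inj by (simp add: sum.reindex)
  also have "\<dots> = (\<Sum>j\<in>H - {k}. \<Sum>N\<in>matchings (H - {k, j}). \<phi> (insert {k, j} N))"
    using fin by (subst sum.Sigma) (auto simp: finite_matchings split_def)
  finally show ?thesis .
qed

section \<open>Pfaffians\<close>

lemma fps_deriv_prod_sum:
  fixes f :: "'a \<Rightarrow> 'b::comm_ring_1 fps"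
  assumes "finite S"
  shows "fps_deriv (\<Prod>m\<in>S. f m) = (\<Sum>m\<in>S. fps_deriv (f m) * (\<Prod>m'\<in>S - {m}. f m'))"
  using assms
proof (induction S rule: finite_induct)
  case empty
  then show ?case by simp
next
  case (insert a S)
  have "(\<Sum>m\<in>S. fps_deriv (f m) * (\<Prod>m'\<in>insert a S - {m}. f m'))
      = (\<Sum>m\<in>S. f a * (fps_deriv (f m) * (\<Prod>m'\<in>S - {m}. f m')))"
  proof (intro sum.cong refl)
    fix m assume "m \<in> S"
    then have "insert a S - {m} = insert a (S - {m})" using insert by auto
    then show "fps_deriv (f m) * (\<Prod>m'\<in>insert a S - {m}. f m')
      = f a * (fps_deriv (f m) * (\<Prod>m'\<in>S - {m}. f m'))"
      using insert by (simp add: mult_ac)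
  qed
  then show ?case using insert
    by (simp add: sum_distrib_left mult_ac add_ac)
qed

text \<open>The Pfaffian algebra rests only on antisymmetry and the values 1 and -1 of \<sigma>, so
  it is developed for such sign functions; the linear order enters with
  \<open>keyed\<close>.\<close>

locale tournament =
  fixes H :: "'a set" and \<sigma> :: "'a \<Rightarrow> 'a \<Rightarrow> int"
  assumes fin: "finite H"
    and anti: "\<lbrakk>p \<in> H; q \<in> H; p \<noteq> q\<rbrakk> \<Longrightarrow> \<sigma> q p = - \<sigma> p q"
    and val: "\<lbrakk>p \<in> H; q \<in> H; p \<noteq> q\<rbrakk> \<Longrightarrow> \<sigma> p q = 1 \<or> \<sigma> p q = -1"
begin

text \<open>If \<open>\<sigma>\<close> comes from a linear order and \<open>m\<close>, \<open>m'\<close> are disjoint pairs, \<open>chi m m' = -1\<close> means that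
  the arcs \<open>m\<close> and \<open>m'\<close> cross.\<close>

definition chi :: "'a set \<Rightarrow> 'a set \<Rightarrow> int" where
  "chi m m' = (\<Prod>p\<in>m. \<Prod>q\<in>m'. \<sigma> p q)"

definition sg :: "'a set set \<Rightarrow> int" where
  "sg M = pair_sign chi M"

lemma sigma_sq: "\<lbrakk>p \<in> H; q \<in> H; p \<noteq> q\<rbrakk> \<Longrightarrow> \<sigma> p q * \<sigma> p q = 1"
  using val[of p q] by auto

text \<open>Each of the four factors changes sign, so the product does not.\<close>

lemma chi_sym:
  assumes "m \<subseteq> H" "m' \<subseteq> H" "card m = 2" "card m' = 2" "m \<inter> m' = {}"
  shows "chi m' m = chi m m'"
proof -
  obtain a b where m: "m = {a, b}" "a \<noteq> b" using assms(3) by (auto simp: card_2_iff)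
  obtain c d where m': "m' = {c, d}" "c \<noteq> d" using assms(4) by (auto simp: card_2_iff)
  have "a \<noteq> c" "a \<noteq> d" "b \<noteq> c" "b \<noteq> d" "a \<in> H" "b \<in> H" "c \<in> H" "d \<in> H"
    using assms m m' by auto
  then show ?thesis
    using anti[of a c] anti[of a d] anti[of b c] anti[of b d] m(2) m'(2)
    by (simp add: chi_def m(1) m'(1))
qed

lemma chi_val:
  assumes "m \<subseteq> H" "m' \<subseteq> H" "m \<inter> m' = {}"
  shows "chi m m' = 1 \<or> chi m m' = -1"
proof -
  have fm: "finite m" "finite m'" using assms by (auto intro: finite_subset[OF _ fin])
  have prod1: "(\<Prod>q\<in>S. f q) = 1 \<or> (\<Prod>q\<in>S. f q) = -1"
    if "finite S" "\<And>q. q \<in> S \<Longrightarrow> f q = 1 \<or> f q = -1" for S and f :: "'a \<Rightarrow> int"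
    using that by (induction S rule: finite_induct) fastforce+
  show ?thesis unfolding chi_def
  proof (intro prod1 fm)
    fix p q assume "p \<in> m" "q \<in> m'"
    then show "\<sigma> p q = 1 \<or> \<sigma> p q = -1" using assms by (intro val) auto
  qed
qed

text \<open>The arcs of \<open>N\<close> cover \<open>U\<close> exactly, so the interaction of the
  new arc with all of them is a product over \<open>U\<close>, independent of
  \<open>N\<close>.\<close>

lemma sg_insert:
  assumes "N \<in> matchings U" "U \<subseteq> H" "m \<subseteq> H" "card m = 2" "m \<inter> U = {}"
  shows "sg (insert m N) = sg N * (\<Prod>q\<in>U. \<Prod>p\<in>m. \<sigma> p q)"
proof -
  have fU: "finite U" using assms(2) by (rule finite_subset[OF _ fin])
  have fN: "finite N" using matching_finite[OF fU assms(1)] .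
  have *: "m' \<subseteq> H \<and> card m' = 2 \<and> m \<inter> m' = {}" if "m' \<in> N" for m'
    using that assms by (auto simp: matchings_def)
  have "m \<notin> N" using *[of m] assms(4) by auto
  then have "sg (insert m N) = sg N * (\<Prod>m'\<in>N. chi m m')"
    unfolding sg_def using fN * assms by (intro pair_sign_insert chi_sym chi_val) auto
  also have "(\<Prod>m'\<in>N. chi m m') = (\<Prod>m'\<in>N. \<Prod>q\<in>m'. \<Prod>p\<in>m. \<sigma> p q)"
    unfolding chi_def by (intro prod.cong refl prod.swap)
  also have "\<dots> = (\<Prod>q\<in>U. \<Prod>p\<in>m. \<sigma> p q)" by (rule prod_matching[OF assms(1)])
  finally show ?thesis .
qed

lemma sg_sq: "sg M * sg M = 1"
  by (simp add: sg_def pair_sign_def flip: power_add)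

lemma matching_D:
  "M \<in> matchings U \<Longrightarrow> m \<in> M \<Longrightarrow> m \<subseteq> U \<and> card m = 2"
  by (auto simp: matchings_def)

lemma matching_disjoint:
  "M \<in> matchings U \<Longrightarrow> m \<in> M \<Longrightarrow> m' \<in> M \<Longrightarrow> m \<noteq> m' \<Longrightarrow> m \<inter> m' = {}"
  by (auto simp: matchings_def)

lemma matching_Un:
  assumes "N \<in> matchings U" "N' \<in> matchings (H - U)" "U \<subseteq> H"
  shows "N \<union> N' \<in> matchings H" "N \<inter> N' = {}"
proof -
  have sep: "m \<inter> m' = {}" "m \<noteq> m'" if "m \<in> N" "m' \<in> N'" for m m'
  proof -
    note D = matching_D[OF assms(1) that(1)] matching_D[OF assms(2) that(2)]
    then show "m \<inter> m' = {}" by blast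
    moreover have "m \<noteq> {}" using D by auto
    ultimately show "m \<noteq> m'" by auto
  qed
  show "N \<inter> N' = {}" using sep(2) by blast
  have un: "\<Union>(N \<union> N') = H" using assms by (auto simp: matchings_def)
  have "m \<inter> m' = {}" if "m \<in> N \<union> N'" "m' \<in> N \<union> N'" "m \<noteq> m'" for m m'
  proof -
    consider "m \<in> N" "m' \<in> N" | "m \<in> N" "m' \<in> N'" | "m \<in> N'" "m' \<in> N" | "m \<in> N'" "m' \<in> N'"
      using \<open>m \<in> N \<union> N'\<close> \<open>m' \<in> N \<union> N'\<close> by blast
    then show ?thesis
    proof cases
      case 1
      then show ?thesis using matching_disjoint[OF assms(1)] that(3) by simp
    next
      case 2
      then show ?thesis by (rule sep(1))
    next
      case 3
      then show ?thesis using sep(1)[of m' m] by (simp add: Int_commute)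
    next
      case 4
      then show ?thesis using matching_disjoint[OF assms(2)] that(3) by simp
    qed
  qed
  moreover have "card m = 2" if "m \<in> N \<union> N'" for m
    using that matching_D[OF assms(1)] matching_D[OF assms(2)] by blast
  ultimately show "N \<union> N' \<in> matchings H"
    unfolding matchings_def mem_Collect_eq using un by blast
qed

text \<open>The interaction factor sees \<open>N\<close> only through the set \<open>U\<close> that
  it covers.\<close>

lemma sg_Un:
  assumes "N \<in> matchings U" "N' \<in> matchings (H - U)" "U \<subseteq> H"
  shows "sg (N \<union> N') = sg N * sg N' * (\<Prod>m'\<in>N'. \<Prod>p\<in>U. \<Prod>q\<in>m'. \<sigma> p q)"
proof -
  note M = matching_Un[OF assms]
  have fN: "finite N" "finite N'"
    using finite_subset[OF _ matching_finite[OF fin M(1)]] by auto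
  have "sg (N \<union> N') = sg N * sg N' * (\<Prod>m\<in>N. \<Prod>m'\<in>N'. chi m m')"
    unfolding sg_def
  proof (rule pair_sign_Un[OF fN M(2)])
    fix e f assume "e \<in> N \<union> N'" "f \<in> N \<union> N'" "e \<noteq> f"
    note * = matching_D[OF M(1) this(1)] matching_D[OF M(1) this(2)] matching_disjoint[OF M(1) this]
    show "chi f e = chi e f" using * by (intro chi_sym) auto
    show "chi e f = 1 \<or> chi e f = -1" using * by (intro chi_val) auto
  qed
  also have "(\<Prod>m\<in>N. \<Prod>m'\<in>N'. chi m m') = (\<Prod>m'\<in>N'. \<Prod>m\<in>N. chi m m')" by (rule prod.swap)
  also have "\<dots> = (\<Prod>m'\<in>N'. \<Prod>p\<in>U. \<Prod>q\<in>m'. \<sigma> p q)"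
    unfolding chi_def by (intro prod.cong refl prod_matching[OF assms(1)])
  finally show ?thesis .
qed

text \<open>Two matchings of the same \<open>U\<close> interact with \<open>N'\<close> by the same
  factor, so exchanging them changes the sign by \<open>sg N * sg N1\<close>. Later this compares a
  matching inside vertices with the edge matching on the same half-edges.\<close>

lemma sg_Un_mult:
  assumes "N \<in> matchings U" "N1 \<in> matchings U" "N' \<in> matchings (H - U)" "U \<subseteq> H"
  shows "sg (N \<union> N') = sg N * sg N1 * sg (N1 \<union> N')"
proof -
  have "sg N * sg N1 * sg (N1 \<union> N') = (sg N1 * sg N1) * sg (N \<union> N')"
    unfolding sg_Un[OF assms(1,3,4)] sg_Un[OF assms(2,3,4)] by (simp only: mult_ac)
  then show ?thesis by (simp add: sg_sq)
qed

text \<open>The Pfaffian of the antisymmetric matrix \<open>amat w\<close>: weights sit on unordered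
  pairs, and all orientation signs are kept in \<open>sg\<close>.\<close>

definition pf :: "('a set \<Rightarrow> 'b::comm_ring_1) \<Rightarrow> 'b" where
  "pf w = (\<Sum>M\<in>matchings H. of_int (sg M) * (\<Prod>m\<in>M. w m))"

text \<open>The signed complementary Pfaffian for deleting \<open>k\<close> and \<open>j\<close>.
  The factor \<open>\<sigma> k j\<close> is there to cancel the one in \<open>amat\<close>, so that
  row \<open>k\<close> against its own cofactors gives \<open>pf w\<close>.\<close>

definition cof :: "('a set \<Rightarrow> 'b::comm_ring_1) \<Rightarrow> 'a \<Rightarrow> 'a \<Rightarrow> 'b" where
  "cof w k j = (if k = j then 0 else of_int (\<sigma> k j) *
     (\<Sum>N\<in>matchings (H - {k, j}). of_int (sg (insert {k, j} N)) * (\<Prod>m\<in>N. w m)))"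

definition amat :: "('a set \<Rightarrow> 'b::comm_ring_1) \<Rightarrow> 'a \<Rightarrow> 'a \<Rightarrow> 'b" where
  "amat w p q = (if p = q then 0 else of_int (\<sigma> p q) * w {p, q})"

lemma prod_insert_matching:
  assumes "N \<in> matchings (H - {k, j})"
  shows "(\<Prod>m\<in>insert {k, j} N. w m) = w {k, j} * (\<Prod>m\<in>N. w m)"
proof -
  have "{k, j} \<notin> N" using assms by (auto simp: matchings_def)
  moreover have "finite N" by (rule matching_finite[OF _ assms]) (simp add: fin)
  ultimately show ?thesis by simp
qed

lemma pf_expand:
  assumes k: "k \<in> H"
  shows "(\<Sum>j\<in>H. amat w k j * cof w k j) = pf w"
proof -
  have "pf w = (\<Sum>j\<in>H - {k}. \<Sum>N\<in>matchings (H - {k, j}).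
      of_int (sg (insert {k, j} N)) * (\<Prod>m\<in>insert {k, j} N. w m))"
    unfolding pf_def by (rule sum_matchings_expand[OF fin k])
  also have "\<dots> = (\<Sum>j\<in>H - {k}. amat w k j * cof w k j)"
  proof (rule sum.cong[OF refl])
    fix j assume j: "j \<in> H - {k}"
    have "of_int (\<sigma> k j) * of_int (\<sigma> k j) = (1 :: 'b)"
      using sigma_sq[of k j] j k by (metis of_int_mult of_int_1 DiffE singletonI)
    moreover have "amat w k j * cof w k j = (of_int (\<sigma> k j) * of_int (\<sigma> k j)) * (w {k, j} *
        (\<Sum>N\<in>matchings (H - {k, j}). of_int (sg (insert {k, j} N)) * (\<Prod>m\<in>N. w m)))"
      using j by (simp only: mult_ac amat_def cof_def) auto
    ultimately have "amat w k j * cof w k j = w {k, j} *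
        (\<Sum>N\<in>matchings (H - {k, j}). of_int (sg (insert {k, j} N)) * (\<Prod>m\<in>N. w m))"
      by simp
    also have "\<dots> = (\<Sum>N\<in>matchings (H - {k, j}).
        of_int (sg (insert {k, j} N)) * (\<Prod>m\<in>insert {k, j} N. w m))"
      unfolding sum_distrib_left by (intro sum.cong refl) (simp add: prod_insert_matching mult_ac)
    finally show "(\<Sum>N\<in>matchings (H - {k, j}).
        of_int (sg (insert {k, j} N)) * (\<Prod>m\<in>insert {k, j} N. w m)) = amat w k j * cof w k j" ..
  qed
  also have "\<dots> = (\<Sum>j\<in>H. amat w k j * cof w k j)"
    by (intro sum.mono_neutral_left) (auto simp: fin amat_def)
  finally show ?thesis ..
qed

text \<open>Both matchings interact with the remaining points by the same factor, so only the signs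
  among the four points matter. Rewriting them in a common orientation reverses one pair on the left
  and two on the right, which leaves one minus sign.\<close>

lemma sg_exchange:
  assumes N: "N \<in> matchings (H - {k, i, j, l})" and "{k, i, j, l} \<subseteq> H"
    and d: "k \<noteq> i" "k \<noteq> j" "k \<noteq> l" "i \<noteq> j" "i \<noteq> l" "j \<noteq> l"
  shows "\<sigma> i j * \<sigma> k j * sg (insert {k, j} (insert {i, l} N))
       = - (\<sigma> i l * \<sigma> k l * sg (insert {k, l} (insert {i, j} N)))"
proof -
  have *: "sg (insert {k, j} (insert {i, l} N))
     = sg N * (\<Prod>q\<in>H - {k, i, j, l}. \<sigma> i q * \<sigma> l q * \<sigma> k q * \<sigma> j q) * (\<sigma> k i * \<sigma> j i * \<sigma> k l * \<sigma> j l)"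
    if "{j', l'} = {j, l}" "N \<in> matchings (H - {k, i, j, l})" "{k, i, j, l} \<subseteq> H"
      "k \<noteq> i" "k \<noteq> j" "k \<noteq> l" "i \<noteq> j" "i \<noteq> l" "j \<noteq> l" for j l j' l'
  proof -
    let ?R = "H - {k, i, j, l}"
    have "insert {i, l} N \<in> matchings (H - {k, j})"
    proof (rule matching_insert(1))
      have "H - {k, j} - {i, l} = ?R" by auto
      then show "N \<in> matchings (H - {k, j} - {i, l})" using that by simp
    qed (use that in auto)
    then have "sg (insert {k, j} (insert {i, l} N)) = sg (insert {i, l} N) * (\<Prod>q\<in>H - {k, j}. \<Prod>p\<in>{k, j}. \<sigma> p q)"
      using that by (intro sg_insert) auto
    also have "sg (insert {i, l} N) = sg N * (\<Prod>q\<in>?R. \<Prod>p\<in>{i, l}. \<sigma> p q)"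
      using that by (intro sg_insert) auto
    also have "(\<Prod>q\<in>H - {k, j}. \<Prod>p\<in>{k, j}. \<sigma> p q)
        = (\<Prod>q\<in>{i, l}. \<Prod>p\<in>{k, j}. \<sigma> p q) * (\<Prod>q\<in>?R. \<Prod>p\<in>{k, j}. \<sigma> p q)"
    proof -
      have "H - {k, j} = {i, l} \<union> ?R" using that by auto
      then show ?thesis using fin by (simp only:) (intro prod.union_disjoint, auto)
    qed
    finally show ?thesis using that by (simp add: prod.distrib mult_ac)
  qed
  have R: "H - {k, i, j, l} = H - {k, i, l, j}" by auto
  have e1: "sg (insert {k, j} (insert {i, l} N))
     = sg N * (\<Prod>q\<in>H - {k, i, j, l}. \<sigma> i q * \<sigma> l q * \<sigma> k q * \<sigma> j q) * (\<sigma> k i * \<sigma> j i * \<sigma> k l * \<sigma> j l)"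
    using assms by (intro *[of j l]) auto
  have "sg (insert {k, l} (insert {i, j} N))
     = sg N * (\<Prod>q\<in>H - {k, i, l, j}. \<sigma> i q * \<sigma> j q * \<sigma> k q * \<sigma> l q) * (\<sigma> k i * \<sigma> l i * \<sigma> k j * \<sigma> l j)"
    using assms R by (intro *[of l j]) auto
  also have "(\<Prod>q\<in>H - {k, i, l, j}. \<sigma> i q * \<sigma> j q * \<sigma> k q * \<sigma> l q)
     = (\<Prod>q\<in>H - {k, i, j, l}. \<sigma> i q * \<sigma> l q * \<sigma> k q * \<sigma> j q)"
    unfolding R by (intro prod.cong refl) (simp add: mult_ac)
  finally have e2: "sg (insert {k, l} (insert {i, j} N))
     = sg N * (\<Prod>q\<in>H - {k, i, j, l}. \<sigma> i q * \<sigma> l q * \<sigma> k q * \<sigma> j q) * (\<sigma> k i * \<sigma> l i * \<sigma> k j * \<sigma> l j)" .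
  have a: "\<sigma> j i = - \<sigma> i j" "\<sigma> l i = - \<sigma> i l" "\<sigma> l j = - \<sigma> j l"
    using anti[of i j] anti[of i l] anti[of j l] assms by auto
  have s: "\<sigma> i j * \<sigma> i j = 1" "\<sigma> i l * \<sigma> i l = 1" "\<sigma> k j * \<sigma> k j = 1" "\<sigma> k l * \<sigma> k l = 1"
    using sigma_sq assms by auto
  let ?X = "sg N * (\<Prod>q\<in>H - {k, i, j, l}. \<sigma> i q * \<sigma> l q * \<sigma> k q * \<sigma> j q) * \<sigma> k i * \<sigma> j l * \<sigma> k j * \<sigma> k l"
  have "\<sigma> i j * \<sigma> k j * sg (insert {k, j} (insert {i, l} N)) = - (?X * (\<sigma> i j * \<sigma> i j))"
    unfolding e1 a by (simp add: mult_ac)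
  moreover have "\<sigma> i l * \<sigma> k l * sg (insert {k, l} (insert {i, j} N)) = ?X * (\<sigma> i l * \<sigma> i l)"
    unfolding e2 a by (simp add: mult_ac)
  ultimately show ?thesis by (simp only: s mult_1_right)
qed

text \<open>Expanding the cofactor a second time, at \<open>i\<close>, gives terms
  \<open>T j l\<close> in which \<open>i\<close> is joined to both \<open>j\<close> and
  \<open>l\<close>; swapping these negates the term by \<open>sg_exchange\<close>. The sum equals
  its own negative, whence the domain with 2 nonzero.\<close>

lemma pf_alien:
  fixes w :: "'a set \<Rightarrow> 'b::idom"
  assumes two: "(2 :: 'b) \<noteq> 0" and k: "k \<in> H" and i: "i \<in> H" and ik: "i \<noteq> k"
  shows "(\<Sum>j\<in>H. amat w i j * cof w k j) = 0"
proof -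
  define A where "A = H - {k, i}"
  define T :: "'a \<Rightarrow> 'a \<Rightarrow> 'b" where "T = (\<lambda>j l. \<Sum>N\<in>matchings (H - {k, i, j, l}).
     of_int (\<sigma> i j * \<sigma> k j * sg (insert {k, j} (insert {i, l} N))) * (w {i, j} * w {i, l} * (\<Prod>m\<in>N. w m)))"
  have Tanti: "T j l = - T l j" if "j \<in> A" "l \<in> A" "j \<noteq> l" for j l
  proof -
    have R: "H - {k, i, l, j} = H - {k, i, j, l}" by auto
    show ?thesis unfolding T_def R sum_negf[symmetric]
    proof (rule sum.cong[OF refl])
      fix N assume N: "N \<in> matchings (H - {k, i, j, l})"
      have "\<sigma> i j * \<sigma> k j * sg (insert {k, j} (insert {i, l} N))
       = - (\<sigma> i l * \<sigma> k l * sg (insert {k, l} (insert {i, j} N)))"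
        using that k i ik by (intro sg_exchange N) (auto simp: A_def)
      then show "of_int (\<sigma> i j * \<sigma> k j * sg (insert {k, j} (insert {i, l} N))) *
          (w {i, j} * w {i, l} * (\<Prod>m\<in>N. w m)) =
         - (of_int (\<sigma> i l * \<sigma> k l * sg (insert {k, l} (insert {i, j} N))) *
            (w {i, l} * w {i, j} * (\<Prod>m\<in>N. w m)))"
        by (simp add: mult_ac)
    qed
  qed
  have term_eq: "amat w i j * cof w k j = (\<Sum>l\<in>A - {j}. T j l)" if j: "j \<in> A" for j
  proof -
    let ?G = "\<lambda>N. of_int (sg (insert {k, j} N)) * (\<Prod>m\<in>N. w m)"
    have Hr: "H - {k, j} - {i} = A - {j}" by (auto simp: A_def)
    have "(\<Sum>N\<in>matchings (H - {k, j}). ?G N)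
        = (\<Sum>l\<in>H - {k, j} - {i}. \<Sum>N\<in>matchings (H - {k, j} - {i, l}). ?G (insert {i, l} N))"
      using fin i ik j by (intro sum_matchings_expand) (auto simp: A_def)
    also have "\<dots> = (\<Sum>l\<in>A - {j}. \<Sum>N\<in>matchings (H - {k, i, j, l}).
        of_int (sg (insert {k, j} (insert {i, l} N))) * (w {i, l} * (\<Prod>m\<in>N. w m)))"
      unfolding Hr
    proof (intro sum.cong refl)
      fix l assume "l \<in> A - {j}"
      show "matchings (H - {k, j} - {i, l}) = matchings (H - {k, i, j, l})"
        by (rule arg_cong[of _ _ matchings]) auto
      fix N assume N: "N \<in> matchings (H - {k, i, j, l})"
      have "{i, l} \<notin> N" using N by (auto simp: matchings_def)
      moreover have "finite N" by (rule matching_finite[OF _ N]) (simp add: fin)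
      ultimately show "?G (insert {i, l} N)
        = of_int (sg (insert {k, j} (insert {i, l} N))) * (w {i, l} * (\<Prod>m\<in>N. w m))" by simp
    qed
    finally have "cof w k j = of_int (\<sigma> k j) * \<dots>" using j by (auto simp: cof_def A_def)
    moreover have "amat w i j = of_int (\<sigma> i j) * w {i, j}" using j by (auto simp: amat_def A_def)
    ultimately show ?thesis
      by (simp add: T_def sum_distrib_left mult_ac)
  qed
  define S where "S = (\<Sum>j\<in>A. \<Sum>l\<in>A - {j}. T j l)"
  have "S = (\<Sum>j\<in>A. \<Sum>l\<in>A. if l \<noteq> j then T j l else 0)"
    unfolding S_def by (intro sum.cong refl sum.mono_neutral_cong_left) (auto simp: A_def fin)
  also have "\<dots> = (\<Sum>l\<in>A. \<Sum>j\<in>A. if l \<noteq> j then T j l else 0)" by (rule sum.swap)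
  also have "\<dots> = (\<Sum>l\<in>A. \<Sum>j\<in>A - {l}. T j l)"
    by (intro sum.cong refl sum.mono_neutral_cong_right) (auto simp: A_def fin)
  also have "\<dots> = (\<Sum>l\<in>A. \<Sum>j\<in>A - {l}. - T l j)"
    by (intro sum.cong refl Tanti) auto
  also have "\<dots> = - S" by (simp add: S_def sum_negf)
  finally have "S = 0" using two by (simp add: eq_neg_iff_add_eq_0 flip: mult_2)
  \<comment> \<open>The indices \<open>k\<close> and \<open>i\<close> drop out because
    \<open>cof\<close> and \<open>amat\<close> vanish on the diagonal.\<close>
  moreover have "(\<Sum>j\<in>H. amat w i j * cof w k j) = (\<Sum>j\<in>A. amat w i j * cof w k j)"
    by (intro sum.mono_neutral_right) (auto simp: A_def fin amat_def cof_def)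
  moreover have "\<dots> = S" unfolding S_def by (intro sum.cong refl term_eq)
  ultimately show ?thesis by simp
qed

text \<open>The factor 2 arises because the differentiated pair is counted once from each of its two
  points.\<close>

lemma fps_deriv_pf:
  fixes w :: "'a set \<Rightarrow> 'b::comm_ring_1 fps"
  shows "2 * fps_deriv (pf w)
       = (\<Sum>k\<in>H. \<Sum>j\<in>H. amat (\<lambda>m. fps_deriv (w m)) k j * cof w k j)"
proof -
  define g where "g = (\<lambda>M m. of_int (sg M) * (fps_deriv (w m) * (\<Prod>m'\<in>M - {m}. w m')))"
  have "fps_deriv (pf w) = (\<Sum>M\<in>matchings H. \<Sum>m\<in>M. g M m)"
    unfolding pf_def fps_deriv_sum
  proof (intro sum.cong refl)
    fix M assume M: "M \<in> matchings H"
    show "fps_deriv (of_int (sg M) * (\<Prod>m\<in>M. w m)) = (\<Sum>m\<in>M. g M m)"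
      using fps_deriv_prod_sum[OF matching_finite[OF fin M], of w]
      by (simp add: g_def sum_distrib_left)
  qed
  moreover have "2 * (\<Sum>m\<in>M. g M m) = (\<Sum>k\<in>H. \<Sum>m\<in>M. if k \<in> m then g M m else 0)"
    if M: "M \<in> matchings H" for M
  proof -
    have "(\<Sum>k\<in>H. \<Sum>m\<in>M. if k \<in> m then g M m else 0)
        = (\<Sum>m\<in>M. \<Sum>k\<in>H. if k \<in> m then g M m else 0)" by (rule sum.swap)
    also have "\<dots> = (\<Sum>m\<in>M. 2 * g M m)"
    proof (intro sum.cong refl)
      fix m assume "m \<in> M"
      then have m: "m \<subseteq> H" "card m = 2" using M by (auto simp: matchings_def)
      have "(\<Sum>k\<in>H. if k \<in> m then g M m else 0) = (\<Sum>k\<in>m. g M m)"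
        using m by (intro sum.mono_neutral_cong_right) (auto simp: fin)
      then show "(\<Sum>k\<in>H. if k \<in> m then g M m else 0) = 2 * g M m" using m by simp
    qed
    finally show ?thesis by (simp add: sum_distrib_left)
  qed
  ultimately have "2 * fps_deriv (pf w)
      = (\<Sum>M\<in>matchings H. \<Sum>k\<in>H. \<Sum>m\<in>M. if k \<in> m then g M m else 0)"
    by (simp add: sum_distrib_left)
  also have "\<dots> = (\<Sum>k\<in>H. \<Sum>M\<in>matchings H. \<Sum>m\<in>M. if k \<in> m then g M m else 0)"
    by (rule sum.swap)
  also have "\<dots> = (\<Sum>k\<in>H. \<Sum>j\<in>H. amat (\<lambda>m. fps_deriv (w m)) k j * cof w k j)"
  proof (intro sum.cong refl)
    fix k assume k: "k \<in> H"
    have "(\<Sum>M\<in>matchings H. \<Sum>m\<in>M. if k \<in> m then g M m else 0)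
       = (\<Sum>j\<in>H - {k}. \<Sum>N\<in>matchings (H - {k, j}).
           \<Sum>m\<in>insert {k, j} N. if k \<in> m then g (insert {k, j} N) m else 0)"
      by (rule sum_matchings_expand[OF fin k])
    also have "\<dots> = (\<Sum>j\<in>H - {k}. amat (\<lambda>m. fps_deriv (w m)) k j * cof w k j)"
    proof (intro sum.cong refl)
      fix j assume j: "j \<in> H - {k}"
      have "(\<Sum>m\<in>insert {k, j} N. if k \<in> m then g (insert {k, j} N) m else 0)
          = fps_deriv (w {k, j}) * (of_int (sg (insert {k, j} N)) * (\<Prod>m\<in>N. w m))"
        if N: "N \<in> matchings (H - {k, j})" for N
      proof -
        have fN: "finite N" by (rule matching_finite[OF _ N]) (simp add: fin)
        have kN: "{k, j} \<notin> N" "k \<notin> \<Union>N" using N by (auto simp: matchings_def)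
        have "(\<Sum>m\<in>insert {k, j} N. if k \<in> m then g (insert {k, j} N) m else 0)
            = g (insert {k, j} N) {k, j} + (\<Sum>m\<in>N. if k \<in> m then g (insert {k, j} N) m else 0)"
          using fN kN by simp
        also have "(\<Sum>m\<in>N. if k \<in> m then g (insert {k, j} N) m else 0) = 0"
          using kN by (intro sum.neutral) auto
        finally show ?thesis using kN by (simp add: g_def mult_ac)
      qed
      then have "(\<Sum>N\<in>matchings (H - {k, j}).
           \<Sum>m\<in>insert {k, j} N. if k \<in> m then g (insert {k, j} N) m else 0)
         = fps_deriv (w {k, j}) *
           (\<Sum>N\<in>matchings (H - {k, j}). of_int (sg (insert {k, j} N)) * (\<Prod>m\<in>N. w m))"
        (is "_ = _ * ?S")
        by (simp add: sum_distrib_left)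
      moreover have "of_int (\<sigma> k j) * of_int (\<sigma> k j) = (1 :: 'b fps)"
        using sigma_sq[of k j] j k by (metis of_int_mult of_int_1 DiffE singletonI)
      moreover have "amat (\<lambda>m. fps_deriv (w m)) k j * cof w k j
         = (of_int (\<sigma> k j) * of_int (\<sigma> k j)) * (fps_deriv (w {k, j}) * ?S)"
        using j by (simp only: mult_ac amat_def cof_def) auto
      ultimately show "(\<Sum>N\<in>matchings (H - {k, j}).
           \<Sum>m\<in>insert {k, j} N. if k \<in> m then g (insert {k, j} N) m else 0)
         = amat (\<lambda>m. fps_deriv (w m)) k j * cof w k j" by simp
    qed
    also have "\<dots> = (\<Sum>j\<in>H. amat (\<lambda>m. fps_deriv (w m)) k j * cof w k j)"
      by (intro sum.mono_neutral_left) (auto simp: fin amat_def)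
    finally show "(\<Sum>M\<in>matchings H. \<Sum>m\<in>M. if k \<in> m then g M m else 0) = \<dots>" .
  qed
  finally show ?thesis .
qed

end

text \<open>The product is -1 to the number of elements before \<open>j\<close>, so the terms
  alternate 1, -1, 1, ... in the order of \<open>key\<close>.\<close>

lemma sum_alternating_rank:
  fixes key :: "'a \<Rightarrow> real"
  assumes "finite T" "inj_on key T"
  shows "(\<Sum>j\<in>T. \<Prod>q\<in>T - {j}. if key j < key q then 1 else -1 :: int) = (if odd (card T) then 1 else 0)"
  using assms
proof (induction "card T" arbitrary: T)
  case 0
  then show ?case by simp
next
  case (Suc n)
  have "T \<noteq> {}" using Suc.hyps by auto
  then obtain a where a: "a \<in> T" "\<And>b. b \<in> T \<Longrightarrow> key a \<le> key b"
    using Suc.prems arg_min_if_finite[of T key] by (metis not_le)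
  have lt: "key a < key b" if "b \<in> T - {a}" for b
    using that a Suc.prems(2) by (metis DiffD1 DiffD2 inj_onD order_le_less singletonI)
  let ?T = "T - {a}"
  have card: "card ?T = n" using a Suc by simp
  have IH: "(\<Sum>j\<in>?T. \<Prod>q\<in>?T - {j}. if key j < key q then 1 else -1 :: int) = (if odd n then 1 else 0)"
    using Suc.hyps(1)[of ?T] card Suc.prems inj_on_subset[of key T ?T] by auto
  have "(\<Sum>j\<in>T. \<Prod>q\<in>T - {j}. if key j < key q then 1 else -1 :: int)
      = (\<Prod>q\<in>T - {a}. if key a < key q then 1 else -1)
        + (\<Sum>j\<in>?T. \<Prod>q\<in>T - {j}. if key j < key q then 1 else -1)"
    using a Suc.prems by (simp add: sum.remove)
  also have "(\<Prod>q\<in>T - {a}. if key a < key q then 1 else -1 :: int) = 1"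
    using lt by (intro prod.neutral) auto
  also have "(\<Sum>j\<in>?T. \<Prod>q\<in>T - {j}. if key j < key q then 1 else -1 :: int)
     = (\<Sum>j\<in>?T. - (\<Prod>q\<in>?T - {j}. if key j < key q then 1 else -1))"
  proof (intro sum.cong refl)
    fix j assume j: "j \<in> ?T"
    have "T - {j} = insert a (?T - {j})" using a j by auto
    moreover have "\<not> key j < key a" using lt[OF j] by simp
    ultimately show "(\<Prod>q\<in>T - {j}. if key j < key q then 1 else -1 :: int)
      = - (\<Prod>q\<in>?T - {j}. if key j < key q then 1 else -1)"
      using Suc.prems by simp
  qed
  finally show ?case using IH Suc.hyps(2)[symmetric] by (simp add: sum_negf)
qed

section \<open>Matchings inside the blocks of a linear order\<close>

definition key_sign :: "('a \<Rightarrow> real) \<Rightarrow> 'a \<Rightarrow> 'a \<Rightarrow> int" where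
  "key_sign key p q = (if key p < key q then 1 else -1)"

locale keyed =
  fixes H :: "'a set" and key :: "'a \<Rightarrow> real"
  assumes finite_H: "finite H" and inj_key: "inj_on key H"

sublocale keyed \<subseteq> tournament H "key_sign key"
proof
  fix p q assume "p \<in> H" "q \<in> H" "p \<noteq> q"
  then have "key p \<noteq> key q" using inj_key by (auto simp: inj_on_def)
  then show "key_sign key q p = - key_sign key p q" by (auto simp: key_sign_def)
qed (auto simp: key_sign_def finite_H)

context keyed
begin

text \<open>The second assumption says that blocks are intervals. Match the least element
  \<open>k\<close> with some \<open>j\<close> of its block: later blocks lie beyond both and
  contribute 1, so the arc's sign is given by the rank of \<open>j\<close> in the block. These signs
  add up to 1 when the block is even and to 0 otherwise, and removing \<open>k\<close> and
  \<open>j\<close> keeps all block parities.\<close>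

lemma sum_block_matchings:
  assumes "U \<subseteq> H"
    and "\<And>p q r. \<lbrakk>p \<in> U; q \<in> U; r \<in> U; blk p = blk r; key p < key q; key q < key r\<rbrakk> \<Longrightarrow> blk q = blk p"
  shows "(\<Sum>M\<in>matchings U. if \<forall>m\<in>M. \<forall>p\<in>m. \<forall>q\<in>m. blk p = blk q then sg M else 0)
       = (if \<forall>v. even (card {q \<in> U. blk q = v}) then 1 else 0)"
  using assms
proof (induction "card U" arbitrary: U rule: less_induct)
  case less
  show ?case
  proof (cases "U = {}")
    case True
    then show ?thesis by (simp add: sg_def)
  next
    case False
    have fU: "finite U" using less.prems(1) by (rule finite_subset[OF _ finite_H])
    have injU: "inj_on key U" using less.prems(1) inj_key inj_on_subset by blast
    obtain k where k: "k \<in> U" "\<And>b. b \<in> U \<Longrightarrow> key k \<le> key b"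
      using fU False arg_min_if_finite[of U key] by (metis not_le)
    have lt: "key k < key b" if "b \<in> U" "b \<noteq> k" for b
      using that k injU by (metis inj_onD order_le_less)
    define T where "T = {j \<in> U. j \<noteq> k \<and> blk j = blk k}"
    define R where "R = (\<lambda>M. \<forall>m\<in>M. \<forall>p\<in>m. \<forall>q\<in>m. blk p = blk q)"
    define ev where "ev = (\<lambda>U. \<forall>v. even (card {q \<in> U. blk q = v}))"
    have ev: "ev (U - {k, j}) \<longleftrightarrow> ev U" if j: "j \<in> T" for j
    proof -
      have "even (card {q \<in> U - {k, j}. blk q = v}) \<longleftrightarrow> even (card {q \<in> U. blk q = v})" for v
      proof (cases "v = blk k")
        case True
        have "{q \<in> U. blk q = v} = insert k (insert j {q \<in> U - {k, j}. blk q = v})"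
          using k(1) j True by (auto simp: T_def)
        then show ?thesis using fU j by (auto simp: T_def)
      next
        case False
        then have "{q \<in> U. blk q = v} = {q \<in> U - {k, j}. blk q = v}" using j by (auto simp: T_def)
        then show ?thesis by simp
      qed
      then show ?thesis by (simp add: ev_def)
    qed
    define P where "P = (\<lambda>j. \<Prod>q\<in>T - {j}. if key j < key q then 1 else -1 :: int)"
    have step: "sg (insert {k, j} N) = P j * sg N"
      if j: "j \<in> T" and N: "N \<in> matchings (U - {k, j})" for j N
    proof -
      have "sg (insert {k, j} N) = sg N * (\<Prod>q\<in>U - {k, j}. \<Prod>p\<in>{k, j}. key_sign key p q)"
        using j k less.prems(1) by (intro sg_insert N) (auto simp: T_def)
      also have "(\<Prod>q\<in>U - {k, j}. \<Prod>p\<in>{k, j}. key_sign key p q) = P j"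
        unfolding P_def
      proof (intro prod.mono_neutral_cong_right ballI)
        show "T - {j} \<subseteq> U - {k, j}" by (auto simp: T_def)
        fix q assume q: "q \<in> U - {k, j} - (T - {j})"
        then have "key k < key q" "blk q \<noteq> blk k" using lt by (auto simp: T_def)
        moreover have "key j \<noteq> key q" using q j injU by (auto simp: T_def inj_on_def)
        moreover have "\<not> key q < key j"
          using less.prems(2)[of k q j] calculation q j k(1) by (auto simp: T_def)
        ultimately show "(\<Prod>p\<in>{k, j}. key_sign key p q) = 1" using j
          by (auto simp: key_sign_def T_def)
      next
        fix q assume "q \<in> T - {j}"
        then show "(\<Prod>p\<in>{k, j}. key_sign key p q) = (if key j < key q then 1 else -1)"
          using lt[of q] j by (auto simp: T_def key_sign_def)
      qed (simp add: fU)
      finally show ?thesis by simp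
    qed
    have "(\<Sum>M\<in>matchings U. if R M then sg M else 0)
       = (\<Sum>j\<in>U - {k}. \<Sum>N\<in>matchings (U - {k, j}). if R (insert {k, j} N) then sg (insert {k, j} N) else 0)"
      by (rule sum_matchings_expand[OF fU k(1)])
    also have "\<dots> = (\<Sum>j\<in>T. P j * (\<Sum>N\<in>matchings (U - {k, j}). if R N then sg N else 0))"
    proof (intro sum.mono_neutral_cong_right ballI)
      show "finite (U - {k})" "T \<subseteq> U - {k}" using fU by (auto simp: T_def)
    next
      fix j assume "j \<in> U - {k} - T"
      then show "(\<Sum>N\<in>matchings (U - {k, j}). if R (insert {k, j} N) then sg (insert {k, j} N) else 0) = 0"
        by (intro sum.neutral) (auto simp: T_def R_def)
    next
      fix j assume j: "j \<in> T"
      then have "R (insert {k, j} N) \<longleftrightarrow> R N" for N by (simp add: T_def R_def)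
      then show "(\<Sum>N\<in>matchings (U - {k, j}). if R (insert {k, j} N) then sg (insert {k, j} N) else 0)
        = P j * (\<Sum>N\<in>matchings (U - {k, j}). if R N then sg N else 0)"
        unfolding sum_distrib_left by (intro sum.cong refl) (simp add: step[OF j])
    qed
    also have "\<dots> = (\<Sum>j\<in>T. P j * (if ev U then 1 else 0))"
    proof (intro sum.cong refl)
      fix j assume j: "j \<in> T"
      have "U - {k, j} \<subset> U" using k by auto
      then have "card (U - {k, j}) < card U" by (rule psubset_card_mono[OF fU])
      then have "(\<Sum>N\<in>matchings (U - {k, j}). if R N then sg N else 0) = (if ev (U - {k, j}) then 1 else 0)"
        unfolding R_def ev_def
      proof (rule less.hyps)
        show "U - {k, j} \<subseteq> H" using less.prems(1) by auto
        fix p q r assume "p \<in> U - {k, j}" "q \<in> U - {k, j}" "r \<in> U - {k, j}"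
          "blk p = blk r" "key p < key q" "key q < key r"
        then show "blk q = blk p" by (intro less.prems(2)[of p q r]) auto
      qed
      then show "P j * (\<Sum>N\<in>matchings (U - {k, j}). if R N then sg N else 0)
        = P j * (if ev U then 1 else 0)" using ev[OF j] by simp
    qed
    also have "\<dots> = (\<Sum>j\<in>T. P j) * (if ev U then 1 else 0)" by (rule sum_distrib_right[symmetric])
    also have "(\<Sum>j\<in>T. P j) = (if odd (card T) then 1 else 0)"
      unfolding P_def by (rule sum_alternating_rank) (use fU injU in \<open>auto simp: T_def inj_on_def\<close>)
    also have "\<dots> * (if ev U then 1 else 0) = (if ev U then 1 else 0 :: int)"
    proof -
      have "{q \<in> U. blk q = blk k} = insert k T" using k(1) by (auto simp: T_def)
      then have "card {q \<in> U. blk q = blk k} = Suc (card T)" using fU by (simp add: T_def)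
      moreover have "ev U \<Longrightarrow> even (card {q \<in> U. blk q = blk k})" by (simp add: ev_def)
      ultimately show ?thesis by auto
    qed
    finally show ?thesis by (simp add: R_def ev_def)
  qed
qed

end

section \<open>Crossings of segments\<close>

text \<open>The positive cone of a translation-invariant total order on the plane. Horizontal
  vectors count as up when they point left because \<open>Arg\<close> is \<pi> on negative reals and
  0 on positive ones; this makes \<open>up z\<close> equivalent to \<open>Arg z > 0\<close>, so at a
  vertex the downward half-edges precede the upward ones.\<close>

definition up :: "complex \<Rightarrow> bool" where
  "up z \<longleftrightarrow> Im z > 0 \<or> (Im z = 0 \<and> Re z < 0)"

definition below :: "complex \<Rightarrow> complex \<Rightarrow> bool" where
  "below p q \<longleftrightarrow> up (q - p)"

text \<open>The oriented area of \<open>u\<close> and \<open>w\<close>, positive when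
  \<open>w\<close> points to the left of \<open>u\<close>.\<close>

definition cross2 :: "complex \<Rightarrow> complex \<Rightarrow> real" where
  "cross2 u w = Re u * Im w - Im u * Re w"

lemma up_add: "up u \<Longrightarrow> up w \<Longrightarrow> up (u + w)"
  by (auto simp: up_def)

lemma up_scaleR_iff:
  assumes "up z"
  shows "up (s *\<^sub>R z) \<longleftrightarrow> s > 0"
  using assms by (auto simp: up_def zero_less_mult_iff mult_less_0_iff)

lemma up_minus: "z \<noteq> 0 \<Longrightarrow> up (- z) \<longleftrightarrow> \<not> up z"
  by (auto simp: up_def complex_eq_iff)

lemma below_trans: "below p q \<Longrightarrow> below q r \<Longrightarrow> below p r"
  using up_add[of "q - p" "r - q"] by (simp add: below_def)

lemma below_irrefl: "\<not> below p p"
  by (simp add: below_def up_def)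

lemma below_asym: "below p q \<Longrightarrow> \<not> below q p"
  using below_trans below_irrefl by blast

lemma below_total: "p \<noteq> q \<Longrightarrow> below p q \<or> below q p"
  using up_minus[of "q - p"] by (auto simp: below_def)

lemma up_iff_Arg: "up z \<longleftrightarrow> Arg z > 0"
  by (simp add: up_def Arg_pos_iff)

text \<open>Within one half-plane the difference of arguments stays strictly between -\<pi> and
  \<pi>, where its sine has the same sign.\<close>

lemma Arg_less_iff_cross2:
  assumes "u \<noteq> 0" "w \<noteq> 0" "up u \<longleftrightarrow> up w"
  shows "Arg u < Arg w \<longleftrightarrow> cross2 u w > 0"
proof -
  have "cross2 u w = cmod u * cmod w * sin (Arg w - Arg u)"
  proof -
    have "Im u = cmod u * sin (Arg u)" "Re u = cmod u * cos (Arg u)"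
         "Im w = cmod w * sin (Arg w)" "Re w = cmod w * cos (Arg w)"
      using assms by (simp_all add: sin_Arg cos_Arg)
    then have "cross2 u w = cmod u * cos (Arg u) * (cmod w * sin (Arg w)) - cmod u * sin (Arg u) * (cmod w * cos (Arg w))"
      unfolding cross2_def by metis
    then show ?thesis by (simp add: sin_diff algebra_simps)
  qed
  then have c: "cross2 u w > 0 \<longleftrightarrow> sin (Arg w - Arg u) > 0"
    using mult_pos_pos[of "cmod u" "cmod w"] assms(1,2)
    by (metis zero_less_mult_pos mult_pos_pos zero_less_norm_iff)
  have b: "- pi < Arg u" "Arg u \<le> pi" "- pi < Arg w" "Arg w \<le> pi" using Arg_bounded by auto
  have d: "Arg w - Arg u < pi" "Arg w - Arg u > - pi"
    using assms(3) b by (auto simp: up_iff_Arg; linarith)+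
  show ?thesis
  proof (cases "Arg u < Arg w")
    case True
    then show ?thesis using c d sin_gt_zero[of "Arg w - Arg u"] by auto
  next
    case False
    then have "sin (Arg u - Arg w) \<ge> 0" using d by (intro sin_ge_zero) auto
    then have "sin (Arg w - Arg u) \<le> 0" using sin_minus[of "Arg u - Arg w"] by simp
    then show ?thesis using False c by auto
  qed
qed

lemma cross2_eq_0_imp_scaleR:
  assumes "X \<noteq> 0" "cross2 X q = 0"
  obtains s where "q = s *\<^sub>R X"
proof
  define n where "n = Re X * Re X + Im X * Im X"
  have "n \<noteq> 0" using assms(1) by (simp add: n_def complex_eq_iff sum_squares_eq_zero_iff)
  \<comment> \<open>The scalar \<open>m / n\<close> is the coefficient of the orthogonal projection
    of \<open>q\<close> onto \<open>X\<close>.\<close>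
  define m where "m = Re X * Re q + Im X * Im q"
  have "Re X * Im q = Im X * Re q" using assms(2) by (simp add: cross2_def)
  then have "n * Re q = m * Re X" "n * Im q = m * Im X"
    unfolding n_def m_def by algebra+
  then show "q = (m / n) *\<^sub>R X"
    using \<open>n \<noteq> 0\<close> by (simp add: complex_eq_iff field_simps)
qed

section \<open>Crossing criteria for two edges from heights and sides\<close>

locale plane_graph =
  fixes V :: "complex set" and E :: "complex set set"
  assumes emb: "embedded_graph V E"
begin

lemma finite_V: "finite V"
  using emb by (simp add: embedded_graph_def)

lemma edge_cases:
  assumes "e \<in> E"
  obtains a b where "e = {a, b}" "a \<in> V" "b \<in> V" "below a b"
proof -
  obtain u v where uv: "e = {u, v}" "u \<in> V" "v \<in> V" "u \<noteq> v"
    using emb assms by (auto simp: embedded_graph_def)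
  then show ?thesis using below_total[of u v] that by (metis insert_commute)
qed

lemma edge_V: "{u, v} \<in> E \<Longrightarrow> u \<in> V \<and> v \<in> V \<and> u \<noteq> v"
  by (erule edge_cases) (use below_irrefl in \<open>auto simp: doubleton_eq_iff\<close>)

lemma finite_E: "finite E"
proof (rule finite_subset)
  show "E \<subseteq> Pow V"
    by (auto elim!: edge_cases)
qed (simp add: finite_V)

lemma not_in_segment:
  assumes "{a, b} \<in> E" "v \<in> V" "v = a + s *\<^sub>R (b - a)" "0 < s" "s < 1"
  shows False
proof -
  have "a \<noteq> b" using edge_V[OF assms(1)] by simp
  then have "v \<in> open_segment a b"
    unfolding in_segment assms(3)
    using assms(4,5) by (intro conjI exI[of _ s]) (auto simp: algebra_simps)
  then show False using emb assms by (auto simp: embedded_graph_def)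
qed

text \<open>On the line of the edge, a height strictly between the ends forces a parameter strictly
  between 0 and 1, so the vertex would be interior to the edge.\<close>

lemma cross2_nonzero:
  assumes "{a, b} \<in> E" "v \<in> V" "below a v" "below v b"
  shows "cross2 (b - a) (v - a) \<noteq> 0"
proof
  assume c: "cross2 (b - a) (v - a) = 0"
  have ab: "up (b - a)" using below_trans[OF assms(3,4)] by (simp add: below_def)
  have "b - a \<noteq> 0" using edge_V[OF assms(1)] by auto
  then obtain s where s: "v - a = s *\<^sub>R (b - a)" using c by (rule cross2_eq_0_imp_scaleR)
  have "s > 0" using assms(3) ab s by (simp add: below_def up_scaleR_iff)
  moreover have "b - v = (1 - s) *\<^sub>R (b - a)" using s by (simp add: algebra_simps)
  then have "s < 1" using assms(4) ab up_scaleR_iff[of "b - a" "1 - s"] by (simp add: below_def)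
  ultimately show False using not_in_segment[OF assms(1,2), of s] s by (simp add: algebra_simps)
qed

text \<open>Otherwise the shorter edge ends in the interior of the longer one. This gives distinct
  directions at a vertex and excludes a turn by \<pi>.\<close>

lemma same_ray:
  assumes "{a, b} \<in> E" "{a, d} \<in> E" "d - a = s *\<^sub>R (b - a)" "s > 0"
  shows "b = d"
proof (cases "s < 1")
  case True
  have "d = a + s *\<^sub>R (b - a)" unfolding assms(3)[symmetric] by simp
  then show ?thesis using not_in_segment[OF assms(1), of d s] assms(4) edge_V[OF assms(2)] True by blast
next
  case False
  show ?thesis
  proof (cases "s = 1")
    case True
    then show ?thesis using assms by simp
  next
    case n: False
    have "b - a = (1 / s) *\<^sub>R (d - a)" using assms by simp
    then have "b = a + (1 / s) *\<^sub>R (d - a)" by (metis add_diff_cancel_left' diff_add_cancel add.commute)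
    moreover have "0 < 1 / s" "1 / s < 1" using n False by auto
    ultimately show ?thesis using not_in_segment[OF assms(2), of b "1/s"] edge_V[OF assms(1)] by blast
  qed
qed

text \<open>Parameters 0 and 1 give vertices and interior points of edges are never vertices, so
  avoiding \<open>V\<close> amounts to open parameter ranges.\<close>

lemma crosses_iff:
  assumes e: "{a, b} \<in> E" "{c, d} \<in> E" "{a, b} \<noteq> {c, d}"
  shows "crosses V {a, b} {c, d} \<longleftrightarrow>
    (\<exists>s t. 0 < s \<and> s < 1 \<and> 0 < t \<and> t < 1 \<and> a + s *\<^sub>R (b - a) = c + t *\<^sub>R (d - c))"
proof
  assume "crosses V {a, b} {c, d}"
  then obtain p where p: "p \<in> closed_segment a b" "p \<in> closed_segment c d" "p \<notin> V"
    by (auto simp: crosses_def segment_convex_hull)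
  obtain s where s: "0 \<le> s" "s \<le> 1" "p = a + s *\<^sub>R (b - a)"
    using p(1) by (auto simp: in_segment algebra_simps)
  obtain t where t: "0 \<le> t" "t \<le> 1" "p = c + t *\<^sub>R (d - c)"
    using p(2) by (auto simp: in_segment algebra_simps)
  have "s \<noteq> 0" "s \<noteq> 1" "t \<noteq> 0" "t \<noteq> 1"
    using s(3) t(3) p(3) edge_V[OF e(1)] edge_V[OF e(2)] by auto
  then show "\<exists>s t. 0 < s \<and> s < 1 \<and> 0 < t \<and> t < 1 \<and> a + s *\<^sub>R (b - a) = c + t *\<^sub>R (d - c)"
    using s t by (intro exI[of _ s] exI[of _ t]) auto
next
  assume "\<exists>s t. 0 < s \<and> s < 1 \<and> 0 < t \<and> t < 1 \<and> a + s *\<^sub>R (b - a) = c + t *\<^sub>R (d - c)"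
  then obtain s t where st: "0 < s" "s < 1" "0 < t" "t < 1" "a + s *\<^sub>R (b - a) = c + t *\<^sub>R (d - c)"
    by blast
  define p where "p = a + s *\<^sub>R (b - a)"
  have "p \<in> closed_segment a b" "p \<in> closed_segment c d"
  proof -
    have "p = (1 - s) *\<^sub>R a + s *\<^sub>R b" by (simp add: p_def algebra_simps)
    then show "p \<in> closed_segment a b" using st(1,2) unfolding in_segment by (intro exI[of _ s]) auto
    have "p = (1 - t) *\<^sub>R c + t *\<^sub>R d" unfolding p_def st(5) by (simp add: algebra_simps)
    then show "p \<in> closed_segment c d" using st(3,4) unfolding in_segment by (intro exI[of _ t]) auto
  qed
  moreover have "p \<notin> V" using not_in_segment[OF e(1), of p s] st p_def by blast
  ultimately show "crosses V {a, b} {c, d}"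
    using e(3) by (auto simp: crosses_def segment_convex_hull)
qed

lemma not_crosses_common:
  assumes "{a, b} \<in> E" "{a, d} \<in> E" "b \<noteq> d" "cross2 (b - a) (d - a) \<noteq> 0"
  shows "\<not> crosses V {a, b} {a, d}"
proof
  assume "crosses V {a, b} {a, d}"
  then obtain s t where st: "0 < s" "0 < t" "s *\<^sub>R (b - a) = t *\<^sub>R (d - a)"
    using assms by (subst (asm) crosses_iff) (auto simp: doubleton_eq_iff)
  have "s * cross2 (b - a) (d - a) = cross2 (s *\<^sub>R (b - a)) (d - a)"
    by (simp add: cross2_def algebra_simps)
  also have "\<dots> = 0" unfolding st(3) by (simp add: cross2_def algebra_simps)
  finally show False using st assms(4) by simp
qed

text \<open>A crossing point would lie strictly above \<open>c\<close> and strictly below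
  \<open>b\<close>.\<close>

lemma not_crosses_above:
  assumes "{a, b} \<in> E" "{c, d} \<in> E" "below a b" "below c d" "b = c \<or> below b c"
  shows "\<not> crosses V {a, b} {c, d}"
proof
  have "a \<noteq> c" "a \<noteq> d"
    using assms(3-5) below_trans[of a b c] below_trans[of a c d] below_irrefl[of a] by auto
  then have ne: "{a, b} \<noteq> {c, d}" by (auto simp: doubleton_eq_iff)
  assume "crosses V {a, b} {c, d}"
  then obtain s t where st: "0 < s" "s < 1" "0 < t" "t < 1" "a + s *\<^sub>R (b - a) = c + t *\<^sub>R (d - c)"
    using assms ne by (subst (asm) crosses_iff) auto
  have "up ((1 - s) *\<^sub>R (b - a))" "up (t *\<^sub>R (d - c))"
    using assms st by (auto simp: below_def up_scaleR_iff)
  then have "up ((1 - s) *\<^sub>R (b - a) + t *\<^sub>R (d - c))" by (rule up_add)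
  also have "(1 - s) *\<^sub>R (b - a) + t *\<^sub>R (d - c) = b - c"
    using st(5) by (simp add: algebra_simps)
  finally have "below c b" by (simp add: below_def)
  then show False using assms(5) below_asym below_irrefl by blast
qed

text \<open>The segment from \<open>c\<close> to \<open>d\<close> meets the line through
  \<open>a\<close> and \<open>b\<close> iff its ends lie on opposite sides; the nested heights then
  place the meeting point inside the edge from \<open>a\<close> to \<open>b\<close>.\<close>

lemma crosses_nested:
  assumes e: "{a, b} \<in> E" "{c, d} \<in> E" and o: "below a c" "below c d" "below d b"
  shows "crosses V {a, b} {c, d} \<longleftrightarrow> (cross2 (b - a) (c - a) < 0) \<noteq> (cross2 (b - a) (d - a) < 0)"
proof -
  define \<beta> \<gamma> where "\<beta> = cross2 (b - a) (c - a)" and "\<gamma> = cross2 (b - a) (d - a)"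
  have cV: "c \<in> V" "d \<in> V" using edge_V[OF e(2)] by auto
  have "a \<noteq> c" "a \<noteq> d"
    using o below_trans[of a c] below_irrefl[of a] below_trans[of a b d] below_trans[of a c b] by auto
  then have ne: "{a, b} \<noteq> {c, d}" by (auto simp: doubleton_eq_iff)
  have nz: "\<beta> \<noteq> 0" "\<gamma> \<noteq> 0"
    unfolding \<beta>_def \<gamma>_def
    using cross2_nonzero[OF e(1) cV(1) o(1)] cross2_nonzero[OF e(1) cV(2) _ o(3)]
      below_trans[OF o(1,2)] below_trans[OF o(2,3)] by auto
  have abup: "up (b - a)"
    using below_trans[OF o(1) below_trans[OF o(2,3)]] by (simp add: below_def)
  show ?thesis
  proof
    assume "crosses V {a, b} {c, d}"
    then obtain s t where st: "0 < s" "s < 1" "0 < t" "t < 1" "a + s *\<^sub>R (b - a) = c + t *\<^sub>R (d - c)"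
      using e ne by (subst (asm) crosses_iff) auto
    have "(1 - t) *\<^sub>R (c - a) + t *\<^sub>R (d - a) = s *\<^sub>R (b - a)"
      using st(5) by (simp add: algebra_simps)
    moreover have "cross2 (b - a) (s *\<^sub>R (b - a)) = 0" by (simp add: cross2_def)
    moreover have "cross2 (b - a) ((1 - t) *\<^sub>R (c - a) + t *\<^sub>R (d - a)) = (1 - t) * \<beta> + t * \<gamma>"
      unfolding \<beta>_def \<gamma>_def cross2_def by (simp add: algebra_simps)
    ultimately have z: "(1 - t) * \<beta> + t * \<gamma> = 0" by metis
    have "\<not> (\<beta> < 0 \<and> \<gamma> < 0)"
      using z st mult_pos_neg[of "1 - t" \<beta>] mult_pos_neg[of t \<gamma>] by linarith
    moreover have "\<not> (\<beta> > 0 \<and> \<gamma> > 0)"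
      using z st mult_pos_pos[of "1 - t" \<beta>] mult_pos_pos[of t \<gamma>] by linarith
    ultimately show "(cross2 (b - a) (c - a) < 0) \<noteq> (cross2 (b - a) (d - a) < 0)"
      using nz unfolding \<beta>_def[symmetric] \<gamma>_def[symmetric] by auto
  next
    assume "(cross2 (b - a) (c - a) < 0) \<noteq> (cross2 (b - a) (d - a) < 0)"
    then have opp: "(\<beta> < 0 \<and> \<gamma> > 0) \<or> (\<beta> > 0 \<and> \<gamma> < 0)"
      using nz unfolding \<beta>_def[symmetric] \<gamma>_def[symmetric] by auto
    \<comment> \<open>The zero of the affine function with value \<beta> at \<open>c\<close> and
      \<gamma> at \<open>d\<close>, which measures the position relative to the line through
      \<open>a\<close> and \<open>b\<close>.\<close>
    define t where "t = \<beta> / (\<beta> - \<gamma>)"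
    have t: "0 < t" "t < 1" "(1 - t) * \<beta> + t * \<gamma> = 0"
      using opp unfolding t_def by (auto simp: field_simps)
    define q where "q = (1 - t) *\<^sub>R (c - a) + t *\<^sub>R (d - a)"
    have "cross2 (b - a) q = (1 - t) * \<beta> + t * \<gamma>"
      unfolding q_def \<beta>_def \<gamma>_def cross2_def by (simp add: algebra_simps)
    moreover have "b - a \<noteq> 0" using edge_V[OF e(1)] by auto
    ultimately obtain s where s: "q = s *\<^sub>R (b - a)" using t(3) cross2_eq_0_imp_scaleR by metis
    have "up q" unfolding q_def using t o below_trans[OF o(1,2)]
      by (intro up_add) (auto simp: up_scaleR_iff below_def)
    then have s0: "s > 0" using s abup by (simp add: up_scaleR_iff)
    have "up ((1 - t) *\<^sub>R (b - c) + t *\<^sub>R (b - d))" using t o below_trans[OF o(2,3)]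
      by (intro up_add) (auto simp: up_scaleR_iff below_def)
    also have "(1 - t) *\<^sub>R (b - c) + t *\<^sub>R (b - d) = (b - a) - q"
      unfolding q_def by (simp add: algebra_simps)
    also have "\<dots> = (1 - s) *\<^sub>R (b - a)" unfolding s by (simp add: algebra_simps)
    finally have s1: "s < 1" using up_scaleR_iff[OF abup, of "1 - s"] by simp
    have "a + s *\<^sub>R (b - a) = c + t *\<^sub>R (d - c)"
      unfolding s[symmetric] q_def by (simp add: algebra_simps)
    then show "crosses V {a, b} {c, d}"
      using e ne s0 s1 t by (subst crosses_iff) blast+
  qed
qed

text \<open>At parameters \<open>s\<close>, \<open>t\<close> of a meeting point, \<gamma> is
  \<open>t * D\<close> and \<beta> is \<open>(1 - s) * D\<close>, so a crossing forces equal signs.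
  Conversely Cramer's rule gives the parameters, and the heights of the ends confine them to the
  open unit interval.\<close>

lemma crosses_interleaved:
  assumes e: "{a, b} \<in> E" "{c, d} \<in> E" and o: "below a c" "below c b" "below b d"
  shows "crosses V {a, b} {c, d} \<longleftrightarrow> (cross2 (b - a) (c - a) < 0) = (cross2 (d - c) (b - c) < 0)"
proof -
  define \<beta> \<gamma> D where "\<beta> = cross2 (d - c) (b - c)" and "\<gamma> = cross2 (b - a) (c - a)"
    and "D = cross2 (d - c) (b - a)"
  have cV: "c \<in> V" "b \<in> V" using edge_V[OF e(2)] edge_V[OF e(1)] by auto
  have "a \<noteq> c" "a \<noteq> d"
    using o below_trans[of a c] below_irrefl[of a] below_trans[of a b d] below_trans[of a c b] by auto
  then have ne: "{a, b} \<noteq> {c, d}" by (auto simp: doubleton_eq_iff)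
  have nz: "\<beta> \<noteq> 0" "\<gamma> \<noteq> 0"
    unfolding \<beta>_def \<gamma>_def
    using cross2_nonzero[OF e(1) cV(1) o(1,2)] cross2_nonzero[OF e(2) cV(2) o(2,3)] by auto
  have abup: "up (b - a)" "up (d - c)"
    using below_trans[OF o(1,2)] below_trans[OF o(2,3)] by (auto simp: below_def)
  show ?thesis
  proof
    assume "crosses V {a, b} {c, d}"
    then obtain s t where st: "0 < s" "s < 1" "0 < t" "t < 1" "a + s *\<^sub>R (b - a) = c + t *\<^sub>R (d - c)"
      using e ne by (subst (asm) crosses_iff) auto
    have "c - a = s *\<^sub>R (b - a) - t *\<^sub>R (d - c)" using st(5) by (simp add: algebra_simps)
    then have "\<gamma> = cross2 (b - a) (s *\<^sub>R (b - a) - t *\<^sub>R (d - c))" by (simp only: \<gamma>_def)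
    then have g: "\<gamma> = t * D" by (simp add: D_def cross2_def algebra_simps)
    have "b - c = (1 - s) *\<^sub>R (b - a) + t *\<^sub>R (d - c)" using st(5) by (simp add: algebra_simps)
    then have "\<beta> = cross2 (d - c) ((1 - s) *\<^sub>R (b - a) + t *\<^sub>R (d - c))" by (simp only: \<beta>_def)
    then have "\<beta> = (1 - s) * D" by (simp add: D_def cross2_def algebra_simps)
    then have "(\<beta> < 0) = (\<gamma> < 0)" using g st by (simp add: mult_less_0_iff)
    then show "(cross2 (b - a) (c - a) < 0) = (cross2 (d - c) (b - c) < 0)"
      by (auto simp: \<beta>_def \<gamma>_def)
  next
    assume "(cross2 (b - a) (c - a) < 0) = (cross2 (d - c) (b - c) < 0)"
    then have same: "(\<beta> < 0 \<and> \<gamma> < 0) \<or> (\<beta> > 0 \<and> \<gamma> > 0)"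
      using nz unfolding \<beta>_def[symmetric] \<gamma>_def[symmetric] by auto
    \<comment> \<open>Cramer's identity for \<open>b - c\<close> in terms of the two edge
      directions. As all three vectors point up, \<open>D\<close> inherits the common sign of
      \<beta> and \<gamma>, and is nonzero.\<close>
    have id: "\<beta> *\<^sub>R (b - a) + \<gamma> *\<^sub>R (d - c) = D *\<^sub>R (b - c)"
      unfolding \<beta>_def \<gamma>_def D_def cross2_def by (simp add: complex_eq_iff algebra_simps)
    have upbc: "up (b - c)" using o(2) by (simp add: below_def)
    have D: "\<beta> / D > 0 \<and> \<gamma> / D > 0"
    proof (cases "\<beta> > 0")
      case True
      then have "up (\<beta> *\<^sub>R (b - a) + \<gamma> *\<^sub>R (d - c))"
        using same abup by (intro up_add) (auto simp: up_scaleR_iff)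
      then have "D > 0" using id upbc by (simp add: up_scaleR_iff)
      then show ?thesis using True same by auto
    next
      case False
      then have n: "\<beta> < 0" "\<gamma> < 0" using same by auto
      then have "up ((- \<beta>) *\<^sub>R (b - a) + (- \<gamma>) *\<^sub>R (d - c))"
        using abup by (intro up_add) (subst up_scaleR_iff; simp)+
      also have "(- \<beta>) *\<^sub>R (b - a) + (- \<gamma>) *\<^sub>R (d - c) = (- D) *\<^sub>R (b - c)"
        using id by (simp add: algebra_simps)
      finally have "D < 0" using up_scaleR_iff[OF upbc, of "- D"] by simp
      then show ?thesis using n by (auto simp: divide_neg_neg)
    qed
    define s t where "s = 1 - \<beta> / D" and "t = \<gamma> / D"
    have s1: "s < 1" and t0: "t > 0" using D by (auto simp: s_def t_def)
    have "D \<noteq> 0" using D by auto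
    have "(\<beta> / D) *\<^sub>R (b - a) + (\<gamma> / D) *\<^sub>R (d - c) = (1 / D) *\<^sub>R (D *\<^sub>R (b - c))"
      unfolding id[symmetric] by (simp add: algebra_simps)
    also have "\<dots> = b - c" using \<open>D \<noteq> 0\<close> by simp
    finally have eq: "a + s *\<^sub>R (b - a) = c + t *\<^sub>R (d - c)"
      unfolding s_def t_def by (simp add: algebra_simps)
    have "up (t *\<^sub>R (d - c) + (c - a))"
      using t0 abup o(1) by (intro up_add) (auto simp: up_scaleR_iff below_def)
    also have "t *\<^sub>R (d - c) + (c - a) = s *\<^sub>R (b - a)" using eq by (simp add: algebra_simps)
    finally have s0: "s > 0" using abup by (simp add: up_scaleR_iff)
    have "up ((1 - s) *\<^sub>R (b - a) + (d - b))"
      using s1 abup o(3) by (intro up_add) (auto simp: up_scaleR_iff below_def)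
    also have "(1 - s) *\<^sub>R (b - a) + (d - b) = (1 - t) *\<^sub>R (d - c)" using eq by (simp add: algebra_simps)
    finally have t1: "t < 1" using up_scaleR_iff[OF abup(2), of "1 - t"] by simp
    show "crosses V {a, b} {c, d}"
      using e ne s0 s1 t0 t1 eq by (subst crosses_iff) blast+
  qed
qed

end

section \<open>The sign of the edge matching\<close>

text \<open>A half-edge is a pair of its origin and the opposite end of its edge. The two half-edges
  of one edge form one arc of the edge matching.\<close>

definition ends :: "'a set \<Rightarrow> ('a \<times> 'a) set" where
  "ends e = {h. {fst h, snd h} = e}"

lemma ends_doubleton: "ends {a, b} = {(a, b), (b, a)}"
  by (auto simp: ends_def doubleton_eq_iff)

lemma ends_disjoint: "e \<noteq> f \<Longrightarrow> ends e \<inter> ends f = {}"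
  by (auto simp: ends_def)

context plane_graph
begin

definition rank :: "complex \<Rightarrow> nat" where
  "rank v = card {u \<in> V. below u v}"

definition hedges :: "(complex \<times> complex) set" where
  "hedges = {(u, v). {u, v} \<in> E}"

text \<open>The factor 10 exceeds \<open>2\<pi>\<close>, so the key orders by height first and by angle second.\<close>

definition hkey :: "complex \<times> complex \<Rightarrow> real" where
  "hkey h = 10 * real (rank (fst h)) + Arg (snd h - fst h)"

lemma rank_less:
  assumes "u \<in> V" "below u v"
  shows "rank u < rank v"
  unfolding rank_def
proof (rule psubset_card_mono)
  show "{w \<in> V. below w u} \<subset> {w \<in> V. below w v}"
    using assms below_trans below_irrefl by blast
qed (simp add: finite_V)

lemma hkey_less:
  assumes "p \<in> V" "below p p'"
  shows "hkey (p, q) < hkey (p', q')"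
proof -
  have "real (rank p) + 1 \<le> real (rank p')" using rank_less[OF assms] by linarith
  moreover have "- pi < Arg (q' - p')" "Arg (q - p) \<le> pi" using Arg_bounded by auto
  ultimately show ?thesis unfolding hkey_def fst_conv snd_conv using pi_less_4 by linarith
qed

lemma finite_hedges: "finite hedges"
proof (rule finite_subset)
  show "hedges \<subseteq> V \<times> V" using edge_V by (auto simp: hedges_def)
qed (simp add: finite_V)

text \<open>Equal keys force a common origin and equal arguments, and \<open>same_ray\<close>
  identifies two edges leaving a vertex in the same direction.\<close>

lemma hkey_inj: "inj_on hkey hedges"
proof (rule inj_onI)
  fix h h' assume "h \<in> hedges" "h' \<in> hedges" and eq: "hkey h = hkey h'"
  then obtain u v u' v' where h: "h = (u, v)" "h' = (u', v')" "{u, v} \<in> E" "{u', v'} \<in> E"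
    by (auto simp: hedges_def)
  have u: "u = u'"
    using below_total[of u u'] hkey_less[of u u' v v'] hkey_less[of u' u v' v] eq h edge_V by fastforce
  then have A: "Arg (v - u) = Arg (v' - u)" using eq h by (simp add: hkey_def)
  have nz: "v - u \<noteq> 0" "v' - u \<noteq> 0" using edge_V[OF h(3)] edge_V[OF h(4)] u by auto
  obtain s where s: "s > 0" "v' - u = of_real s * (v - u)"
  proof -
    define z where "z = exp (\<i> * Arg (v - u))"
    have 1: "v - u = of_real (cmod (v - u)) * z" using Arg_eq nz(1) unfolding z_def by blast
    have 2: "v' - u = of_real (cmod (v' - u)) * z" using Arg_eq nz(2) unfolding z_def A by blast
    have "of_real (cmod (v' - u) / cmod (v - u)) * (v - u)
        = of_real (cmod (v' - u) / cmod (v - u)) * (of_real (cmod (v - u)) * z)" using 1 by metis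
    also have "\<dots> = v' - u" using 2 nz(1) by (simp add: field_simps)
    finally have "v' - u = of_real (cmod (v' - u) / cmod (v - u)) * (v - u)" ..
    moreover have "cmod (v' - u) / cmod (v - u) > 0" using nz by simp
    ultimately show thesis using that by blast
  qed
  have "v = v'" using same_ray[of u v v' s] h s u by (simp add: scaleR_conv_of_real)
  then show "h = h'" using h u by simp
qed

sublocale keyed hedges hkey
  by unfold_locales (simp_all add: finite_hedges hkey_inj)

lemma key_sign_below:
  assumes "p \<in> V" "below p p'"
  shows "key_sign hkey (p, q) (p', q') = 1" "key_sign hkey (p', q') (p, q) = -1"
  using hkey_less[OF assms] by (auto simp: key_sign_def intro: less_imp_le) (meson not_less_iff_gr_or_eq)

lemma key_sign_same: "key_sign hkey (p, q) (p, q') = (if Arg (q - p) < Arg (q' - p) then 1 else -1)"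
  by (simp add: key_sign_def hkey_def)

text \<open>The value -1 means that \<open>v\<close> lies at a height strictly between the ends of
  \<open>f\<close> and to the right of \<open>f\<close> directed upwards. The existential picks this
  direction, since \<open>f\<close> is an unordered pair.\<close>

definition side :: "complex \<Rightarrow> complex set \<Rightarrow> int" where
  "side v f = (if \<exists>a b. f = {a, b} \<and> below a v \<and> below v b \<and> cross2 (b - a) (v - a) < 0 then -1 else 1)"

lemma side_eq:
  assumes "below a b"
  shows "side v {a, b} = (if below a v \<and> below v b \<and> cross2 (b - a) (v - a) < 0 then -1 else 1)"
proof -
  have "a' = a \<and> b' = b" if "{a, b} = {a', b'}" "below a' v" "below v b'" for a' b'
    using that below_trans[of a' v b'] below_asym[OF assms] by (auto simp: doubleton_eq_iff)
  then show ?thesis unfolding side_def by metis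
qed

lemma side_sq: "side v f * side v f = 1"
  by (simp add: side_def)

lemma side_end: "v \<in> f \<Longrightarrow> side v f = 1"
  using below_irrefl by (auto simp: side_def)

definition crs :: "complex set \<Rightarrow> complex set \<Rightarrow> int" where
  "crs e f = (if crosses V e f then -1 else 1)"

lemma crs_sym: "crs e f = crs f e"
  by (auto simp: crs_def crosses_def)

lemma ends_sub: "e \<in> E \<Longrightarrow> ends e \<subseteq> hedges"
  by (auto simp: ends_def hedges_def)

lemma ends_card:
  assumes "e \<in> E"
  shows "card (ends e) = 2"
proof -
  obtain a b where "e = {a, b}" "below a b" using edge_cases[OF assms] .
  moreover from this have "(a, b) \<noteq> (b, a)" using below_irrefl by auto
  ultimately show ?thesis by (simp add: ends_doubleton)
qed

lemma chi_ends:
  assumes "a \<noteq> b" "c \<noteq> d"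
  shows "chi (ends {a, b}) (ends {c, d}) = key_sign hkey (a, b) (c, d) * key_sign hkey (a, b) (d, c)
    * (key_sign hkey (b, a) (c, d) * key_sign hkey (b, a) (d, c))"
  using assms by (simp add: chi_def ends_doubleton)

lemma chi_ends_sym:
  assumes "e \<in> E" "f \<in> E" "e \<noteq> f"
  shows "chi (ends f) (ends e) = chi (ends e) (ends f)"
  using assms by (intro chi_sym ends_sub ends_card ends_disjoint)

text \<open>The heights of the four ends leave five patterns. Disjoint ranges: no sign occurs at
  all. Nested ranges: the arcs do not cross, and the segments cross iff \<open>c\<close> and
  \<open>d\<close> lie on different sides. Interleaved ranges: the arcs cross, and the segments
  cross iff the two relevant sides agree. A common bottom or top: the segments do not cross, and
  comparing angles at the shared vertex reproduces the one nontrivial side factor.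
  \<open>chi_ends_eq\<close> gets the remaining orders by symmetry.\<close>

lemma chi_ends_ordered:
  assumes e: "{a, b} \<in> E" "{c, d} \<in> E" "{a, b} \<noteq> {c, d}" and o: "below a b" "below c d"
    and ac: "below a c \<or> (a = c \<and> below b d)"
  shows "chi (ends {a, b}) (ends {c, d}) = crs {a, b} {c, d} *
    ((side a {c, d} * side b {c, d}) * (side c {a, b} * side d {a, b}))"
proof -
  have V: "a \<in> V" "b \<in> V" "c \<in> V" "d \<in> V" and ne: "a \<noteq> b" "c \<noteq> d"
    using edge_V[OF e(1)] edge_V[OF e(2)] by auto
  note chi = chi_ends[OF ne]
  note ks = key_sign_below[OF V(1)] key_sign_below[OF V(2)] key_sign_below[OF V(3)] key_sign_below[OF V(4)]
  note irr = below_irrefl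
  consider (bot) "a = c" "below b d" | (disj) "below a c" "b = c \<or> below b c"
    | (top) "below a c" "b = d" | (nest) "below a c" "below d b"
    | (inter) "below a c" "below c b" "below b d"
    using ac below_total[of b c] below_total[of b d] by blast
  then show ?thesis
  proof cases
    case bot
    have ad: "below a d" using o bot by blast
    have na: "\<not> below d b" "\<not> below b a" "\<not> below d a" using bot o below_asym by blast+
    have nz: "cross2 (d - a) (b - a) \<noteq> 0"
      using cross2_nonzero[of a d b] e bot V o by auto
    have "\<not> crosses V {c, d} {a, b}"
      using not_crosses_common[of a d b] e bot nz irr by (auto simp: insert_commute)
    then have crs: "crs {a, b} {c, d} = 1" unfolding crs_sym[of "{a, b}"] by (simp add: crs_def)
    have "Arg (b - a) < Arg (d - a) \<longleftrightarrow> cross2 (b - a) (d - a) > 0"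
      using o bot(1) ne by (intro Arg_less_iff_cross2) (auto simp: below_def)
    also have "\<dots> \<longleftrightarrow> cross2 (d - a) (b - a) < 0" by (simp add: cross2_def mult.commute)
    finally have A: "Arg (b - a) < Arg (d - a) \<longleftrightarrow> cross2 (d - a) (b - a) < 0" .
    show ?thesis unfolding chi crs side_eq[OF o(1)] side_eq[OF o(2)]
      using bot o ad na irr A by (simp add: ks key_sign_same)
  next
    case disj
    have bd: "below b d" using disj o below_trans by blast
    have ad: "below a d" using o disj below_trans by blast
    have na: "\<not> below d b" "\<not> below b a" "\<not> below d a" "\<not> below c a" "\<not> below c b"
      using bd ad disj o irr by (auto dest: below_asym)
    have "\<not> crosses V {a, b} {c, d}" using disj e o by (intro not_crosses_above) auto
    then have crs: "crs {a, b} {c, d} = 1" by (simp add: crs_def)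
    show ?thesis
    proof (cases "b = c")
      case True
      have "Arg (a - c) \<le> 0" using o(1) True below_asym[OF o(1)] up_iff_Arg[of "a - c"] by (simp add: below_def)
      moreover have "Arg (d - c) > 0" using o(2) by (simp add: below_def up_iff_Arg)
      ultimately have "Arg (a - c) < Arg (d - c)" by simp
      then show ?thesis unfolding chi crs side_eq[OF o(1)] side_eq[OF o(2)]
        using disj o ad na irr bd True by (simp add: ks key_sign_same)
    next
      case False
      then have bc: "below b c" using disj by simp
      show ?thesis unfolding chi crs side_eq[OF o(1)] side_eq[OF o(2)]
        using disj o ad na irr bd bc by (simp add: ks)
    qed
  next
    case top
    have na: "\<not> below b a" "\<not> below c a" "\<not> below b c" using top o by (auto dest: below_asym)
    have cb: "below c b" using top o by simp
    have ac': "a \<noteq> c" using top irr by auto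
    have nz: "cross2 (b - a) (c - a) \<noteq> 0"
      using cross2_nonzero[of a b c] e top V o by auto
    then have "cross2 (a - b) (c - b) \<noteq> 0" by (simp add: cross2_def algebra_simps)
    then have "\<not> crosses V {b, a} {b, c}"
      using not_crosses_common[of b a c] e top ac' by (auto simp: insert_commute)
    then have crs: "crs {a, b} {c, d} = 1" using top by (simp add: crs_def insert_commute)
    have "Arg (a - b) < Arg (c - b) \<longleftrightarrow> cross2 (a - b) (c - b) > 0"
      using o na top ne by (intro Arg_less_iff_cross2) (auto simp: below_def)
    also have "\<dots> \<longleftrightarrow> cross2 (b - a) (c - a) < 0" by (simp add: cross2_def algebra_simps)
    finally have A: "Arg (a - b) < Arg (c - b) \<longleftrightarrow> cross2 (b - a) (c - a) < 0" .
    show ?thesis unfolding chi crs side_eq[OF o(1)] side_eq[OF o(2)]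
      using top o na irr A cb by (simp add: ks key_sign_same)
  next
    case nest
    have t: "below a d" "below c b" using nest o below_trans by blast+
    have na: "\<not> below d a" "\<not> below b c" "\<not> below c a" "\<not> below b d" "\<not> below b a" "\<not> below d c"
      using t nest o by (auto dest: below_asym)
    show ?thesis unfolding chi crs_def side_eq[OF o(1)] side_eq[OF o(2)]
      using crosses_nested[OF e(1,2) nest(1) o(2) nest(2)] nest t na o irr by (simp add: ks)
  next
    case inter
    have t: "below a d" using inter o below_trans by blast
    have na: "\<not> below d a" "\<not> below b c" "\<not> below c a" "\<not> below d b" "\<not> below b a" "\<not> below d c"
      using t inter o by (auto dest: below_asym)
    show ?thesis unfolding chi crs_def side_eq[OF o(1)] side_eq[OF o(2)]
      using crosses_interleaved[OF e(1,2) inter] inter t na o irr by (simp add: ks)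
  qed
qed

lemma chi_ends_eq:
  assumes e: "e \<in> E" "f \<in> E" "e \<noteq> f"
  shows "chi (ends e) (ends f) = crs e f * ((\<Prod>v\<in>e. side v f) * (\<Prod>v\<in>f. side v e))"
proof -
  obtain a b where ab: "e = {a, b}" "a \<in> V" "b \<in> V" "below a b" using edge_cases[OF e(1)] .
  obtain c d where cd: "f = {c, d}" "c \<in> V" "d \<in> V" "below c d" using edge_cases[OF e(2)] .
  have ne: "a \<noteq> b" "c \<noteq> d" using ab cd below_irrefl by auto
  have "below a c \<or> (a = c \<and> below b d) \<or> below c a \<or> (c = a \<and> below d b)"
    using below_total[of a c] below_total[of b d] e ab cd by auto
  then show ?thesis
  proof (elim disjE)
    assume "below a c"
    then show ?thesis using chi_ends_ordered[of a b c d] e ab cd ne by simp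
  next
    assume "a = c \<and> below b d"
    then show ?thesis using chi_ends_ordered[of a b c d] e ab cd ne by simp
  next
    assume "below c a"
    then show ?thesis
      using chi_ends_ordered[of c d a b] e ab cd ne chi_ends_sym[OF e] crs_sym[of e f] by (simp add: mult_ac)
  next
    assume "c = a \<and> below d b"
    then show ?thesis
      using chi_ends_ordered[of c d a b] e ab cd ne chi_ends_sym[OF e] crs_sym[of e f] by (simp add: mult_ac)
  qed
qed

lemma ends_inj: "inj_on ends E"
  using ends_disjoint ends_card by (metis Int_absorb card.empty inj_onI zero_neq_numeral)

text \<open>Each unordered pair of edges contributes one \<open>crs\<close> factor, collected by
  \<open>pair_sign\<close>, and two families of side factors, one for each ordered pair.\<close>

lemma sg_ends_eq:
  assumes F: "F \<subseteq> E"
  shows "sg (ends ` F) = pair_sign crs F * (\<Prod>f\<in>F. \<Prod>e\<in>F - {f}. \<Prod>v\<in>e. side v f)"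
proof -
  have "finite F" using F finite_E finite_subset by auto
  then show ?thesis using F
  proof (induction F rule: finite_induct)
    case empty
    then show ?case by (simp add: sg_def)
  next
    case (insert a F)
    define G where "G = (\<lambda>e f. \<Prod>v\<in>e. side v f)"
    have aE: "a \<in> E" and FE: "F \<subseteq> E" using insert by auto
    have ne: "f \<noteq> a" if "f \<in> F" for f using that insert by auto
    have val: "chi (ends a) (ends f) = 1 \<or> chi (ends a) (ends f) = -1" if "f \<in> F" for f
      using that FE aE ne[OF that] by (intro chi_val ends_sub ends_disjoint) auto
    have injF: "inj_on ends F" using ends_inj FE inj_on_subset by blast
    have "ends a \<notin> ends ` F" using inj_onD[OF ends_inj] aE FE insert.hyps by blast
    then have "sg (insert (ends a) (ends ` F)) = sg (ends ` F) * (\<Prod>m\<in>ends ` F. chi (ends a) m)"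
      unfolding sg_def
    proof (intro pair_sign_insert)
      fix m assume "m \<in> ends ` F"
      then obtain f where "f \<in> F" "m = ends f" by auto
      then show "chi m (ends a) = chi (ends a) m" "chi (ends a) m = 1 \<or> chi (ends a) m = -1"
        using chi_ends_sym[of a f] ne[of f] val aE FE by auto
    qed (use insert.hyps in auto)
    also have "(\<Prod>m\<in>ends ` F. chi (ends a) m) = (\<Prod>f\<in>F. chi (ends a) (ends f))"
      using injF by (simp add: prod.reindex)
    also have "\<dots> = (\<Prod>f\<in>F. crs a f * (G a f * G f a))"
      unfolding G_def using FE aE ne by (intro prod.cong refl chi_ends_eq) auto
    also have "\<dots> = (\<Prod>f\<in>F. crs a f) * ((\<Prod>f\<in>F. G a f) * (\<Prod>f\<in>F. G f a))"
      by (simp add: prod.distrib)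
    finally have "sg (ends ` insert a F) = sg (ends ` F) * \<dots>" by simp
    moreover have "sg (ends ` F) = pair_sign crs F * (\<Prod>f\<in>F. \<Prod>e\<in>F - {f}. G e f)"
      using insert.IH[OF FE] by (simp add: G_def)
    moreover have "pair_sign crs (insert a F) = pair_sign crs F * (\<Prod>f\<in>F. crs a f)"
      using insert.hyps by (intro pair_sign_insert) (auto simp: crs_sym crs_def)
    moreover have "(\<Prod>f\<in>insert a F. \<Prod>e\<in>insert a F - {f}. G e f)
        = (\<Prod>f\<in>F. G f a) * ((\<Prod>f\<in>F. G a f) * (\<Prod>f\<in>F. \<Prod>e\<in>F - {f}. G e f))"
    proof -
      have "insert a F - {a} = F" using insert.hyps by auto
      moreover have "(\<Prod>e\<in>insert a F - {f}. G e f) = G a f * (\<Prod>e\<in>F - {f}. G e f)" if "f \<in> F" for f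
      proof -
        have "insert a F - {f} = insert a (F - {f})" using ne[OF that] by auto
        then show ?thesis using insert.hyps by simp
      qed
      ultimately show ?thesis using insert.hyps by (simp add: prod.distrib)
    qed
    ultimately have "sg (ends ` insert a F) =
        pair_sign crs (insert a F) * (\<Prod>f\<in>insert a F. \<Prod>e\<in>insert a F - {f}. G e f)"
      by (simp only: mult_ac)
    then show ?case by (simp only: G_def)
  qed
qed

text \<open>In an even set every vertex is counted an even number of times on the side of a fixed edge,
  so all side factors cancel.\<close>

lemma sg_ends_even:
  assumes F: "F \<subseteq> E" and ev: "even_set V F"
  shows "sg (ends ` F) = (-1) ^ crossing_number V F"
proof -
  have fF: "finite F" using F finite_E finite_subset by auto
  have "(\<Prod>e\<in>F - {f}. \<Prod>v\<in>e. side v f) = 1" if f: "f \<in> F" for f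
  proof -
    \<comment> \<open>The edge \<open>f\<close> itself may be included because its own ends have
      \<open>side\<close> 1; then every vertex is counted with its full degree in
      \<open>F\<close>.\<close>
    have "(\<Prod>e\<in>F - {f}. \<Prod>v\<in>e. side v f) = (\<Prod>e\<in>F. \<Prod>v\<in>e. side v f)"
      using fF by (intro prod.mono_neutral_left) (auto simp: side_end)
    also have "\<dots> = (\<Prod>e\<in>F. \<Prod>v\<in>V. if v \<in> e then side v f else 1)"
    proof (rule prod.cong[OF refl])
      fix e assume "e \<in> F"
      then have "e \<subseteq> V" using F by (auto elim!: edge_cases)
      then show "(\<Prod>v\<in>e. side v f) = (\<Prod>v\<in>V. if v \<in> e then side v f else 1)"
        by (intro prod.mono_neutral_cong_left) (auto simp: finite_V)
    qed
    also have "\<dots> = (\<Prod>v\<in>V. \<Prod>e\<in>F. if v \<in> e then side v f else 1)" by (rule prod.swap)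
    also have "\<dots> = (\<Prod>v\<in>V. side v f ^ deg F v)"
      unfolding deg_def using fF by (simp add: prod.inter_filter[symmetric])
    also have "\<dots> = 1"
    proof (intro prod.neutral ballI)
      fix v assume "v \<in> V"
      then have "even (deg F v)" using ev by (auto simp: even_set_def)
      then obtain k where "deg F v = 2 * k" by blast
      then show "side v f ^ deg F v = 1" by (simp add: power_mult power2_eq_square side_sq)
    qed
    finally show ?thesis .
  qed
  then have "sg (ends ` F) = pair_sign crs F" using sg_ends_eq[OF F] by simp
  also have "{{e, f} |e f. e \<in> F \<and> f \<in> F \<and> e \<noteq> f \<and> crs e f = -1}
     = {{e, f} |e f. e \<in> F \<and> f \<in> F \<and> crosses V e f}"
    by (rule Collect_cong) (auto simp: crs_def crosses_def)
  then have "pair_sign crs F = (-1) ^ crossing_number V F"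
    by (simp add: pair_sign_def crossing_number_def)
  finally show ?thesis .
qed

end

section \<open>The generating function as a Pfaffian\<close>

fun mpow :: "'a set \<Rightarrow> ('a \<Rightarrow> 'a \<Rightarrow> 'b::comm_ring_1) \<Rightarrow> nat \<Rightarrow> 'a \<Rightarrow> 'a \<Rightarrow> 'b" where
  "mpow H M 0 h g = (if h = g then 1 else 0)"
| "mpow H M (Suc n) h g = (\<Sum>j\<in>H. M h j * mpow H M n j g)"

lemma fps_const_prod: "fps_const (\<Prod>i\<in>S. f i) = (\<Prod>i\<in>S. fps_const (f i :: 'b::comm_ring_1))"
  by (induction S rule: infinite_finite_induct) (auto simp flip: fps_const_mult)

text \<open>The factor \<open>fps_X\<close> lets coefficient \<open>n\<close> determine coefficient
  \<open>n + 1\<close>, so the resolvent system has one solution without inverting any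
  matrix.\<close>

lemma fps_linear_system_unique:
  fixes c c' :: "'a \<Rightarrow> 'b::comm_ring_1 fps"
  assumes "\<And>h. h \<in> H \<Longrightarrow> c h = fps_X * (\<Sum>j\<in>H. fps_const (M h j) * c j) + d h"
    and "\<And>h. h \<in> H \<Longrightarrow> c' h = fps_X * (\<Sum>j\<in>H. fps_const (M h j) * c' j) + d h"
    and "h \<in> H"
  shows "c h = c' h"
proof -
  have "\<forall>h\<in>H. fps_nth (c h) n = fps_nth (c' h) n" for n
  proof (induction n)
    case 0
    show ?case
    proof
      fix h assume "h \<in> H"
      show "fps_nth (c h) 0 = fps_nth (c' h) 0"
        by (subst assms(1)[OF \<open>h \<in> H\<close>], subst assms(2)[OF \<open>h \<in> H\<close>]) simp
    qed
  next
    case (Suc n)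
    show ?case
    proof
      fix h assume "h \<in> H"
      show "fps_nth (c h) (Suc n) = fps_nth (c' h) (Suc n)"
        by (subst assms(1)[OF \<open>h \<in> H\<close>], subst assms(2)[OF \<open>h \<in> H\<close>])
          (use Suc in \<open>simp add: fps_sum_nth\<close>)
    qed
  qed
  then show ?thesis using assms(3) by (simp add: fps_eq_iff)
qed

section \<open>Half-edge weights and the expansion over edge sets\<close>

context plane_graph
begin

abbreviation hsign :: "complex \<times> complex \<Rightarrow> complex \<times> complex \<Rightarrow> int" where
  "hsign \<equiv> key_sign hkey"

definition blk :: "(complex \<times> complex) set \<Rightarrow> bool" where
  "blk m \<longleftrightarrow> (\<forall>p\<in>m. \<forall>q\<in>m. fst p = fst q)"

text \<open>Either square root would do, as long as both halves of an edge carry the same one: their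
  product is the edge weight.\<close>

definition awt :: "(complex set \<Rightarrow> complex) \<Rightarrow> (complex \<times> complex) set \<Rightarrow> complex" where
  "awt x m = (if blk m then \<Prod>h\<in>m. csqrt (x {fst h, snd h}) else 0)"

definition bwt :: "(complex \<times> complex) set \<Rightarrow> complex" where
  "bwt m = (if m \<in> ends ` E then 1 else 0)"

definition wt :: "(complex set \<Rightarrow> complex) \<Rightarrow> (complex \<times> complex) set \<Rightarrow> complex fps" where
  "wt x m = fps_X * fps_const (awt x m) + fps_const (bwt m)"

definition hal :: "complex set set \<Rightarrow> (complex \<times> complex) set" where
  "hal F = {h. {fst h, snd h} \<in> F}"

lemma hal_E: "hal E = hedges"
  by (auto simp: hal_def hedges_def)

lemma ends_matching:
  assumes "F \<subseteq> E"
  shows "ends ` F \<in> matchings (hal F)"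
proof -
  have "\<Union>(ends ` F) = hal F" by (auto simp: ends_def hal_def)
  moreover have "card m = 2" if "m \<in> ends ` F" for m using that assms ends_card by auto
  moreover have "m \<inter> m' = {}" if *: "m \<in> ends ` F" "m' \<in> ends ` F" "m \<noteq> m'" for m m'
  proof -
    obtain e f where "m = ends e" "m' = ends f" using * by blast
    then show ?thesis using ends_disjoint[of e f] *(3) by auto
  qed
  ultimately show ?thesis unfolding matchings_def mem_Collect_eq by blast
qed

lemma not_blk_ends: "e \<in> E \<Longrightarrow> \<not> blk (ends e)"
proof -
  assume "e \<in> E"
  then obtain a b where "e = {a, b}" "below a b" using edge_cases by blast
  then show ?thesis using below_irrefl by (auto simp: ends_doubleton blk_def)
qed

lemma hal_diff: "F \<subseteq> E \<Longrightarrow> hedges - hal F = hal (E - F)"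
  by (auto simp: hal_def hedges_def)

text \<open>A matching that uses only vertex pairs and edge pairs is determined by the set
  \<open>E - F\<close> of edges whose halves are joined together and by a matching \<open>N\<close>
  inside vertices of all other half-edges. No pair is of both kinds, so \<open>F\<close> and
  \<open>N\<close> can be read off.\<close>

lemma sum_good_matchings:
  fixes \<phi> :: "(complex \<times> complex) set set \<Rightarrow> 'b::comm_monoid_add"
  shows "(\<Sum>M\<in>{M \<in> matchings hedges. \<forall>m\<in>M. blk m \<or> m \<in> ends ` E}. \<phi> M)
   = (\<Sum>F\<in>Pow E. \<Sum>N\<in>{N \<in> matchings (hal F). \<forall>m\<in>N. blk m}. \<phi> (N \<union> ends ` (E - F)))"
proof -
  have fM: "finite {N \<in> matchings (hal F). \<forall>m\<in>N. blk m}" if "F \<subseteq> E" for F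
  proof -
    have "hal F \<subseteq> hedges" using that by (auto simp: hal_def hedges_def)
    then have "finite (hal F)" using finite_hedges finite_subset by blast
    then show ?thesis by (simp add: finite_matchings)
  qed
  have "(\<Sum>F\<in>Pow E. \<Sum>N\<in>{N \<in> matchings (hal F). \<forall>m\<in>N. blk m}. \<phi> (N \<union> ends ` (E - F)))
     = (\<Sum>p\<in>(SIGMA F:Pow E. {N \<in> matchings (hal F). \<forall>m\<in>N. blk m}). \<phi> (snd p \<union> ends ` (E - fst p)))"
    using fM finite_E by (subst sum.Sigma) (auto simp: split_def)
  also have "\<dots> = (\<Sum>M\<in>{M \<in> matchings hedges. \<forall>m\<in>M. blk m \<or> m \<in> ends ` E}. \<phi> M)"
  proof (rule sum.reindex_bij_witness[where
        i = "\<lambda>M. ({e \<in> E. ends e \<notin> M}, {m \<in> M. blk m})" and j = "\<lambda>p. snd p \<union> ends ` (E - fst p)"])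
    fix p assume "p \<in> (SIGMA F:Pow E. {N \<in> matchings (hal F). \<forall>m\<in>N. blk m})"
    then obtain F N where p: "p = (F, N)" "F \<subseteq> E" "N \<in> matchings (hal F)" "\<forall>m\<in>N. blk m" by auto
    have nb: "ends e \<notin> N" if "e \<in> E" for e using p(4) not_blk_ends[OF that] by blast
    have "{e \<in> E. ends e \<notin> N \<union> ends ` (E - F)} = F"
      using p(2) nb inj_onD[OF ends_inj] by blast
    moreover have "{m \<in> N \<union> ends ` (E - F). blk m} = N"
      using p(4) not_blk_ends by auto
    ultimately show "({e \<in> E. ends e \<notin> snd p \<union> ends ` (E - fst p)},
        {m \<in> snd p \<union> ends ` (E - fst p). blk m}) = p" using p(1) by simp
    have "N \<union> ends ` (E - F) \<in> matchings hedges"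
      using p(2,3) ends_matching[of "E - F"] hal_diff[OF p(2)]
      by (intro matching_Un(1)[of _ "hal F"]) (auto simp: hal_def hedges_def)
    moreover have "blk m \<or> m \<in> ends ` E" if "m \<in> N \<union> ends ` (E - F)" for m
      using that p(4) by blast
    ultimately show "snd p \<union> ends ` (E - fst p) \<in> {M \<in> matchings hedges. \<forall>m\<in>M. blk m \<or> m \<in> ends ` E}"
      unfolding p(1) fst_conv snd_conv by blast
  next
    fix M assume "M \<in> {M \<in> matchings hedges. \<forall>m\<in>M. blk m \<or> m \<in> ends ` E}"
    then have M: "M \<in> matchings hedges" "\<And>m. m \<in> M \<Longrightarrow> blk m \<or> m \<in> ends ` E" by auto
    let ?F = "{e \<in> E. ends e \<notin> M}" and ?N = "{m \<in> M. blk m}"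
    have split: "M = ?N \<union> ends ` (E - ?F)" using M(2) by auto
    then show "snd (?F, ?N) \<union> ends ` (E - fst (?F, ?N)) = M" by simp
    have UM: "\<Union>M = hedges" using M(1) by (simp add: matchings_def)
    have U2: "\<Union>(ends ` (E - ?F)) = hal (E - ?F)" by (auto simp: ends_def hal_def)
    have "\<Union>?N \<inter> hal (E - ?F) = {}"
    proof -
      have "m \<inter> ends e = {}" if "m \<in> M" "blk m" "e \<in> E" "ends e \<in> M" for m e
        using that matching_disjoint[OF M(1)] not_blk_ends by metis
      then have "\<Union>?N \<inter> \<Union>(ends ` (E - ?F)) = {}" by blast
      then show ?thesis by (simp only: U2)
    qed
    moreover have "\<Union>?N \<union> hal (E - ?F) = hedges"
    proof -
      have "\<Union>M = \<Union>?N \<union> \<Union>(ends ` (E - ?F))" by (subst split) (rule Union_Un_distrib)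
      then show ?thesis by (simp only: U2 UM)
    qed
    moreover have "hal ?F = hedges - hal (E - ?F)" by (auto simp: hal_def hedges_def)
    ultimately have "\<Union>?N = hal ?F" by blast
    then have "?N \<in> matchings (hal ?F)"
      using M(1) unfolding matchings_def by blast
    then show "(?F, ?N) \<in> (SIGMA F:Pow E. {N \<in> matchings (hal F). \<forall>m\<in>N. blk m})" by auto
  qed simp
  finally show ?thesis ..
qed

lemma card_block_deg:
  assumes "F \<subseteq> E"
  shows "card {q \<in> hal F. fst q = v} = deg F v"
  unfolding deg_def
proof (rule bij_betw_same_card)
  show "bij_betw (\<lambda>q. {fst q, snd q}) {q \<in> hal F. fst q = v} {e \<in> F. v \<in> e}"
  proof (rule bij_betwI')
    fix p q assume "p \<in> {q \<in> hal F. fst q = v}" "q \<in> {q \<in> hal F. fst q = v}"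
    then show "({fst p, snd p} = {fst q, snd q}) = (p = q)"
      by (auto simp: doubleton_eq_iff prod_eq_iff)
  next
    fix q assume "q \<in> {q \<in> hal F. fst q = v}"
    then show "{fst q, snd q} \<in> {e \<in> F. v \<in> e}" by (auto simp: hal_def)
  next
    fix e assume e: "e \<in> {e \<in> F. v \<in> e}"
    then obtain a b where "e = {a, b}" using assms edge_cases by blast
    then have "(v, if v = a then b else a) \<in> {q \<in> hal F. fst q = v} \<and> e = {v, if v = a then b else a}"
      using e by (auto simp: hal_def insert_commute)
    then show "\<exists>q\<in>{q \<in> hal F. fst q = v}. e = {fst q, snd q}" by force
  qed
qed

text \<open>The blocks are the half-edges with a common origin; they are intervals because
  \<open>hkey\<close> compares heights of origins first.\<close>

lemma sum_blk_matchings: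
  assumes F: "F \<subseteq> E"
  shows "(\<Sum>N\<in>{N \<in> matchings (hal F). \<forall>m\<in>N. blk m}. sg N) = (if even_set V F then 1 else 0)"
proof -
  have sub: "hal F \<subseteq> hedges" using F by (auto simp: hal_def hedges_def)
  then have fin: "finite (hal F)" using finite_hedges finite_subset by blast
  have "(\<Sum>N\<in>{N \<in> matchings (hal F). \<forall>m\<in>N. blk m}. sg N)
    = (\<Sum>N\<in>matchings (hal F). if \<forall>m\<in>N. \<forall>p\<in>m. \<forall>q\<in>m. fst p = fst q then sg N else 0)"
    unfolding blk_def using finite_matchings[OF fin] by (rule sum.inter_filter)
  also have "\<dots> = (if \<forall>v. even (card {q \<in> hal F. fst q = v}) then 1 else 0)"
  proof (rule sum_block_matchings[OF sub])
    fix p q r assume *: "p \<in> hal F" "q \<in> hal F" "r \<in> hal F" "fst p = fst r" "hkey p < hkey q" "hkey q < hkey r"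
    have V: "fst p \<in> V" "fst q \<in> V"
      using * F edge_V[of "fst p" "snd p"] edge_V[of "fst q" "snd q"] by (auto simp: hal_def)
    show "fst q = fst p"
    proof (rule ccontr)
      assume "fst q \<noteq> fst p"
      then consider "below (fst q) (fst p)" | "below (fst p) (fst q)" using below_total by blast
      then show False
      proof cases
        case 1
        then show ?thesis using hkey_less[OF V(2) 1, of "snd q" "snd p"] *(5) by simp
      next
        case 2
        then show ?thesis using hkey_less[OF V(1) 2, of "snd r" "snd q"] *(4,6) by simp
      qed
    qed
  qed
  also have "(\<forall>v. even (card {q \<in> hal F. fst q = v})) \<longleftrightarrow> even_set V F"
  proof -
    \<comment> \<open>\<open>even_set\<close> speaks only of points of \<open>V\<close>, whereas the
      block count ranges over all points of the plane.\<close>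
    have "deg F v = 0" if "v \<notin> V" for v
      using that F edge_cases unfolding deg_def by (subst card_eq_0_iff) blast
    then show ?thesis unfolding card_block_deg[OF F] even_set_def by (metis even_zero)
  qed
  finally show ?thesis .
qed

text \<open>Z(tx) as a formal polynomial in t.\<close>

definition Zfps :: "(complex set \<Rightarrow> complex) \<Rightarrow> complex fps" where
  "Zfps x = (\<Sum>F\<in>{F. F \<subseteq> E \<and> even_set V F}.
     fps_const ((-1) ^ crossing_number V F * (\<Prod>e\<in>F. x e)) * fps_X ^ card F)"

text \<open>By \<open>sg_Un_mult\<close>, the sign of \<open>N\<close> together with the edge pairs
  outside \<open>F\<close> is \<open>sg N * sg (ends\<close> F) * sg (ends \<open>E)\<close>.
  Summing \<open>sg N\<close> tests whether \<open>F\<close> is even, the second factor is then the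
  crossing sign, and the third is global. The square roots over the half-edges of \<open>F\<close>
  multiply to the product of its edge weights, and \<open>card N = card F\<close> gives the power of
  t.\<close>

lemma pf_wt: "pf (wt x) = of_int (sg (ends ` E)) * Zfps x"
proof -
  let ?good = "{M \<in> matchings hedges. \<forall>m\<in>M. blk m \<or> m \<in> ends ` E}"
  let ?bm = "\<lambda>F. {N \<in> matchings (hal F). \<forall>m\<in>N. blk m}"
  have "pf (wt x) = (\<Sum>M\<in>?good. of_int (sg M) * (\<Prod>m\<in>M. wt x m))"
    unfolding pf_def
  proof (rule sum.mono_neutral_right)
    show "\<forall>M\<in>matchings hedges - ?good. of_int (sg M) * (\<Prod>m\<in>M. wt x m) = 0"
    proof
      fix M assume M: "M \<in> matchings hedges - ?good"
      then obtain m where m: "m \<in> M" "\<not> blk m" "m \<notin> ends ` E" by auto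
      then have "wt x m = 0" by (simp add: wt_def awt_def bwt_def)
      moreover have "finite M" using M matching_finite[OF finite_hedges] by blast
      ultimately have "(\<Prod>m\<in>M. wt x m) = 0" using m(1) by (rule_tac prod_zero) auto
      then show "of_int (sg M) * (\<Prod>m\<in>M. wt x m) = 0" by simp
    qed
  qed (auto simp: finite_matchings finite_hedges)
  also have "\<dots> = (\<Sum>F\<in>Pow E. \<Sum>N\<in>?bm F.
      of_int (sg (N \<union> ends ` (E - F))) * (\<Prod>m\<in>N \<union> ends ` (E - F). wt x m))"
    by (rule sum_good_matchings)
  also have "\<dots> = (\<Sum>F\<in>Pow E. of_int (sg (ends ` E)) * (of_int (sg (ends ` F) * (\<Sum>N\<in>?bm F. sg N))
      * (fps_const (\<Prod>e\<in>F. x e) * fps_X ^ card F)))"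
  proof (rule sum.cong[OF refl])
    fix F assume "F \<in> Pow E"
    then have F: "F \<subseteq> E" by simp
    have sub: "hal F \<subseteq> hedges" using F by (auto simp: hal_def hedges_def)
    then have fin: "finite (hal F)" using finite_hedges finite_subset by blast
    have fF: "finite F" "finite E" using F finite_E finite_subset by auto
    have eF: "ends ` F \<in> matchings (hal F)" by (rule ends_matching[OF F])
    have eF': "ends ` (E - F) \<in> matchings (hedges - hal F)"
      unfolding hal_diff[OF F] by (rule ends_matching) auto
    have injF: "inj_on ends F" using ends_inj F inj_on_subset by blast
    have Eun: "ends ` F \<union> ends ` (E - F) = ends ` E" using F by auto
    have "of_int (sg (N \<union> ends ` (E - F))) * (\<Prod>m\<in>N \<union> ends ` (E - F). wt x m)
      = of_int (sg (ends ` E)) * (of_int (sg (ends ` F) * sg N) * (fps_const (\<Prod>e\<in>F. x e) * fps_X ^ card F))"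
      if "N \<in> ?bm F" for N
    proof -
      have N: "N \<in> matchings (hal F)" "\<And>m. m \<in> N \<Longrightarrow> blk m" using that by auto
      have fN: "finite N" by (rule matching_finite[OF fin N(1)])
      have sgn: "sg (N \<union> ends ` (E - F)) = sg N * sg (ends ` F) * sg (ends ` E)"
        using sg_Un_mult[OF N(1) eF eF' sub] unfolding Eun .
      have "(\<Prod>m\<in>N \<union> ends ` (E - F). wt x m) = (\<Prod>m\<in>N. wt x m) * (\<Prod>m\<in>ends ` (E - F). wt x m)"
        using matching_Un(2)[OF N(1) eF' sub] fN fF by (intro prod.union_disjoint) auto
      also have "(\<Prod>m\<in>ends ` (E - F). wt x m) = 1"
        using not_blk_ends by (intro prod.neutral) (auto simp: wt_def awt_def bwt_def)
      also have "(\<Prod>m\<in>N. wt x m) = (\<Prod>m\<in>N. fps_X * fps_const (\<Prod>h\<in>m. csqrt (x {fst h, snd h})))"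
        using N(2) not_blk_ends by (intro prod.cong refl) (auto simp: wt_def awt_def bwt_def)
      also have "\<dots> = fps_X ^ card N * fps_const (\<Prod>m\<in>N. \<Prod>h\<in>m. csqrt (x {fst h, snd h}))"
        by (simp add: prod.distrib fps_const_prod)
      also have "(\<Prod>m\<in>N. \<Prod>h\<in>m. csqrt (x {fst h, snd h})) = (\<Prod>m\<in>ends ` F. \<Prod>h\<in>m. csqrt (x {fst h, snd h}))"
        unfolding prod_matching[OF N(1)] prod_matching[OF eF] ..
      also have "\<dots> = (\<Prod>e\<in>F. \<Prod>h\<in>ends e. csqrt (x {fst h, snd h}))"
        using injF by (simp add: prod.reindex)
      also have "\<dots> = (\<Prod>e\<in>F. x e)"
      proof (rule prod.cong[OF refl])
        fix e assume "e \<in> F"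
        then have "e \<in> E" using F by auto
        then have "(\<Prod>h\<in>ends e. csqrt (x {fst h, snd h})) = csqrt (x e) ^ card (ends e)"
          by (subst prod_constant[symmetric], intro prod.cong refl) (auto simp: ends_def)
        then show "(\<Prod>h\<in>ends e. csqrt (x {fst h, snd h})) = x e"
          using ends_card[OF \<open>e \<in> E\<close>] by simp
      qed
      also have "card N = card F"
        using card_matching[OF N(1) fin] card_matching[OF eF fin] card_image[OF injF] by simp
      finally have "(\<Prod>m\<in>N \<union> ends ` (E - F). wt x m) = fps_X ^ card F * fps_const (\<Prod>e\<in>F. x e)" by simp
      then show ?thesis unfolding sgn by (simp only: of_int_mult mult_ac)
    qed
    then have "(\<Sum>N\<in>?bm F. of_int (sg (N \<union> ends ` (E - F))) * (\<Prod>m\<in>N \<union> ends ` (E - F). wt x m))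
      = (\<Sum>N\<in>?bm F. of_int (sg (ends ` E)) * (of_int (sg (ends ` F) * sg N) * (fps_const (\<Prod>e\<in>F. x e) * fps_X ^ card F)))"
      by (intro sum.cong refl)
    also have "\<dots> = of_int (sg (ends ` E)) * (of_int (sg (ends ` F) * (\<Sum>N\<in>?bm F. sg N))
      * (fps_const (\<Prod>e\<in>F. x e) * fps_X ^ card F))"
      by (simp only: sum_distrib_left sum_distrib_right of_int_sum)
    finally show "(\<Sum>N\<in>?bm F. of_int (sg (N \<union> ends ` (E - F))) * (\<Prod>m\<in>N \<union> ends ` (E - F). wt x m)) = \<dots>" .
  qed
  also have "\<dots> = of_int (sg (ends ` E)) * (\<Sum>F\<in>Pow E. of_int (sg (ends ` F) * (\<Sum>N\<in>?bm F. sg N))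
      * (fps_const (\<Prod>e\<in>F. x e) * fps_X ^ card F))" by (rule sum_distrib_left[symmetric])
  also have "(\<Sum>F\<in>Pow E. of_int (sg (ends ` F) * (\<Sum>N\<in>?bm F. sg N))
      * (fps_const (\<Prod>e\<in>F. x e) * fps_X ^ card F)) = Zfps x"
    unfolding Zfps_def
  proof (rule sum.mono_neutral_cong_right)
    show "finite (Pow E)" using finite_E by simp
    show "\<forall>F\<in>Pow E - {F. F \<subseteq> E \<and> even_set V F}. of_int (sg (ends ` F) * (\<Sum>N\<in>?bm F. sg N))
      * (fps_const (\<Prod>e\<in>F. x e) * fps_X ^ card F) = 0"
      by (simp add: sum_blk_matchings)
    fix F assume "F \<in> {F. F \<subseteq> E \<and> even_set V F}"
    then have F: "F \<subseteq> E" "even_set V F" by auto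
    have "(of_int ((-1) ^ crossing_number V F) :: complex fps) = fps_const ((-1) ^ crossing_number V F)"
      by (simp flip: fps_of_int)
    then show "of_int (sg (ends ` F) * (\<Sum>N\<in>?bm F. sg N)) * (fps_const (\<Prod>e\<in>F. x e) * fps_X ^ card F)
      = fps_const ((-1) ^ crossing_number V F * (\<Prod>e\<in>F. x e)) * fps_X ^ card F"
      using F by (simp add: sum_blk_matchings sg_ends_even mult.assoc flip: fps_const_mult)
  qed auto
  finally show ?thesis .
qed

end

section \<open>The logarithmic derivative\<close>

context plane_graph
begin

definition acoef :: "(complex set \<Rightarrow> complex) \<Rightarrow> complex \<times> complex \<Rightarrow> complex \<times> complex \<Rightarrow> complex" where
  "acoef x p q = (if p = q then 0 else of_int (hsign p q) * awt x {p, q})"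

text \<open>This is \<Lambda>: since the edge matching joins each half-edge only to its swap, the
  matrix product has a single term. It moves along the edge of \<open>h\<close> and then turns into
  \<open>g\<close>.\<close>

definition tmat :: "(complex set \<Rightarrow> complex) \<Rightarrow> complex \<times> complex \<Rightarrow> complex \<times> complex \<Rightarrow> complex" where
  "tmat x h g = of_int (hsign h (prod.swap h)) * acoef x (prod.swap h) g"

lemma swap_hedges: "h \<in> hedges \<Longrightarrow> prod.swap h \<in> hedges \<and> prod.swap h \<noteq> h"
  by (cases h) (auto simp: hedges_def insert_commute dest: edge_V)

lemma hsign_swap:
  assumes "h \<in> hedges"
  shows "hsign (prod.swap h) h = - hsign h (prod.swap h)" "hsign h (prod.swap h) * hsign h (prod.swap h) = 1"
  using swap_hedges[OF assms] anti[of h "prod.swap h"] sigma_sq[of h "prod.swap h"] assms by auto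

lemma pair_ends_iff:
  assumes "p \<in> hedges" "p \<noteq> q"
  shows "{p, q} \<in> ends ` E \<longleftrightarrow> q = prod.swap p"
proof
  assume "{p, q} \<in> ends ` E"
  then obtain e where e: "{p, q} = ends e" by auto
  then have "{fst p, snd p} = e" "{fst q, snd q} = e" by (auto simp: ends_def)
  then show "q = prod.swap p" using assms(2)
    by (cases p; cases q) (auto simp: doubleton_eq_iff)
next
  assume "q = prod.swap p"
  then have "{p, q} = ends {fst p, snd p}" by (cases p) (simp add: ends_doubleton)
  moreover have "{fst p, snd p} \<in> E" using assms by (auto simp: hedges_def)
  ultimately show "{p, q} \<in> ends ` E" by blast
qed

lemma amat_wt:
  assumes "p \<in> hedges"
  shows "amat (wt x) p q = fps_X * fps_const (acoef x p q)
    + (if q = prod.swap p then of_int (hsign p q) else 0)"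
proof (cases "p = q")
  case True
  then show ?thesis using swap_hedges[OF assms] by (auto simp: amat_def acoef_def)
next
  case False
  have "of_int (hsign p q) * fps_const (awt x {p, q}) = fps_const (acoef x p q)"
    using False by (simp add: acoef_def flip: fps_of_int)
  then have "of_int (hsign p q) * (fps_X * fps_const (awt x {p, q})) = fps_X * fps_const (acoef x p q)"
    by (metis mult.left_commute)
  moreover have "bwt {p, q} = (if q = prod.swap p then 1 else 0)"
    using pair_ends_iff[OF assms False] by (simp add: bwt_def)
  ultimately show ?thesis using False by (auto simp: amat_def wt_def distrib_left)
qed

text \<open>Pair the row of \<open>prod.swap h\<close> with the cofactors of \<open>k\<close>,
  giving the Pfaffian or 0. In this row the constant part has its only entry in column
  \<open>h\<close>, so that cofactor can be isolated; multiplying by its sign removes the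
  coefficient.\<close>

lemma cof_recursion:
  assumes k: "k \<in> hedges" and h: "h \<in> hedges"
  shows "cof (wt x) k h = fps_X * (\<Sum>j\<in>hedges. fps_const (tmat x h j) * cof (wt x) k j)
     + (if h = prod.swap k then of_int (hsign k (prod.swap k)) * pf (wt x) else 0)"
proof -
  let ?i = "prod.swap h" and ?s = "of_int (hsign h (prod.swap h)) :: complex fps"
  have i: "?i \<in> hedges" "?i \<noteq> h" using swap_hedges[OF h] by auto
  have ss: "?s * ?s = 1" using hsign_swap(2)[OF h] by (metis of_int_mult of_int_1)
  have "(2 :: complex fps) \<noteq> 0" by (rule numeral_neq_fps_zero)
  note alien = pf_alien[OF this]
  have "(\<Sum>j\<in>hedges. amat (wt x) ?i j * cof (wt x) k j) = (if ?i = k then pf (wt x) else 0)"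
    using pf_expand[OF k] alien[OF k i(1)] by auto
  moreover have "(\<Sum>j\<in>hedges. amat (wt x) ?i j * cof (wt x) k j)
     = fps_X * (\<Sum>j\<in>hedges. fps_const (acoef x ?i j) * cof (wt x) k j) - ?s * cof (wt x) k h"
  proof -
    have "(\<Sum>j\<in>hedges. amat (wt x) ?i j * cof (wt x) k j)
      = (\<Sum>j\<in>hedges. fps_X * (fps_const (acoef x ?i j) * cof (wt x) k j)
          + (if j = h then - ?s * cof (wt x) k h else 0))"
      using hsign_swap(1)[OF h] by (intro sum.cong refl) (simp add: amat_wt[OF i(1)] distrib_right mult.assoc)
    also have "\<dots> = fps_X * (\<Sum>j\<in>hedges. fps_const (acoef x ?i j) * cof (wt x) k j) - ?s * cof (wt x) k h"
      using h finite_hedges by (simp add: sum.distrib sum_distrib_left)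
    finally show ?thesis .
  qed
  ultimately have "fps_X * (\<Sum>j\<in>hedges. fps_const (acoef x ?i j) * cof (wt x) k j) - ?s * cof (wt x) k h
      = (if ?i = k then pf (wt x) else 0)" by (simp only:)
  moreover have "d = c - b" if "c - d = b" for b c d :: "complex fps" using that by auto
  ultimately have "?s * cof (wt x) k h
     = fps_X * (\<Sum>j\<in>hedges. fps_const (acoef x ?i j) * cof (wt x) k j) - (if ?i = k then pf (wt x) else 0)"
    by (simp only:)
  then have "?s * (?s * cof (wt x) k h)
     = ?s * (fps_X * (\<Sum>j\<in>hedges. fps_const (acoef x ?i j) * cof (wt x) k j) - (if ?i = k then pf (wt x) else 0))"
    by simp
  moreover have "?s * (?s * cof (wt x) k h) = cof (wt x) k h" by (simp only: mult.assoc[symmetric] ss mult_1_left)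
  moreover have "?s * (\<Sum>j\<in>hedges. fps_const (acoef x ?i j) * cof (wt x) k j)
     = (\<Sum>j\<in>hedges. fps_const (tmat x h j) * cof (wt x) k j)"
    unfolding sum_distrib_left tmat_def by (intro sum.cong refl) (simp add: mult_ac flip: fps_of_int)
  moreover have "?s * (if ?i = k then pf (wt x) else 0)
     = - (if h = prod.swap k then of_int (hsign k (prod.swap k)) * pf (wt x) else 0)"
    using hsign_swap(1)[OF h] by (cases h; cases k) auto
  ultimately show ?thesis by (simp add: right_diff_distrib mult.left_commute)
qed

text \<open>The analogue of "adjugate equals determinant times inverse", with the geometric series
  of \<open>tmat\<close> as inverse. Both sides solve the same linear system, so the Pfaffian is
  never divided by.\<close>

lemma cof_eq:
  assumes k: "k \<in> hedges" and h: "h \<in> hedges"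
  shows "cof (wt x) k h = of_int (hsign k (prod.swap k)) * pf (wt x)
     * Abs_fps (\<lambda>n. mpow hedges (tmat x) n h (prod.swap k))"
proof (rule fps_linear_system_unique[OF cof_recursion[OF k] _ h])
  fix h assume h: "h \<in> hedges"
  let ?R = "\<lambda>h. Abs_fps (\<lambda>n. mpow hedges (tmat x) n h (prod.swap k))"
  let ?c = "of_int (hsign k (prod.swap k)) * pf (wt x)"
  have "?R h = fps_X * (\<Sum>j\<in>hedges. fps_const (tmat x h j) * ?R j) + (if h = prod.swap k then 1 else 0)"
    (is "_ = ?rhs")
  proof (rule fps_ext)
    fix n show "fps_nth (?R h) n = fps_nth ?rhs n"
      by (cases n) (auto simp: fps_sum_nth)
  qed
  then have "?c * ?R h = ?c * ?rhs" by (rule arg_cong)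
  also have "\<dots> = fps_X * (\<Sum>j\<in>hedges. fps_const (tmat x h j) * (?c * ?R j)) + (if h = prod.swap k then ?c else 0)"
  proof -
    have "?c * (\<Sum>j\<in>hedges. fps_const (tmat x h j) * ?R j) = (\<Sum>j\<in>hedges. fps_const (tmat x h j) * (?c * ?R j))"
      unfolding sum_distrib_left by (intro sum.cong refl) (simp only: mult_ac)
    then show ?thesis by (simp only: distrib_left mult.left_commute[of ?c]) simp
  qed
  finally show "?c * ?R h = fps_X * (\<Sum>j\<in>hedges. fps_const (tmat x h j) * (?c * ?R j)) + (if h = prod.swap k then ?c else 0)" .
qed

text \<open>Jacobi's formula for the Pfaffian: the derivative of the matrix is its t-linear part,
  and inserting \<open>cof_eq\<close> turns the double sum into traces of powers of
  \<open>tmat\<close>.\<close>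

lemma fps_deriv_pf_wt:
  "2 * fps_deriv (pf (wt x)) = - (pf (wt x) * Abs_fps (\<lambda>n. \<Sum>h\<in>hedges. mpow hedges (tmat x) (Suc n) h h))"
proof -
  let ?R = "\<lambda>h g. Abs_fps (\<lambda>n. mpow hedges (tmat x) n h g)"
  have "2 * fps_deriv (pf (wt x)) = (\<Sum>k\<in>hedges. \<Sum>j\<in>hedges. amat (\<lambda>m. fps_deriv (wt x m)) k j * cof (wt x) k j)"
    by (rule fps_deriv_pf)
  also have "\<dots> = (\<Sum>k\<in>hedges. \<Sum>j\<in>hedges. fps_const (acoef x k j) *
      (of_int (hsign k (prod.swap k)) * pf (wt x) * ?R j (prod.swap k)))"
  proof (intro sum.cong refl)
    fix k j assume kj: "k \<in> hedges" "j \<in> hedges"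
    have "amat (\<lambda>m. fps_deriv (wt x m)) k j = fps_const (acoef x k j)"
      by (simp add: amat_def wt_def acoef_def flip: fps_of_int)
    then show "amat (\<lambda>m. fps_deriv (wt x m)) k j * cof (wt x) k j = fps_const (acoef x k j) *
      (of_int (hsign k (prod.swap k)) * pf (wt x) * ?R j (prod.swap k))"
      using cof_eq[OF kj] by simp
  qed
  \<comment> \<open>Substituting \<open>prod.swap h\<close> for \<open>k\<close> exposes
    \<open>tmat\<close>; its sign is opposite to the one present here, which produces the minus of
    the result.\<close>
  also have "\<dots> = (\<Sum>h\<in>hedges. \<Sum>j\<in>hedges. fps_const (acoef x (prod.swap h) j) *
      (of_int (hsign (prod.swap h) h) * pf (wt x) * ?R j h))"
    by (rule sum.reindex_bij_witness[of _ prod.swap prod.swap]) (use swap_hedges in auto)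
  also have "\<dots> = (\<Sum>h\<in>hedges. \<Sum>j\<in>hedges. - (pf (wt x) * (fps_const (tmat x h j) * ?R j h)))"
  proof (intro sum.cong refl)
    fix h j assume "h \<in> hedges" "j \<in> hedges"
    then show "fps_const (acoef x (prod.swap h) j) * (of_int (hsign (prod.swap h) h) * pf (wt x) * ?R j h)
      = - (pf (wt x) * (fps_const (tmat x h j) * ?R j h))"
      by (simp add: hsign_swap(1) tmat_def fps_of_int mult_ac flip: fps_const_mult)
  qed
  also have "\<dots> = - (pf (wt x) * (\<Sum>h\<in>hedges. \<Sum>j\<in>hedges. fps_const (tmat x h j) * ?R j h))"
    by (simp add: sum_negf sum_distrib_left)
  also have "(\<Sum>h\<in>hedges. \<Sum>j\<in>hedges. fps_const (tmat x h j) * ?R j h)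
      = Abs_fps (\<lambda>n. \<Sum>h\<in>hedges. mpow hedges (tmat x) (Suc n) h h)"
    by (rule fps_ext) (simp add: fps_sum_nth)
  finally show ?thesis .
qed

lemma fps_deriv_Zfps:
  "2 * fps_deriv (Zfps x) = - (Zfps x * Abs_fps (\<lambda>n. \<Sum>h\<in>hedges. mpow hedges (tmat x) (Suc n) h h))"
proof -
  let ?s = "of_int (sg (ends ` E)) :: complex fps"
  have ss: "?s * ?s = 1" using sg_sq[of "ends ` E"] by (metis of_int_mult of_int_1)
  then have "Zfps x = (?s * ?s) * Zfps x" by (simp only: mult_1_left)
  then have Z: "Zfps x = ?s * pf (wt x)" unfolding pf_wt by (simp only: mult.assoc)
  show ?thesis unfolding Z using fps_deriv_pf_wt[of x]
    by (simp add: mult.left_commute[of 2])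
qed

end

section \<open>Traces and closed paths\<close>

fun chain :: "('a \<Rightarrow> 'a \<Rightarrow> 'b::comm_ring_1) \<Rightarrow> 'a list \<Rightarrow> 'a \<Rightarrow> 'b" where
  "chain M [] g = 1"
| "chain M [h] g = M h g"
| "chain M (h # k # hs) g = M h k * chain M (k # hs) g"

lemma sum_lists_Suc:
  "(\<Sum>l\<in>{l. set l \<subseteq> H \<and> length l = Suc n}. \<phi> l)
     = (\<Sum>j\<in>H. \<Sum>l\<in>{l. set l \<subseteq> H \<and> length l = n}. \<phi> (j # l))"
  if "finite H"
proof -
  have "(\<Sum>j\<in>H. \<Sum>l\<in>{l. set l \<subseteq> H \<and> length l = n}. \<phi> (j # l))
      = (\<Sum>p\<in>H \<times> {l. set l \<subseteq> H \<and> length l = n}. \<phi> (fst p # snd p))"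
    by (simp add: sum.cartesian_product split_def)
  also have "\<dots> = (\<Sum>l\<in>{l. set l \<subseteq> H \<and> length l = Suc n}. \<phi> l)"
    by (rule sum.reindex_bij_witness[of _ "\<lambda>l. (hd l, tl l)" "\<lambda>p. fst p # snd p"])
      (auto simp: length_Suc_conv)
  finally show ?thesis ..
qed

lemma mpow_chain:
  assumes "finite H" "g \<in> H" "h \<in> H"
  shows "mpow H M (Suc n) h g = (\<Sum>l\<in>{l. set l \<subseteq> H \<and> length l = n}. chain M (h # l) g)"
  using assms(3)
proof (induction n arbitrary: h)
  case 0
  have "{l. set l \<subseteq> H \<and> length l = 0} = {[]}" by auto
  moreover have "(\<Sum>j\<in>H. M h j * (if j = g then 1 else 0)) = M h g"
    using assms(1,2) by (simp add: if_distrib cong: if_cong)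
  ultimately show ?case by simp
next
  case (Suc n)
  have "mpow H M (Suc (Suc n)) h g = (\<Sum>j\<in>H. M h j * mpow H M (Suc n) j g)" by simp
  also have "\<dots> = (\<Sum>j\<in>H. \<Sum>l\<in>{l. set l \<subseteq> H \<and> length l = n}. chain M (h # j # l) g)"
    by (intro sum.cong refl) (simp only: Suc.IH chain.simps sum_distrib_left)
  also have "\<dots> = (\<Sum>l\<in>{l. set l \<subseteq> H \<and> length l = Suc n}. chain M (h # l) g)"
    by (rule sum_lists_Suc[OF assms(1), symmetric])
  finally show ?case .
qed

lemma chain_prod: "l \<noteq> [] \<Longrightarrow> chain M l g = (\<Prod>i<length l. M (l ! i) ((l @ [g]) ! Suc i))"
proof (induction M l g rule: chain.induct)
  case (3 M h k hs g)
  have "chain M (h # k # hs) g = M h k * (\<Prod>i<length (k # hs). M ((k # hs) ! i) (((k # hs) @ [g]) ! Suc i))"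
    using 3 by simp
  also have "\<dots> = (\<Prod>i<length (h # k # hs). M ((h # k # hs) ! i) (((h # k # hs) @ [g]) ! Suc i))"
    unfolding length_Cons[of h] prod.lessThan_Suc_shift by simp
  finally show ?case .
qed auto

text \<open>On the diagonal the final index is the head of the list, which closes the walk and makes
  the indices cyclic.\<close>

lemma trace_mpow:
  assumes "finite H" "n > 0"
  shows "(\<Sum>h\<in>H. mpow H M n h h)
    = (\<Sum>l\<in>{l. set l \<subseteq> H \<and> length l = n}. \<Prod>i<n. M (l ! i) (l ! ((i + 1) mod n)))"
proof -
  obtain m where n: "n = Suc m" using assms(2) by (cases n) auto
  have "(\<Sum>h\<in>H. mpow H M n h h) = (\<Sum>h\<in>H. \<Sum>l\<in>{l. set l \<subseteq> H \<and> length l = m}. chain M (h # l) (hd (h # l)))"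
    unfolding n by (intro sum.cong refl) (simp only: mpow_chain[OF assms(1)] list.sel)
  also have "\<dots> = (\<Sum>l\<in>{l. set l \<subseteq> H \<and> length l = n}. chain M l (hd l))"
    unfolding n by (rule sum_lists_Suc[OF assms(1), symmetric])
  also have "\<dots> = (\<Sum>l\<in>{l. set l \<subseteq> H \<and> length l = n}. \<Prod>i<n. M (l ! i) (l ! ((i + 1) mod n)))"
  proof (intro sum.cong refl)
    fix l assume "l \<in> {l. set l \<subseteq> H \<and> length l = n}"
    then have l: "length l = n" "l \<noteq> []" using assms(2) by auto
    have "(l @ [hd l]) ! Suc i = l ! ((i + 1) mod n)" if "i < n" for i
      using that l by (cases "Suc i = n") (auto simp: nth_append hd_conv_nth)
    then show "chain M l (hd l) = (\<Prod>i<n. M (l ! i) (l ! ((i + 1) mod n)))"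
      unfolding chain_prod[OF l(2)] l(1) by (intro prod.cong refl) auto
  qed
  finally show ?thesis .
qed

lemma prod_shift_mod:
  fixes f :: "nat \<Rightarrow> 'b::comm_monoid_mult"
  assumes "n > 0"
  shows "(\<Prod>i<n. f ((i + k) mod n)) = (\<Prod>i<n. f i)"
proof (rule prod.reindex_bij_witness[of _ "\<lambda>j. (j + (n - k mod n)) mod n" "\<lambda>i. (i + k) mod n"])
  have k: "k mod n \<le> n" using assms by (simp add: less_imp_le)
  fix i assume "i \<in> {..<n}"
  then have i: "i < n" by simp
  have "((i + k) mod n + (n - k mod n)) mod n = (i + k mod n + (n - k mod n)) mod n"
    by (metis mod_add_left_eq mod_add_right_eq)
  also have "\<dots> = (i + n) mod n" using k by simp
  finally show "((i + k) mod n + (n - k mod n)) mod n = i" using i by simp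
  have "((i + (n - k mod n)) mod n + k) mod n = (i + (n - k mod n) + k mod n) mod n"
    by (metis mod_add_left_eq mod_add_right_eq)
  also have "\<dots> = (i + n) mod n" using k by simp
  finally show "((i + (n - k mod n)) mod n + k) mod n = i" using i by simp
qed (use assms in auto)

lemma closed_path_iff:
  assumes "length vs = n"
  shows "closed_path E vs \<longleftrightarrow> n > 0 \<and>
     (\<forall>i<n. {vs ! i, vs ! ((i + 1) mod n)} \<in> E \<and> vs ! ((i + 2) mod n) \<noteq> vs ! i)"
proof
  assume r: "n > 0 \<and> (\<forall>i<n. {vs ! i, vs ! ((i + 1) mod n)} \<in> E \<and> vs ! ((i + 2) mod n) \<noteq> vs ! i)"
  have "{vs ! i, vs ! (i + 1)} \<in> E" if "i + 1 < n" for i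
  proof -
    have "(i + 1) mod n = i + 1" "i < n" using that by auto
    then show ?thesis using r by metis
  qed
  moreover have "vs ! (i + 2) \<noteq> vs ! i" if "i + 2 < n" for i
  proof -
    have "(i + 2) mod n = i + 2" "i < n" using that by auto
    then show ?thesis using r by metis
  qed
  moreover have "vs \<noteq> []" using r assms by auto
  ultimately show "closed_path E vs"
    unfolding closed_path_def is_path_def assms using r by blast
qed (use assms in \<open>auto simp: closed_path_def\<close>)

text \<open>The negative of \<open>loop_sign\<close>. Unlike the latter it is a product of local
  factors along the path.\<close>

definition turn_phase :: "complex list \<Rightarrow> complex" where
  "turn_phase vs = exp (\<i> * of_real (winding_angle vs) / 2)"

definition edge_prod :: "(complex set \<Rightarrow> 'b::comm_monoid_mult) \<Rightarrow> complex list \<Rightarrow> 'b" where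
  "edge_prod x vs = (\<Prod>i<length vs. x {vs ! i, vs ! ((i + 1) mod length vs)})"

context plane_graph
begin

definition closed_paths :: "nat \<Rightarrow> complex list set" where
  "closed_paths n = {vs. closed_path E vs \<and> length vs = n}"

lemma finite_closed_paths: "finite (closed_paths n)"
proof (rule finite_subset)
  show "closed_paths n \<subseteq> {vs. set vs \<subseteq> V \<and> length vs = n}"
  proof
    fix vs assume "vs \<in> closed_paths n"
    then have vs: "closed_path E vs" "length vs = n" by (auto simp: closed_paths_def)
    have "vs ! i \<in> V" if "i < n" for i
      using that vs closed_path_iff[OF vs(2)] edge_V by blast
    then show "vs \<in> {vs. set vs \<subseteq> V \<and> length vs = n}" using vs(2) by (auto simp: in_set_conv_nth)
  qed
qed (simp add: finite_V finite_lists_length_eq)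

text \<open>Any matrix supported on steps that continue without turning back has this trace, so the
  lemma serves both \<open>tmat\<close> and the real majorant \<open>nmat\<close>. Cyclic lists of
  half-edges and closed vertex sequences determine each other.\<close>

lemma trace_closed_paths:
  fixes M :: "complex \<times> complex \<Rightarrow> complex \<times> complex \<Rightarrow> 'b::comm_ring_1"
  assumes M: "\<And>h g. h \<in> hedges \<Longrightarrow> g \<in> hedges \<Longrightarrow> \<not> (snd h = fst g \<and> snd g \<noteq> fst h) \<Longrightarrow> M h g = 0"
    and n: "n > 0"
  shows "(\<Sum>h\<in>hedges. mpow hedges M n h h) = (\<Sum>vs\<in>closed_paths n. \<Prod>i<n.
     M (vs ! i, vs ! ((i + 1) mod n)) (vs ! ((i + 1) mod n), vs ! ((i + 2) mod n)))"
proof -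
  let ?good = "{l. set l \<subseteq> hedges \<and> length l = n \<and>
    (\<forall>i<n. snd (l ! i) = fst (l ! ((i + 1) mod n)) \<and> snd (l ! ((i + 1) mod n)) \<noteq> fst (l ! i))}"
  have mod2: "((i + 1) mod n + 1) mod n = (i + 2) mod n" for i by (simp add: mod_Suc_eq)
  have lt: "(i + 1) mod n < n" for i using n by simp
  have "(\<Sum>h\<in>hedges. mpow hedges M n h h)
     = (\<Sum>l\<in>{l. set l \<subseteq> hedges \<and> length l = n}. \<Prod>i<n. M (l ! i) (l ! ((i + 1) mod n)))"
    by (rule trace_mpow[OF finite_hedges n])
  also have "\<dots> = (\<Sum>l\<in>?good. \<Prod>i<n. M (l ! i) (l ! ((i + 1) mod n)))"
  proof (rule sum.mono_neutral_right)
    show "finite {l. set l \<subseteq> hedges \<and> length l = n}"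
      by (rule finite_lists_length_eq[OF finite_hedges])
    show "\<forall>l\<in>{l. set l \<subseteq> hedges \<and> length l = n} - ?good. (\<Prod>i<n. M (l ! i) (l ! ((i + 1) mod n))) = 0"
    proof
      fix l assume l: "l \<in> {l. set l \<subseteq> hedges \<and> length l = n} - ?good"
      then obtain i where i: "i < n" "\<not> (snd (l ! i) = fst (l ! ((i + 1) mod n)) \<and> snd (l ! ((i + 1) mod n)) \<noteq> fst (l ! i))"
        by blast
      have "l ! i \<in> hedges" "l ! ((i + 1) mod n) \<in> hedges" using l i(1) lt nth_mem by fastforce+
      then have "M (l ! i) (l ! ((i + 1) mod n)) = 0" using i(2) by (rule M)
      then show "(\<Prod>i<n. M (l ! i) (l ! ((i + 1) mod n))) = 0"
        using i(1) by (intro prod_zero) auto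
    qed
  qed auto
  also have "\<dots> = (\<Sum>vs\<in>closed_paths n. \<Prod>i<n.
     M (vs ! i, vs ! ((i + 1) mod n)) (vs ! ((i + 1) mod n), vs ! ((i + 2) mod n)))"
  proof (rule sum.reindex_bij_witness[where
        i = "\<lambda>vs. map (\<lambda>i. (vs ! i, vs ! ((i + 1) mod n))) [0..<n]" and j = "map fst"])
    fix l assume l: "l \<in> ?good"
    then have len: "length l = n" and ed: "\<And>i. i < n \<Longrightarrow> l ! i \<in> hedges"
      and step: "\<And>i. i < n \<Longrightarrow> snd (l ! i) = fst (l ! ((i + 1) mod n))"
      and nb: "\<And>i. i < n \<Longrightarrow> snd (l ! ((i + 1) mod n)) \<noteq> fst (l ! i)"
      using nth_mem by fastforce+
    have nth: "l ! i = (map fst l ! i, map fst l ! ((i + 1) mod n))" if "i < n" for i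
      using that step[OF that] len lt[of i] by (simp add: prod_eq_iff)
    show "map (\<lambda>i. (map fst l ! i, map fst l ! ((i + 1) mod n))) [0..<n] = l"
      using nth len by (intro nth_equalityI) auto
    have "closed_path E (map fst l)"
    proof (subst closed_path_iff[of _ n])
      show "length (map fst l) = n" using len by simp
      show "0 < n \<and> (\<forall>i<n. {map fst l ! i, map fst l ! ((i + 1) mod n)} \<in> E \<and> map fst l ! ((i + 2) mod n) \<noteq> map fst l ! i)"
      proof (intro conjI allI impI n)
        fix i assume i: "i < n"
        show "{map fst l ! i, map fst l ! ((i + 1) mod n)} \<in> E"
          using ed[OF i] nth[OF i] by (auto simp: hedges_def)
        show "map fst l ! ((i + 2) mod n) \<noteq> map fst l ! i"
          using nb[OF i] nth[OF lt[of i]] nth[OF i] mod2[of i] by (metis fst_conv snd_conv)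
      qed
    qed
    then show "map fst l \<in> closed_paths n" using len by (simp add: closed_paths_def)
    show "(\<Prod>i<n. M (map fst l ! i, map fst l ! ((i + 1) mod n))
        (map fst l ! ((i + 1) mod n), map fst l ! ((i + 2) mod n)))
      = (\<Prod>i<n. M (l ! i) (l ! ((i + 1) mod n)))"
    proof (intro prod.cong refl)
      fix i assume "i \<in> {..<n}"
      then show "M (map fst l ! i, map fst l ! ((i + 1) mod n))
        (map fst l ! ((i + 1) mod n), map fst l ! ((i + 2) mod n)) = M (l ! i) (l ! ((i + 1) mod n))"
        using nth[of i] nth[OF lt[of i]] mod2[of i] by simp
    qed
  next
    fix vs assume "vs \<in> closed_paths n"
    then have vs: "closed_path E vs" "length vs = n" by (auto simp: closed_paths_def)
    let ?l = "map (\<lambda>i. (vs ! i, vs ! ((i + 1) mod n))) [0..<n]"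
    show "map fst ?l = vs" using vs(2) by (intro nth_equalityI) auto
    have c: "{vs ! i, vs ! ((i + 1) mod n)} \<in> E" "vs ! ((i + 2) mod n) \<noteq> vs ! i" if "i < n" for i
      using closed_path_iff[OF vs(2)] vs(1) that by auto
    have "set ?l \<subseteq> hedges" using c(1) by (auto simp: hedges_def)
    moreover have "snd (?l ! i) = fst (?l ! ((i + 1) mod n)) \<and> snd (?l ! ((i + 1) mod n)) \<noteq> fst (?l ! i)"
      if "i < n" for i
      using c(2)[OF that] lt[of i] that mod2[of i] by (simp del: mod_Suc_eq)
    ultimately show "?l \<in> ?good" by simp
  qed
  finally show ?thesis .
qed

section \<open>Entries of the transition matrix, turning angles and signs\<close>

lemma tmat_zero:
  assumes "\<not> (snd h = fst g \<and> snd g \<noteq> fst h)"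
  shows "tmat x h g = 0"
proof (cases "prod.swap h = g")
  case True
  then show ?thesis by (simp add: tmat_def acoef_def)
next
  case False
  then have "fst (prod.swap h) \<noteq> fst g" using assms by (auto simp: prod_eq_iff)
  then have "\<not> blk {prod.swap h, g}" unfolding blk_def by blast
  then show ?thesis using False by (simp add: tmat_def acoef_def awt_def)
qed

lemma tmat_eq:
  assumes "{u, v} \<in> E" "{v, w} \<in> E" "w \<noteq> u"
  shows "tmat x (u, v) (v, w) = of_int (hsign (u, v) (v, u) * hsign (v, u) (v, w)) *
    (csqrt (x {u, v}) * csqrt (x {v, w}))"
proof -
  have ne: "(v, u) \<noteq> (v, w)" using assms(3) by simp
  have "awt x {(v, u), (v, w)} = csqrt (x {u, v}) * csqrt (x {v, w})"
    using ne by (simp add: awt_def blk_def insert_commute[of v u])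
  then show ?thesis using ne by (simp add: tmat_def acoef_def)
qed

text \<open>The turning angle is \<beta> - \<alpha> up to a wrap by 2\<pi>, and a wrap negates the
  half-angle phase. The two order signs detect it. For \<alpha> > 0 the first is 1 and the second is
  -1 exactly when \<beta> - \<alpha> \<le> -\<pi>. For \<alpha> \<le> 0 the first is -1 and the
  second is 1 exactly when \<beta> - \<alpha> > \<pi>.\<close>

lemma exp_turn_angle:
  assumes "{u, v} \<in> E" "{v, w} \<in> E" "w \<noteq> u"
  shows "exp (\<i> * of_real (turn_angle (v - u) (w - v)) / 2)
    = of_int (hsign (u, v) (v, u) * hsign (v, u) (v, w)) *
      (exp (\<i> * of_real (Arg (w - v)) / 2) / exp (\<i> * of_real (Arg (v - u)) / 2))"
proof -
  define \<alpha> \<beta> where "\<alpha> = Arg (v - u)" and "\<beta> = Arg (w - v)"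
  have V: "u \<in> V" "v \<in> V" "u \<noteq> v" "v \<noteq> w" using edge_V[OF assms(1)] edge_V[OF assms(2)] by auto
  have nz: "v - u \<noteq> 0" "w - v \<noteq> 0" using V by auto
  have b: "- pi < \<alpha>" "\<alpha> \<le> pi" "- pi < \<beta>" "\<beta> \<le> pi" unfolding \<alpha>_def \<beta>_def using Arg_bounded by auto
  have turn: "turn_angle (v - u) (w - v) = \<beta> - \<alpha> + (if \<beta> - \<alpha> > pi then -2 * pi else if \<beta> - \<alpha> \<le> -pi then 2 * pi else 0)"
    unfolding turn_angle_def \<alpha>_def \<beta>_def using nz by (intro Arg_divide')
  have Argm: "Arg (u - v) = (if \<alpha> \<le> 0 then \<alpha> + pi else \<alpha> - pi)"
    using Arg_minus[OF nz(1)] by (simp add: \<alpha>_def)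
  have e1: "hsign (u, v) (v, u) = (if \<alpha> > 0 then 1 else -1)"
  proof (cases "\<alpha> > 0")
    case True
    then have "below u v" by (simp add: below_def up_iff_Arg \<alpha>_def)
    then show ?thesis using key_sign_below(1)[OF V(1)] True by simp
  next
    case False
    then have "below v u" using below_total[OF V(3)] by (auto simp: below_def up_iff_Arg \<alpha>_def)
    then show ?thesis using key_sign_below(2)[OF V(2)] False by simp
  qed
  have e2: "hsign (v, u) (v, w) = (if Arg (u - v) < \<beta> then 1 else -1)"
    by (simp add: key_sign_same \<beta>_def)
  have quot: "exp (\<i> * of_real \<beta> / 2) / exp (\<i> * of_real \<alpha> / 2) = exp (\<i> * of_real (\<beta> - \<alpha>) / 2)"
    by (simp add: exp_diff diff_divide_distrib right_diff_distrib)
  have plus: "exp (\<i> * of_real (t + 2 * pi) / 2) = - exp (\<i> * of_real t / 2)"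
    "exp (\<i> * of_real (t - 2 * pi) / 2) = - exp (\<i> * of_real t / 2)" for t
  proof -
    have "\<i> * of_real (t + 2 * pi) / 2 = \<i> * of_real t / 2 + of_real pi * \<i>" by (simp add: field_simps)
    then show "exp (\<i> * of_real (t + 2 * pi) / 2) = - exp (\<i> * of_real t / 2)"
      by (simp only: exp_add exp_pi_i) simp
    have "\<i> * of_real (t - 2 * pi) / 2 = \<i> * of_real t / 2 - of_real pi * \<i>" by (simp add: field_simps)
    then show "exp (\<i> * of_real (t - 2 * pi) / 2) = - exp (\<i> * of_real t / 2)"
      by (simp only: exp_diff exp_pi_i) simp
  qed
  show ?thesis unfolding \<alpha>_def[symmetric] \<beta>_def[symmetric] quot e1 e2 Argm
  proof (cases "\<alpha> > 0")
    case True
    then have "\<not> \<beta> - \<alpha> > pi" using b by linarith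
    then have "turn_angle (v - u) (w - v) = (if \<beta> - \<alpha> \<le> -pi then \<beta> - \<alpha> + 2 * pi else \<beta> - \<alpha>)" using turn by simp
    then show "exp (\<i> * of_real (turn_angle (v - u) (w - v)) / 2) = of_int ((if \<alpha> > 0 then 1 else -1) *
        (if (if \<alpha> \<le> 0 then \<alpha> + pi else \<alpha> - pi) < \<beta> then 1 else -1)) * exp (\<i> * of_real (\<beta> - \<alpha>) / 2)"
      using True plus(1)[of "\<beta> - \<alpha>"] by simp
  next
    case False
    then have "\<not> \<beta> - \<alpha> \<le> - pi" using b by linarith
    then have "turn_angle (v - u) (w - v) = (if \<beta> - \<alpha> > pi then \<beta> - \<alpha> - 2 * pi else \<beta> - \<alpha>)" using turn by simp
    then show "exp (\<i> * of_real (turn_angle (v - u) (w - v)) / 2) = of_int ((if \<alpha> > 0 then 1 else -1) *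
        (if (if \<alpha> \<le> 0 then \<alpha> + pi else \<alpha> - pi) < \<beta> then 1 else -1)) * exp (\<i> * of_real (\<beta> - \<alpha>) / 2)"
      using False plus(2)[of "\<beta> - \<alpha>"] by auto
  qed
qed

definition turn_sign :: "complex list \<Rightarrow> int" where
  "turn_sign vs = (\<Prod>i<length vs. let n = length vs; u = vs ! i; v = vs ! ((i + 1) mod n); w = vs ! ((i + 2) mod n)
     in hsign (u, v) (v, u) * hsign (v, u) (v, w))"

text \<open>Around a closed path the quotients of half-angle phases telescope, leaving only the
  order signs. This is the conjugation to the Kac-Ward matrix, read on its traces.\<close>

lemma turn_phase_eq:
  assumes "closed_path E vs"
  shows "turn_phase vs = of_int (turn_sign vs)"
proof -
  define n where "n = length vs"
  have c: "n > 0" "\<And>i. i < n \<Longrightarrow> {vs ! i, vs ! ((i + 1) mod n)} \<in> E" "\<And>i. i < n \<Longrightarrow> vs ! ((i + 2) mod n) \<noteq> vs ! i"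
    using closed_path_iff[of vs n] assms by (auto simp: n_def)
  have mod2: "((i + 1) mod n + 1) mod n = (i + 2) mod n" for i by (simp add: mod_Suc_eq)
  have lt: "(i + 1) mod n < n" for i using c(1) by simp
  define s where "s = (\<lambda>i. exp (\<i> * of_real (Arg (vs ! ((i + 1) mod n) - vs ! i)) / 2))"
  let ?e = "\<lambda>i. of_int (hsign (vs ! i, vs ! ((i + 1) mod n)) (vs ! ((i + 1) mod n), vs ! i) *
     hsign (vs ! ((i + 1) mod n), vs ! i) (vs ! ((i + 1) mod n), vs ! ((i + 2) mod n))) :: complex"
  have "turn_phase vs = (\<Prod>i<n. exp (\<i> * of_real (turn_angle (vs ! ((i + 1) mod n) - vs ! i)
                       (vs ! ((i + 2) mod n) - vs ! ((i + 1) mod n))) / 2))"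
    unfolding turn_phase_def winding_angle_def Let_def n_def[symmetric]
    by (simp add: sum_distrib_left sum_divide_distrib exp_sum)
  also have "\<dots> = (\<Prod>i<n. ?e i * (s ((i + 1) mod n) / s i))"
  proof (intro prod.cong refl)
    fix i assume "i \<in> {..<n}"
    then have i: "i < n" by simp
    have "{vs ! ((i + 1) mod n), vs ! ((i + 2) mod n)} \<in> E" using c(2)[OF lt[of i]] mod2[of i] by simp
    then show "exp (\<i> * of_real (turn_angle (vs ! ((i + 1) mod n) - vs ! i)
                       (vs ! ((i + 2) mod n) - vs ! ((i + 1) mod n))) / 2) = ?e i * (s ((i + 1) mod n) / s i)"
      using exp_turn_angle[OF c(2)[OF i] _ c(3)[OF i]] unfolding s_def mod2 by blast
  qed
  also have "\<dots> = (\<Prod>i<n. ?e i) * ((\<Prod>i<n. s ((i + 1) mod n)) / (\<Prod>i<n. s i))"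
    by (simp only: prod.distrib prod_dividef)
  also have "(\<Prod>i<n. s ((i + 1) mod n)) = (\<Prod>i<n. s i)" by (rule prod_shift_mod[OF c(1)])
  also have "(\<Prod>i<n. s i) / (\<Prod>i<n. s i) = 1" by (simp add: s_def)
  finally show ?thesis by (simp add: turn_sign_def Let_def n_def)
qed

text \<open>An integer product of signs squares to 1; thus the winding angle is a multiple of 2\<pi>
  without any topological argument.\<close>

lemma turn_phase_cases:
  assumes "closed_path E vs"
  shows "turn_phase vs = 1 \<or> turn_phase vs = -1"
proof -
  have "turn_sign vs * turn_sign vs = 1"
    unfolding turn_sign_def prod.distrib[symmetric] Let_def
    by (intro prod.neutral) (auto simp: key_sign_def)
  then have "turn_sign vs = 1 \<or> turn_sign vs = -1" by (metis zmult_eq_1_iff)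
  then show ?thesis using turn_phase_eq[OF assms] by auto
qed

text \<open>The square root of each traversed edge occurs in two consecutive matrix entries, which
  together restore its weight.\<close>

lemma trace_tmat:
  assumes n: "n > 0"
  shows "(\<Sum>h\<in>hedges. mpow hedges (tmat x) n h h) = (\<Sum>vs\<in>closed_paths n. turn_phase vs * edge_prod x vs)"
proof -
  have "(\<Sum>h\<in>hedges. mpow hedges (tmat x) n h h) = (\<Sum>vs\<in>closed_paths n. \<Prod>i<n.
     tmat x (vs ! i, vs ! ((i + 1) mod n)) (vs ! ((i + 1) mod n), vs ! ((i + 2) mod n)))"
    by (rule trace_closed_paths[OF tmat_zero n])
  also have "\<dots> = (\<Sum>vs\<in>closed_paths n. turn_phase vs * edge_prod x vs)"
  proof (intro sum.cong refl)
    fix vs assume "vs \<in> closed_paths n"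
    then have vs: "closed_path E vs" "length vs = n" by (auto simp: closed_paths_def)
    have c: "\<And>i. i < n \<Longrightarrow> {vs ! i, vs ! ((i + 1) mod n)} \<in> E" "\<And>i. i < n \<Longrightarrow> vs ! ((i + 2) mod n) \<noteq> vs ! i"
      using closed_path_iff[OF vs(2)] vs(1) by auto
    have mod2: "((i + 1) mod n + 1) mod n = (i + 2) mod n" for i by (simp add: mod_Suc_eq)
    have lt: "(i + 1) mod n < n" for i using n by simp
    define r where "r = (\<lambda>i. csqrt (x {vs ! i, vs ! ((i + 1) mod n)}))"
    let ?e = "\<lambda>i. of_int (hsign (vs ! i, vs ! ((i + 1) mod n)) (vs ! ((i + 1) mod n), vs ! i) *
     hsign (vs ! ((i + 1) mod n), vs ! i) (vs ! ((i + 1) mod n), vs ! ((i + 2) mod n))) :: complex"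
    have "(\<Prod>i<n. tmat x (vs ! i, vs ! ((i + 1) mod n)) (vs ! ((i + 1) mod n), vs ! ((i + 2) mod n)))
       = (\<Prod>i<n. ?e i * (r i * r ((i + 1) mod n)))"
    proof (intro prod.cong refl)
      fix i assume "i \<in> {..<n}"
      then have i: "i < n" by simp
      have "{vs ! ((i + 1) mod n), vs ! ((i + 2) mod n)} \<in> E" using c(1)[OF lt[of i]] mod2[of i] by simp
      then show "tmat x (vs ! i, vs ! ((i + 1) mod n)) (vs ! ((i + 1) mod n), vs ! ((i + 2) mod n))
          = ?e i * (r i * r ((i + 1) mod n))"
        using tmat_eq[OF c(1)[OF i] _ c(2)[OF i]] unfolding r_def mod2 by blast
    qed
    also have "\<dots> = (\<Prod>i<n. ?e i) * ((\<Prod>i<n. r i) * (\<Prod>i<n. r ((i + 1) mod n)))"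
      by (simp only: prod.distrib)
    also have "(\<Prod>i<n. r ((i + 1) mod n)) = (\<Prod>i<n. r i)" by (rule prod_shift_mod[OF n])
    also have "(\<Prod>i<n. r i) * (\<Prod>i<n. r i) = edge_prod x vs"
      unfolding edge_prod_def vs(2) prod.distrib[symmetric] r_def
      by (intro prod.cong refl) (simp flip: power2_eq_square)
    also have "(\<Prod>i<n. ?e i) = turn_phase vs"
      unfolding turn_phase_eq[OF vs(1)] turn_sign_def vs(2) Let_def by simp
    finally show "(\<Prod>i<n. tmat x (vs ! i, vs ! ((i + 1) mod n)) (vs ! ((i + 1) mod n), vs ! ((i + 2) mod n)))
       = turn_phase vs * edge_prod x vs" .
  qed
  finally show ?thesis .
qed

end

section \<open>Loops\<close>

definition cyc :: "'a list \<Rightarrow> nat \<Rightarrow> 'a" where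
  "cyc vs i = vs ! (i mod length vs)"

lemma cyc_mod: "cyc vs (i mod length vs + k) = cyc vs (i + k)"
  by (simp add: cyc_def mod_add_left_eq)

lemma cyc_mod_0: "cyc vs (i mod length vs) = cyc vs i"
  by (simp add: cyc_def)

lemma cyc_rotate: "vs \<noteq> [] \<Longrightarrow> cyc (rotate k vs) i = cyc vs (k + i)"
  by (simp add: cyc_def nth_rotate mod_add_right_eq)

text \<open>The bound by twice the length avoids truncated subtraction while still admitting
  \<open>i + 1\<close> and \<open>i + 2\<close> for \<open>i\<close> below a length of at least
  2.\<close>

lemma cyc_rev:
  assumes "i < 2 * length vs"
  shows "cyc (rev vs) i = cyc vs (2 * length vs - 1 - i)"
proof (cases "i < length vs")
  case True
  then have "2 * length vs - 1 - i = (length vs - Suc i) + length vs" by simp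
  then have "(2 * length vs - 1 - i) mod length vs = length vs - Suc i" using True by (simp only: mod_add_self2) simp
  then show ?thesis using True by (simp add: cyc_def rev_nth)
next
  case False
  define j where "j = i - length vs"
  have j: "i = j + length vs" "j < length vs" using False assms by (auto simp: j_def)
  have "2 * length vs - 1 - i = length vs - Suc j" using j by simp
  then show ?thesis using j by (simp add: cyc_def rev_nth)
qed

text \<open>The common form of \<open>turn_phase\<close> and \<open>edge_prod\<close>, so that their
  behaviour under rotation and reversal is proved once.\<close>

definition cyc_prod :: "('a \<Rightarrow> 'a \<Rightarrow> 'a \<Rightarrow> 'b::comm_monoid_mult) \<Rightarrow> 'a list \<Rightarrow> 'b" where
  "cyc_prod F vs = (\<Prod>i<length vs. F (cyc vs i) (cyc vs (i + 1)) (cyc vs (i + 2)))"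

lemma cyc_prod_shift:
  assumes "vs \<noteq> []"
  shows "(\<Prod>i<length vs. F (cyc vs (i + k)) (cyc vs (i + k + 1)) (cyc vs (i + k + 2))) = cyc_prod F vs"
proof -
  have "(\<Prod>i<length vs. F (cyc vs (i + k)) (cyc vs (i + k + 1)) (cyc vs (i + k + 2)))
    = (\<Prod>i<length vs. (\<lambda>j. F (cyc vs j) (cyc vs (j + 1)) (cyc vs (j + 2))) ((i + k) mod length vs))"
    by (simp only: cyc_mod cyc_mod_0)
  also have "\<dots> = cyc_prod F vs"
    unfolding cyc_prod_def by (rule prod_shift_mod) (use assms in simp)
  finally show ?thesis .
qed

lemma cyc_prod_rotate: "vs \<noteq> [] \<Longrightarrow> cyc_prod F (rotate k vs) = cyc_prod F vs"
  using cyc_prod_shift[of vs F k]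
  by (subst cyc_prod_def) (simp add: cyc_rotate add_ac)

lemma cyc_prod_rev:
  assumes n: "2 \<le> length vs"
  shows "cyc_prod F (rev vs) = cyc_prod (\<lambda>a b c. F c b a) vs"
proof -
  let ?n = "length vs" and ?G = "\<lambda>a b c. F c b a"
  \<comment> \<open>The triple at \<open>i\<close> of the reversed list is the triple at
    \<open>(n - 1 - i) + (n - 2)\<close> of the list, read backwards, where \<open>n\<close> is the
    length.\<close>
  have "cyc_prod F (rev vs) = (\<Prod>i<?n. (\<lambda>j. ?G (cyc vs (j + (?n - 2))) (cyc vs (j + (?n - 2) + 1)) (cyc vs (j + (?n - 2) + 2))) (?n - Suc i))"
    unfolding cyc_prod_def length_rev
  proof (rule prod.cong[OF refl])
    fix i assume "i \<in> {..<?n}"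
    then have i: "i < ?n" by simp
    have "2 * ?n - 1 - i = (?n - Suc i) + (?n - 2) + 2" "2 * ?n - 1 - (i + 1) = (?n - Suc i) + (?n - 2) + 1"
      "2 * ?n - 1 - (i + 2) = (?n - Suc i) + (?n - 2)" using i n by auto
    then show "F (cyc (rev vs) i) (cyc (rev vs) (i + 1)) (cyc (rev vs) (i + 2)) =
       (\<lambda>j. ?G (cyc vs (j + (?n - 2))) (cyc vs (j + (?n - 2) + 1)) (cyc vs (j + (?n - 2) + 2))) (?n - Suc i)"
      using i n by (simp only: cyc_rev)
  qed
  also have "\<dots> = (\<Prod>j<?n. ?G (cyc vs (j + (?n - 2))) (cyc vs (j + (?n - 2) + 1)) (cyc vs (j + (?n - 2) + 2)))"
    by (rule prod.nat_diff_reindex)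
  also have "\<dots> = cyc_prod ?G vs" by (rule cyc_prod_shift) (use n in auto)
  finally show ?thesis .
qed

section \<open>Rotation orbits and multiplicity\<close>

definition rots :: "'a list \<Rightarrow> 'a list set" where
  "rots vs = range (\<lambda>k. rotate k vs)"

definition orb :: "'a list \<Rightarrow> 'a list set" where
  "orb vs = rots vs \<union> rots (rev vs)"

lemma self_rots: "vs \<in> rots vs"
  unfolding rots_def by (rule image_eqI[of _ _ 0]) auto

lemma rotate_back: "\<exists>j. rotate j (rotate k vs) = vs"
proof (cases "vs = []")
  case False
  have "(length vs - k mod length vs + k) mod length vs = (length vs - k mod length vs + k mod length vs) mod length vs"
    by (simp add: mod_add_right_eq)
  also have "\<dots> = 0" using False by (simp add: less_imp_le)
  finally show ?thesis by (intro exI[of _ "length vs - k mod length vs"]) (simp add: rotate_rotate rotate_id)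
qed simp

lemma rots_eq: "ws \<in> rots vs \<Longrightarrow> rots ws = rots vs"
proof -
  have sub: "rots (rotate k vs) \<subseteq> rots vs" for k and vs :: "'a list"
    by (auto simp: rots_def rotate_rotate)
  assume "ws \<in> rots vs"
  then obtain k where k: "ws = rotate k vs" by (auto simp: rots_def)
  obtain j where "rotate j ws = vs" using rotate_back k by blast
  then show ?thesis using sub[of k vs] sub[of j ws] k by auto
qed

text \<open>Reversal conjugates a rotation into its inverse.\<close>

lemma rev_rots: "ws \<in> rots vs \<Longrightarrow> rev ws \<in> rots (rev vs)"
proof -
  assume "ws \<in> rots vs"
  then obtain k where k: "ws = rotate k vs" by (auto simp: rots_def)
  obtain j where j: "rotate j ws = vs" using rotate_back k by blast
  have "rev vs \<in> rots (rev ws)"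
  proof -
    have "rotate (length ws - j mod length ws) (rev ws) \<in> rots (rev ws)" by (auto simp: rots_def)
    also have "rotate (length ws - j mod length ws) (rev ws) = rev vs"
    proof (cases "ws = []")
      case False
      show ?thesis
      proof (cases "j mod length ws = 0")
        case True
        then have "vs = ws" using j rotate_id[of j ws] by simp
        then show ?thesis using True by (simp add: rotate_id)
      next
        case n: False
        then have "(length ws - j mod length ws) mod length ws = length ws - j mod length ws"
          using False by simp
        then have "rotate (length ws - j mod length ws) (rev ws) = rev (rotate (j mod length ws) ws)"
          using False by (simp add: rotate_rev less_imp_le)
        then show ?thesis using j rotate_conv_mod[of j ws] by simp
      qed
    qed (use j in auto)
    finally show ?thesis .
  qed
  then show ?thesis using rots_eq self_rots by blast
qed

lemma rots_rev_eq: "rots (rev vs) = rev ` rots vs"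
proof (intro equalityI subsetI)
  fix ws assume "ws \<in> rots (rev vs)"
  then have "rev ws \<in> rots vs" using rev_rots[of ws "rev vs"] by simp
  then show "ws \<in> rev ` rots vs" by (intro image_eqI[of _ _ "rev ws"]) auto
qed (auto intro: rev_rots)

lemma self_orb: "vs \<in> orb vs"
  by (simp add: orb_def self_rots)

lemma orb_eq:
  assumes "ws \<in> orb vs"
  shows "orb ws = orb vs"
proof (cases "ws \<in> rots vs")
  case True
  then show ?thesis using rots_eq[OF True] rots_eq[OF rev_rots[OF True]] by (simp add: orb_def)
next
  case False
  then have w: "ws \<in> rots (rev vs)" using assms by (simp add: orb_def)
  then show ?thesis using rots_eq[OF w] rots_eq[OF rev_rots[OF w]] by (simp add: orb_def Un_commute)
qed

lemma rots_lessThan: "vs \<noteq> [] \<Longrightarrow> rots vs = (\<lambda>k. rotate k vs) ` {..<length vs}"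
  unfolding rots_def
proof (intro equalityI subsetI)
  fix ws assume "vs \<noteq> []" "ws \<in> range (\<lambda>k. rotate k vs)"
  then obtain k where "ws = rotate (k mod length vs) vs" using rotate_conv_mod by blast
  then show "ws \<in> (\<lambda>k. rotate k vs) ` {..<length vs}" using \<open>vs \<noteq> []\<close> by auto
qed auto

text \<open>Orbit counting for the cyclic group: rotations depend only on the amount modulo the
  least period \<open>p\<close>, and smaller amounts give distinct lists. So the orbit has
  \<open>p\<close> elements and the multiplicity is the length divided by \<open>p\<close>.\<close>

lemma card_rots:
  assumes "vs \<noteq> []"
  shows "card (rots vs) * multiplicity vs = length vs" "multiplicity vs > 0"
proof -
  define p where "p = (LEAST p. 0 < p \<and> rotate p vs = vs)"
  have "0 < length vs \<and> rotate (length vs) vs = vs" using assms by (simp add: rotate_id)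
  then have "0 < p \<and> rotate p vs = vs" unfolding p_def by (rule LeastI)
  then have p: "0 < p" "rotate p vs = vs" by auto
  have least: "q = 0" if "rotate q vs = vs" "q < p" for q
    using that not_less_Least[of q "\<lambda>p. 0 < p \<and> rotate p vs = vs"] by (auto simp: p_def)
  have mult: "rotate (p * q) vs = vs" for q
    by (induction q) (use p(2) in \<open>auto simp flip: rotate_rotate\<close>)
  have md: "rotate k vs = rotate (k mod p) vs" for k
  proof -
    have "rotate k vs = rotate (k mod p + p * (k div p)) vs" by simp
    also have "\<dots> = rotate (k mod p) vs" by (simp only: rotate_rotate[symmetric] mult)
    finally show ?thesis .
  qed
  have "length vs mod p = 0"
    using md[of "length vs"] p(1) by (intro least) (auto simp: rotate_id)
  then have dvd: "length vs = p * (length vs div p)" by auto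
  have "inj_on (\<lambda>k. rotate k vs) {..<p}"
  proof (rule linorder_inj_onI)
    fix i j assume ij: "i < j" "i \<in> {..<p}" "j \<in> {..<p}"
    show "rotate i vs \<noteq> rotate j vs"
    proof
      assume "rotate i vs = rotate j vs"
      then have "rotate (p - j) (rotate i vs) = rotate (p - j) (rotate j vs)" by simp
      then have "rotate (p - j + i) vs = vs" using ij p(2) by (simp add: rotate_rotate)
      then have "p - j + i = 0" by (rule least) (use ij in auto)
      then show False using ij by auto
    qed
  qed auto
  moreover have "rots vs = (\<lambda>k. rotate k vs) ` {..<p}"
    unfolding rots_def using md p(1) by (auto simp: image_iff) (metis mod_less_divisor lessThan_iff)
  ultimately have card: "card (rots vs) = p" by (simp add: card_image)
  have m: "multiplicity vs = length vs div p" by (simp add: multiplicity_def p_def)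
  show "card (rots vs) * multiplicity vs = length vs" using card m dvd by simp
  show "multiplicity vs > 0" using m dvd assms by (metis length_greater_0_conv mult_0_right not_gr_zero)
qed

section \<open>Least elements in the lexicographic order\<close>

lemma vless_total: "vless p q \<or> p = q \<or> vless q p"
  by (auto simp: vless_def complex_eq_iff)

lemma seq_le_total: "seq_le xs ys \<or> seq_le ys xs"
  using lexord_linear[of "{(p, q). vless p q}" xs ys] vless_total by (auto simp: seq_le_def)

lemma seq_le_trans: "seq_le xs ys \<Longrightarrow> seq_le ys zs \<Longrightarrow> seq_le xs zs"
proof -
  have "trans {(p, q). vless p q}" by (auto simp: trans_def vless_def)
  then show "seq_le xs ys \<Longrightarrow> seq_le ys zs \<Longrightarrow> seq_le xs zs"
    unfolding seq_le_def using lexord_trans by blast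
qed

lemma seq_le_antisym:
  assumes "seq_le xs ys" "seq_le ys xs"
  shows "xs = ys"
proof (rule ccontr)
  assume "xs \<noteq> ys"
  then have "(xs, ys) \<in> lexord {(p, q). vless p q}" "(ys, xs) \<in> lexord {(p, q). vless p q}"
    using assms by (auto simp: seq_le_def)
  moreover have "asym {(p, q). vless p q}" by (auto simp: asym_iff vless_def)
  then have "asym (lexord {(p, q). vless p q})" by (rule lexord_asym)
  ultimately show False by (meson asymD)
qed

lemma seq_le_least:
  assumes "finite S" "S \<noteq> {}"
  obtains m where "m \<in> S" "\<And>y. y \<in> S \<Longrightarrow> seq_le m y"
proof -
  have "\<exists>m\<in>S. \<forall>y\<in>S. seq_le m y"
    using assms
  proof (induction S rule: finite_ne_induct)
    case (singleton a)
    then show ?case by (simp add: seq_le_def)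
  next
    case (insert a S)
    then obtain m where m: "m \<in> S" "\<forall>y\<in>S. seq_le m y" by blast
    show ?case
    proof (cases "seq_le a m")
      case True
      then have "\<forall>y\<in>insert a S. seq_le a y" using m seq_le_trans by (auto simp: seq_le_def[of a a])
      then show ?thesis by blast
    next
      case False
      then have "seq_le m a" using seq_le_total by blast
      then show ?thesis using m by blast
    qed
  qed
  then show thesis using that by blast
qed

section \<open>Closed paths up to rotation and reversal\<close>

context plane_graph
begin

text \<open>Quantifying over all natural indices turns rotation into a mere index shift.\<close>

lemma closed_path_cyc:
  "closed_path E vs \<longleftrightarrow> vs \<noteq> [] \<and> (\<forall>i. {cyc vs i, cyc vs (i + 1)} \<in> E \<and> cyc vs (i + 2) \<noteq> cyc vs i)"
proof -
  let ?n = "length vs"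
  have *: "{vs ! i, vs ! ((i + 1) mod ?n)} \<in> E \<and> vs ! ((i + 2) mod ?n) \<noteq> vs ! i \<longleftrightarrow>
     {cyc vs i, cyc vs (i + 1)} \<in> E \<and> cyc vs (i + 2) \<noteq> cyc vs i" if "i < ?n" for i
    using that by (simp add: cyc_def)
  have "(\<forall>i<?n. {cyc vs i, cyc vs (i + 1)} \<in> E \<and> cyc vs (i + 2) \<noteq> cyc vs i) \<longleftrightarrow>
    (\<forall>i. {cyc vs i, cyc vs (i + 1)} \<in> E \<and> cyc vs (i + 2) \<noteq> cyc vs i)" if "vs \<noteq> []"
  proof
    assume A: "\<forall>i<?n. {cyc vs i, cyc vs (i + 1)} \<in> E \<and> cyc vs (i + 2) \<noteq> cyc vs i"
    show "\<forall>i. {cyc vs i, cyc vs (i + 1)} \<in> E \<and> cyc vs (i + 2) \<noteq> cyc vs i"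
    proof
      fix i
      have "i mod ?n < ?n" using that by simp
      then have "{cyc vs (i mod ?n), cyc vs (i mod ?n + 1)} \<in> E \<and> cyc vs (i mod ?n + 2) \<noteq> cyc vs (i mod ?n)"
        using A by blast
      then show "{cyc vs i, cyc vs (i + 1)} \<in> E \<and> cyc vs (i + 2) \<noteq> cyc vs i"
        unfolding cyc_mod cyc_mod_0 .
    qed
  qed blast
  then show ?thesis using closed_path_iff[OF refl, of E vs] * by auto
qed

lemma closed_path_length:
  assumes "closed_path E vs"
  shows "3 \<le> length vs"
proof -
  note c = assms[unfolded closed_path_cyc]
  have "length vs \<noteq> 1"
  proof
    assume "length vs = 1"
    then have "cyc vs 0 = cyc vs 1" by (simp add: cyc_def)
    then show False using c edge_V[of "cyc vs 0" "cyc vs 1"] by (metis add_0)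
  qed
  moreover have "length vs \<noteq> 2"
  proof
    assume "length vs = 2"
    then have "cyc vs 0 = cyc vs 2" by (simp add: cyc_def)
    then show False using c by (metis add_0)
  qed
  ultimately show ?thesis using c by (cases "length vs") auto
qed

lemma closed_path_rotate: "closed_path E vs \<Longrightarrow> closed_path E (rotate k vs)"
  unfolding closed_path_cyc by (auto simp: cyc_rotate add.assoc[symmetric])

lemma closed_path_rev:
  assumes "closed_path E vs"
  shows "closed_path E (rev vs)"
proof -
  let ?n = "length vs"
  note c = assms[unfolded closed_path_cyc]
  have n3: "3 \<le> ?n" by (rule closed_path_length[OF assms])
  have "{rev vs ! i, rev vs ! ((i + 1) mod ?n)} \<in> E \<and> rev vs ! ((i + 2) mod ?n) \<noteq> rev vs ! i" if i: "i < ?n" for i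
  proof -
    define j where "j = 2 * ?n - 3 - i"
    have e: "2 * ?n - 1 - i = j + 2" "2 * ?n - 1 - (i + 1) = j + 1" "2 * ?n - 1 - (i + 2) = j"
      using i n3 by (auto simp: j_def)
    have "rev vs ! i = cyc vs (j + 2)" "rev vs ! ((i + 1) mod ?n) = cyc vs (j + 1)" "rev vs ! ((i + 2) mod ?n) = cyc vs j"
      using cyc_rev[of i vs] cyc_rev[of "i + 1" vs] cyc_rev[of "i + 2" vs] i n3 e
      by (auto simp: cyc_def[of "rev vs"])
    moreover have "{cyc vs (j + 1), cyc vs (j + 1 + 1)} \<in> E" "cyc vs (j + 2) \<noteq> cyc vs j"
      using c by blast+
    ultimately show ?thesis by (simp add: insert_commute)
  qed
  then show ?thesis using closed_path_iff[of "rev vs" ?n] n3 by auto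
qed

text \<open>A path equal to a rotation of its reversal would have a reflection axis. An axis through
  a vertex makes its two neighbours equal, which is backtracking; an axis through an edge makes its
  ends equal, which is a self-loop. Hence reversal exactly doubles each rotation orbit.\<close>

lemma rev_notin_rots:
  assumes "closed_path E vs"
  shows "rev vs \<notin> rots vs"
proof
  let ?n = "length vs"
  note c = assms[unfolded closed_path_cyc]
  have n3: "3 \<le> ?n" by (rule closed_path_length[OF assms])
  assume "rev vs \<in> rots vs"
  then obtain k where k: "k < ?n" "rev vs = rotate k vs" using c by (auto simp: rots_lessThan)
  have eq: "cyc vs (k + i) = cyc vs (2 * ?n - 1 - i)" if "i < 2 * ?n" for i
    using cyc_rotate[of vs k i] cyc_rev[OF that] k c by simp
  \<comment> \<open>Positions with index sum \<open>2 * ?n - 1 + k\<close> carry the same vertex, so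
    the axis sits at half this sum; its parity separates the two cases.\<close>
  define q where "q = (2 * ?n - 1 + k) div 2"
  have q: "q \<le> 2 * ?n - 2" using k n3 by (auto simp: q_def)
  have i: "2 * ?n - 2 - q < 2 * ?n" "2 * ?n - 1 - (2 * ?n - 2 - q) = q + 1" using q n3 by auto
  show False
  proof (cases "even (2 * ?n - 1 + k)")
    case True
    then have "2 * ?n - 1 + k = 2 * q" by (auto simp: q_def)
    then have "k + (2 * ?n - 2 - q) = q - 1" "1 \<le> q" using q n3 by auto
    then have "cyc vs (q - 1) = cyc vs ((q - 1) + 2)" using eq[OF i(1)] i(2) by simp
    then show False using c by metis
  next
    case False
    then have "2 * ?n - 1 + k = 2 * q + 1" unfolding q_def by presburger
    then have "k + (2 * ?n - 2 - q) = q" using q n3 by auto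
    then have "cyc vs q = cyc vs (q + 1)" using eq[OF i(1)] i(2) by simp
    then show False using c edge_V by metis
  qed
qed

lemma card_orb:
  assumes "closed_path E vs"
  shows "card (orb vs) = 2 * card (rots vs)"
proof -
  have ne: "vs \<noteq> []" using assms by (simp add: closed_path_def)
  have fin: "finite (rots vs)" by (simp add: rots_lessThan[OF ne])
  have "rots vs \<inter> rots (rev vs) = {}"
  proof (rule ccontr)
    assume "rots vs \<inter> rots (rev vs) \<noteq> {}"
    then obtain ws where "ws \<in> rots vs" "ws \<in> rots (rev vs)" by blast
    then have "rots vs = rots (rev vs)" using rots_eq by blast
    then show False using rev_notin_rots[OF assms] self_rots by blast
  qed
  then have "card (orb vs) = card (rots vs) + card (rev ` rots vs)"
    unfolding orb_def using fin by (subst card_Un_disjoint) (auto simp: rots_rev_eq)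
  then show ?thesis by (simp add: card_image inj_on_def)
qed

lemma orb_closed:
  assumes "closed_path E vs" "ws \<in> orb vs"
  shows "closed_path E ws" "length ws = length vs"
  using assms closed_path_rotate closed_path_rev by (auto simp: orb_def rots_def)

lemma is_loop_orb: "is_loop E vs \<longleftrightarrow> closed_path E vs \<and> (\<forall>ws\<in>orb vs. seq_le vs ws)"
proof (cases "closed_path E vs")
  case True
  then have "vs \<noteq> []" "rev vs \<noteq> []" by (auto simp: closed_path_def)
  then show ?thesis using True by (auto simp: is_loop_def orb_def rots_lessThan)
qed (simp add: is_loop_def)

definition loops :: "nat \<Rightarrow> complex list set" where
  "loops n = {l. is_loop E l \<and> length l = n}"

lemma loops_subset: "loops n \<subseteq> closed_paths n"
  by (auto simp: loops_def closed_paths_def is_loop_def)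

lemma finite_orb: "closed_path E vs \<Longrightarrow> finite (orb vs)"
  by (auto simp: orb_def closed_path_def rots_lessThan)

lemma closed_paths_Union: "closed_paths n = (\<Union>l\<in>loops n. orb l)"
proof (intro equalityI subsetI)
  fix vs assume "vs \<in> closed_paths n"
  then have vs: "closed_path E vs" "length vs = n" by (auto simp: closed_paths_def)
  obtain l where l: "l \<in> orb vs" "\<And>y. y \<in> orb vs \<Longrightarrow> seq_le l y"
    using seq_le_least[OF finite_orb[OF vs(1)]] self_orb by blast
  then have "l \<in> loops n"
    using orb_closed[OF vs(1) l(1)] vs(2) orb_eq[OF l(1)] by (auto simp: loops_def is_loop_orb)
  then show "vs \<in> (\<Union>l\<in>loops n. orb l)" using orb_eq[OF l(1)] self_orb by blast
next
  fix vs assume "vs \<in> (\<Union>l\<in>loops n. orb l)"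
  then show "vs \<in> closed_paths n"
    using orb_closed by (auto simp: loops_def is_loop_def closed_paths_def)
qed

text \<open>The orbits of distinct loops are disjoint because the least element of an orbit is
  unique, and \<open>card_orb\<close> with \<open>card_rots\<close> gives the orbit size
  \<open>2 * n / multiplicity l\<close>.\<close>

lemma sum_closed_paths_loops:
  fixes W :: "complex list \<Rightarrow> complex"
  assumes inv: "\<And>vs ws. closed_path E vs \<Longrightarrow> ws \<in> orb vs \<Longrightarrow> W ws = W vs"
  shows "(\<Sum>vs\<in>closed_paths n. W vs) = 2 * of_nat n * (\<Sum>l\<in>loops n. W l / of_nat (multiplicity l))"
proof -
  have disj: "\<forall>l\<in>loops n. \<forall>l'\<in>loops n. l \<noteq> l' \<longrightarrow> orb l \<inter> orb l' = {}"
  proof (intro ballI impI, rule ccontr)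
    fix l l' assume l: "l \<in> loops n" "l' \<in> loops n" "l \<noteq> l'" "orb l \<inter> orb l' \<noteq> {}"
    then obtain w where "w \<in> orb l" "w \<in> orb l'" by blast
    then have "orb l = orb l'" using orb_eq by metis
    then have "seq_le l l'" "seq_le l' l"
      using l(1,2) self_orb by (auto simp: loops_def is_loop_orb)
    then show False using seq_le_antisym l(3) by blast
  qed
  have fin: "finite (loops n)" using loops_subset finite_closed_paths finite_subset by blast
  have "(\<Sum>vs\<in>closed_paths n. W vs) = (\<Sum>l\<in>loops n. \<Sum>vs\<in>orb l. W vs)"
    unfolding closed_paths_Union
    by (rule sum.UNION_disjoint[OF fin _ disj]) (auto simp: loops_def is_loop_def finite_orb)
  also have "\<dots> = (\<Sum>l\<in>loops n. 2 * of_nat n * (W l / of_nat (multiplicity l)))"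
  proof (rule sum.cong[OF refl])
    fix l assume "l \<in> loops n"
    then have l: "closed_path E l" "length l = n" by (auto simp: loops_def is_loop_def)
    then have ne: "l \<noteq> []" by (auto simp: closed_path_def)
    have "(\<Sum>vs\<in>orb l. W vs) = (\<Sum>vs\<in>orb l. W l)" by (intro sum.cong refl inv l(1))
    also have "\<dots> = 2 * of_nat (card (rots l)) * W l" by (simp add: card_orb[OF l(1)])
    also have "of_nat n = (of_nat (card (rots l)) * of_nat (multiplicity l) :: complex)"
      using card_rots(1)[OF ne] l(2) by (metis of_nat_mult)
    then have "2 * of_nat (card (rots l)) * W l = 2 * of_nat n * (W l / of_nat (multiplicity l))"
      using card_rots(2)[OF ne] by simp
    finally show "(\<Sum>vs\<in>orb l. W vs) = 2 * of_nat n * (W l / of_nat (multiplicity l))" .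
  qed
  also have "\<dots> = 2 * of_nat n * (\<Sum>l\<in>loops n. W l / of_nat (multiplicity l))"
    by (simp add: sum_distrib_left)
  finally show ?thesis .
qed

section \<open>Invariance of path weights and the loop sum\<close>

lemma edge_prod_cyc: "edge_prod x vs = cyc_prod (\<lambda>a b c. x {a, b}) vs"
  unfolding edge_prod_def cyc_prod_def by (intro prod.cong refl) (simp add: cyc_def)

lemma turn_phase_cyc:
  "turn_phase vs = cyc_prod (\<lambda>a b c. exp (\<i> * of_real (turn_angle (b - a) (c - b)) / 2)) vs"
proof -
  have "turn_phase vs = (\<Prod>i<length vs. exp (\<i> * of_real (turn_angle (vs ! ((i + 1) mod length vs) - vs ! i)
                       (vs ! ((i + 2) mod length vs) - vs ! ((i + 1) mod length vs))) / 2))"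
    unfolding turn_phase_def winding_angle_def Let_def
    by (simp add: sum_distrib_left sum_divide_distrib exp_sum)
  also have "\<dots> = cyc_prod (\<lambda>a b c. exp (\<i> * of_real (turn_angle (b - a) (c - b)) / 2)) vs"
    unfolding cyc_prod_def by (intro prod.cong refl) (simp add: cyc_def)
  finally show ?thesis .
qed

text \<open>Reversal inverts the quotient of the directions, and \<open>Arg\<close> of an inverse is
  the negative except on the negative real axis. A negative quotient would mean turning back along
  the same ray, which \<open>same_ray\<close> excludes.\<close>

lemma turn_angle_reverse:
  assumes "{a, b} \<in> E" "{b, c} \<in> E" "c \<noteq> a"
  shows "turn_angle (b - c) (a - b) = - turn_angle (b - a) (c - b)"
proof -
  define z where "z = (c - b) / (b - a)"
  have nz: "b - a \<noteq> 0" "c - b \<noteq> 0" using edge_V[OF assms(1)] edge_V[OF assms(2)] by auto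
  have "(a - b) / (b - c) = (- (b - a)) / (- (c - b))" by simp
  also have "\<dots> = inverse z" unfolding minus_divide_divide z_def by simp
  finally have inv: "(a - b) / (b - c) = inverse z" .
  have "Arg z = 0" if real: "z \<in> \<real>"
  proof -
    obtain r where r: "z = of_real r" using real by (rule Reals_cases)
    have "\<not> r < 0"
    proof
      assume "r < 0"
      have "c - b = (- r) *\<^sub>R (a - b)" using r nz by (simp add: z_def scaleR_conv_of_real field_simps)
      then have "a = c" using same_ray[of b a c "- r"] assms \<open>r < 0\<close> by (simp add: insert_commute)
      then show False using assms by simp
    qed
    then show ?thesis by (simp add: r)
  qed
  then show ?thesis unfolding turn_angle_def inv z_def[symmetric] by (simp add: Arg_inverse)
qed

text \<open>Reversal negates all turning angles, so the phases are mutually inverse; being 1 or -1,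
  they coincide.\<close>

lemma turn_phase_rev:
  assumes "closed_path E vs"
  shows "turn_phase (rev vs) = turn_phase vs"
proof -
  note c = assms[unfolded closed_path_cyc]
  have "turn_phase (rev vs) * turn_phase vs
    = cyc_prod (\<lambda>a b c. exp (\<i> * of_real (turn_angle (b - c) (a - b)) / 2)) vs * turn_phase vs"
    unfolding turn_phase_cyc[of "rev vs"] using closed_path_length[OF assms] by (subst cyc_prod_rev) auto
  also have "\<dots> = 1"
    unfolding turn_phase_cyc cyc_prod_def prod.distrib[symmetric]
  proof (intro prod.neutral ballI)
    fix i assume "i \<in> {..<length vs}"
    have e: "{cyc vs i, cyc vs (i + 1)} \<in> E" "{cyc vs (i + 1), cyc vs (i + 2)} \<in> E" "cyc vs (i + 2) \<noteq> cyc vs i"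
      using c[THEN conjunct2, rule_format, of i] c[THEN conjunct2, rule_format, of "i + 1"] by auto
    show "exp (\<i> * of_real (turn_angle (cyc vs (i + 1) - cyc vs (i + 2)) (cyc vs i - cyc vs (i + 1))) / 2) *
      exp (\<i> * of_real (turn_angle (cyc vs (i + 1) - cyc vs i) (cyc vs (i + 2) - cyc vs (i + 1))) / 2) = 1"
      unfolding turn_angle_reverse[OF e] by (simp flip: exp_add)
  qed
  finally show ?thesis
    using turn_phase_cases[OF assms] turn_phase_cases[OF closed_path_rev[OF assms]] by auto
qed

lemma edge_prod_rev:
  assumes "2 \<le> length vs"
  shows "edge_prod x (rev vs) = edge_prod x vs"
proof -
  have "edge_prod x (rev vs) = cyc_prod (\<lambda>a b c. x {c, b}) vs"
    unfolding edge_prod_cyc using assms by (simp add: cyc_prod_rev)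
  also have "\<dots> = (\<Prod>i<length vs. (\<lambda>a b c. x {a, b}) (cyc vs (i + 1)) (cyc vs (i + 1 + 1)) (cyc vs (i + 1 + 2)))"
    unfolding cyc_prod_def by (intro prod.cong refl) (simp add: insert_commute)
  also have "\<dots> = cyc_prod (\<lambda>a b c. x {a, b}) vs"
    using assms by (intro cyc_prod_shift) auto
  finally show ?thesis by (simp add: edge_prod_cyc)
qed

lemma path_weight_orb:
  assumes "closed_path E vs" "ws \<in> orb vs"
  shows "turn_phase ws * edge_prod x ws = turn_phase vs * edge_prod x vs"
proof -
  have n: "3 \<le> length vs" by (rule closed_path_length[OF assms(1)])
  then have ne: "vs \<noteq> []" "rev vs \<noteq> []" by auto
  have rot: "turn_phase (rotate k us) = turn_phase us" "edge_prod x (rotate k us) = edge_prod x us"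
    if "us \<noteq> []" for k us
    using that by (simp_all add: turn_phase_cyc edge_prod_cyc cyc_prod_rotate)
  consider k where "ws = rotate k vs" | k where "ws = rotate k (rev vs)"
    using assms(2) by (auto simp: orb_def rots_def)
  then show ?thesis
    using rot ne turn_phase_rev[OF assms(1)] edge_prod_rev[of vs x] n by cases simp_all
qed

lemma loop_weight_eq: "loop_weight x l = - (turn_phase l * edge_prod x l / of_nat (multiplicity l))"
  by (simp add: loop_weight_def loop_sign_def turn_phase_def edge_prod_def)

lemma sum_loops:
  "2 * of_nat n * (\<Sum>l\<in>loops n. loop_weight x l) = - (\<Sum>vs\<in>closed_paths n. turn_phase vs * edge_prod x vs)"
  using sum_closed_paths_loops[of "\<lambda>vs. turn_phase vs * edge_prod x vs" n, OF path_weight_orb]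
  by (simp add: loop_weight_eq sum_negf)

end

section \<open>Convergence and conclusion\<close>

lemma fps_poly_eval:
  fixes c :: "'a \<Rightarrow> complex"
  assumes "finite S"
  shows "fps_conv_radius (\<Sum>F\<in>S. fps_const (c F) * fps_X ^ k F) = \<infinity> \<and>
    eval_fps (\<Sum>F\<in>S. fps_const (c F) * fps_X ^ k F) z = (\<Sum>F\<in>S. c F * z ^ k F)"
  using assms
proof (induction S rule: finite_induct)
  case empty
  then show ?case by simp
next
  case (insert a S)
  let ?f = "fps_const (c a) * fps_X ^ k a" and ?g = "\<Sum>F\<in>S. fps_const (c F) * fps_X ^ k F"
  have rf: "fps_conv_radius ?f = \<infinity>"
    using fps_conv_radius_mult[of "fps_const (c a)" "fps_X ^ k a"] by simp
  have "fps_conv_radius (?f + ?g) = \<infinity>"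
    using fps_conv_radius_add[of ?f ?g] rf insert.IH by simp
  moreover have "eval_fps (?f + ?g) z = c a * z ^ k a + eval_fps ?g z"
    using rf insert.IH by (subst eval_fps_add) (auto simp: eval_fps_mult)
  ultimately show ?case using insert by simp
qed

text \<open>On the ball, \<open>Z\<close> times exp(-\<open>L\<close>) has derivative zero and
  equals 1 at the origin.\<close>

lemma eval_fps_exp_of_log_deriv:
  fixes Z L :: "complex fps"
  assumes deriv: "fps_deriv Z = Z * fps_deriv L"
    and rad: "ereal R \<le> fps_conv_radius Z" "ereal R \<le> fps_conv_radius L"
    and init: "fps_nth Z 0 = 1" "fps_nth L 0 = 0"
    and z: "norm z < R"
  shows "eval_fps Z z = exp (eval_fps L z)"
proof -
  define f where "f = (\<lambda>z. eval_fps Z z * exp (- eval_fps L z))"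
  have R: "R > 0" using z by (metis norm_ge_zero order_le_less_trans)
  have "\<exists>c. \<forall>w\<in>ball 0 R. f w = c"
  proof (rule has_field_derivative_zero_constant)
    fix w :: complex assume "w \<in> ball 0 R"
    then have w: "ereal (norm w) < ereal R" by simp
    have rw: "norm w < fps_conv_radius Z" "norm w < fps_conv_radius L"
      using less_le_trans[OF w rad(1)] less_le_trans[OF w rad(2)] by auto
    have rL: "norm w < fps_conv_radius (fps_deriv L)"
      using rw(2) fps_conv_radius_deriv[of L] by (rule less_le_trans)
    have "eval_fps (fps_deriv Z) w = eval_fps Z w * eval_fps (fps_deriv L) w"
      unfolding deriv by (rule eval_fps_mult[OF rw(1) rL])
    then have dZ: "(eval_fps Z has_field_derivative eval_fps Z w * eval_fps (fps_deriv L) w) (at w within ball 0 R)"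
      using has_field_derivative_eval_fps[OF rw(1)] by simp
    have dL: "(eval_fps L has_field_derivative eval_fps (fps_deriv L) w) (at w within ball 0 R)"
      by (rule has_field_derivative_eval_fps[OF rw(2)])
    show "(f has_field_derivative 0) (at w within ball 0 R)"
      unfolding f_def by (rule derivative_eq_intros dZ dL refl | simp)+
  qed simp
  then obtain c where c: "\<And>w. w \<in> ball 0 R \<Longrightarrow> f w = c" by blast
  have "f z = f 0" using c[of z] c[of 0] z R by simp
  then have "eval_fps Z z * exp (- eval_fps L z) = 1" by (simp add: f_def eval_fps_at_0 init)
  then show ?thesis by (simp add: exp_minus field_simps)
qed

section \<open>Geometric bounds for closed paths and the loop expansion\<close>

context plane_graph
begin

text \<open>The whole weight is put on the edge being entered, instead of square roots on two edges
  as in \<open>tmat\<close>. Traces over closed paths see the same edge products, but row sums are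
  now controlled by the degree of a single vertex.\<close>

definition nmat :: "(complex set \<Rightarrow> complex) \<Rightarrow> complex \<times> complex \<Rightarrow> complex \<times> complex \<Rightarrow> real" where
  "nmat x h g = (if snd h = fst g \<and> snd g \<noteq> fst h then norm (x {fst g, snd g}) else 0)"

text \<open>A half-edge arriving at \<open>v\<close> has \<open>deg E v - 1\<close> continuations,
  each of modulus below 1 / (\<open>deg E v\<close> - 1) because \<open>dmax\<close> is at least
  \<open>deg E v\<close>. When there is no continuation the row is empty.\<close>

lemma nmat_row:
  assumes bound: "\<forall>u v. {u, v} \<in> E \<longrightarrow> dmax E u v = 1 \<or> norm (x {u, v}) < 1 / (real (dmax E u v) - 1)"
    and h: "h \<in> hedges"
  shows "(\<Sum>g\<in>hedges. nmat x h g) < 1"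
proof -
  obtain u v where uv: "h = (u, v)" "{u, v} \<in> E" using h by (auto simp: hedges_def)
  define S where "S = {g \<in> hedges. v = fst g \<and> snd g \<noteq> u}"
  have fS: "finite S" using finite_hedges by (simp add: S_def)
  have sum: "(\<Sum>g\<in>hedges. nmat x h g) = (\<Sum>g\<in>S. norm (x {fst g, snd g}))"
    unfolding S_def nmat_def uv(1) using finite_hedges by (simp add: sum.inter_filter)
  show ?thesis
  proof (cases "S = {}")
    case True
    then show ?thesis using sum by simp
  next
    case False
    have "insert (v, u) S = {q \<in> hal E. fst q = v}"
      using uv(2) by (auto simp: S_def hal_E hedges_def insert_commute)
    moreover have "(v, u) \<notin> S" by (simp add: S_def)
    ultimately have deg: "deg E v = Suc (card S)"
      using card_block_deg[OF order_refl, of v] card_insert_disjoint[OF fS] by metis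
    have k: "card S > 0" using False fS by auto
    have "norm (x {fst g, snd g}) < 1 / real (card S)" if "g \<in> S" for g
    proof -
      have g: "{fst g, snd g} \<in> E" "fst g = v" using that by (auto simp: S_def hedges_def)
      have d: "Suc (card S) \<le> dmax E (fst g) (snd g)" using deg g(2) by (simp add: dmax_def)
      then have "dmax E (fst g) (snd g) \<noteq> 1" using k by linarith
      then have "norm (x {fst g, snd g}) < 1 / (real (dmax E (fst g) (snd g)) - 1)"
        using bound g(1) by blast
      also have "\<dots> \<le> 1 / real (card S)" using d k by (intro divide_left_mono) auto
      finally show ?thesis .
    qed
    then have "(\<Sum>g\<in>S. norm (x {fst g, snd g})) < (\<Sum>g\<in>S. 1 / real (card S))"
      using fS False by (intro sum_strict_mono) auto
    also have "\<dots> = 1" using k by simp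
    finally show ?thesis using sum by simp
  qed
qed

lemma sum_closed_paths_bound:
  fixes x :: "complex set \<Rightarrow> complex"
  assumes bound: "\<forall>u v. {u, v} \<in> E \<longrightarrow> dmax E u v = 1 \<or> norm (x {u, v}) < 1 / (real (dmax E u v) - 1)"
  obtains r C where "0 \<le> r" "r < 1" "0 \<le> C"
    "\<And>n. n > 0 \<Longrightarrow> (\<Sum>vs\<in>closed_paths n. norm (edge_prod x vs)) \<le> C * r ^ n"
proof -
  \<comment> \<open>The inserted 0 covers the graph without edges and makes \<open>r\<close>
    nonnegative.\<close>
  define r where "r = Max (insert 0 ((\<lambda>h. \<Sum>g\<in>hedges. nmat x h g) ` hedges))"
  have r0: "0 \<le> r" unfolding r_def using finite_hedges by (intro Max_ge) auto
  have r1: "r < 1" unfolding r_def using finite_hedges nmat_row[OF bound] by (subst Max_less_iff) auto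
  have row: "(\<Sum>g\<in>hedges. nmat x h g) \<le> r" if "h \<in> hedges" for h
    unfolding r_def using finite_hedges that by (intro Max_ge) auto
  have nn: "nmat x h g \<ge> 0" for h g by (simp add: nmat_def)
  have mnn: "mpow hedges (nmat x) n h g \<ge> 0" for n h g
    by (induction n arbitrary: h) (auto intro!: sum_nonneg mult_nonneg_nonneg nn)
  have pow: "(\<Sum>g\<in>hedges. mpow hedges (nmat x) n h g) \<le> r ^ n" if "h \<in> hedges" for n h
    using that
  proof (induction n arbitrary: h)
    case 0
    then show ?case using finite_hedges by simp
  next
    case (Suc n)
    have "(\<Sum>g\<in>hedges. mpow hedges (nmat x) (Suc n) h g)
        = (\<Sum>j\<in>hedges. nmat x h j * (\<Sum>g\<in>hedges. mpow hedges (nmat x) n j g))"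
      by (simp add: sum_distrib_left) (rule sum.swap)
    also have "\<dots> \<le> (\<Sum>j\<in>hedges. nmat x h j * r ^ n)"
      by (intro sum_mono mult_left_mono Suc.IH nn)
    also have "\<dots> = (\<Sum>j\<in>hedges. nmat x h j) * r ^ n" by (simp add: sum_distrib_right)
    also have "\<dots> \<le> r * r ^ n" using row[OF Suc.prems] r0 by (intro mult_right_mono) auto
    finally show ?case by simp
  qed
  have "(\<Sum>vs\<in>closed_paths n. norm (edge_prod x vs)) \<le> real (card hedges) * r ^ n" if n: "n > 0" for n
  proof -
    have "(\<Sum>vs\<in>closed_paths n. norm (edge_prod x vs)) = (\<Sum>vs\<in>closed_paths n. \<Prod>i<n.
     nmat x (vs ! i, vs ! ((i + 1) mod n)) (vs ! ((i + 1) mod n), vs ! ((i + 2) mod n)))"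
    proof (intro sum.cong refl)
      fix vs assume "vs \<in> closed_paths n"
      then have vs: "closed_path E vs" "length vs = n" by (auto simp: closed_paths_def)
      have nb: "vs ! ((i + 2) mod n) \<noteq> vs ! i" if "i < n" for i
        using closed_path_iff[OF vs(2)] vs(1) that by auto
      let ?f = "\<lambda>i. norm (x {vs ! i, vs ! ((i + 1) mod n)})"
      have "norm (edge_prod x vs) = (\<Prod>i<n. ?f i)"
        by (simp add: edge_prod_def vs(2) flip: prod_norm)
      \<comment> \<open>A cyclic shift by one assigns to each step the weight of the edge entered,
        as \<open>nmat\<close> does.\<close>
      also have "\<dots> = (\<Prod>i<n. ?f ((i + 1) mod n))" by (rule prod_shift_mod[OF n, symmetric])
      also have "\<dots> = (\<Prod>i<n. nmat x (vs ! i, vs ! ((i + 1) mod n)) (vs ! ((i + 1) mod n), vs ! ((i + 2) mod n)))"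
      proof (intro prod.cong refl)
        fix i assume "i \<in> {..<n}"
        moreover have "((i + 1) mod n + 1) mod n = (i + 2) mod n" by (simp add: mod_Suc_eq)
        ultimately show "?f ((i + 1) mod n) =
          nmat x (vs ! i, vs ! ((i + 1) mod n)) (vs ! ((i + 1) mod n), vs ! ((i + 2) mod n))"
          using nb[of i] by (simp add: nmat_def)
      qed
      finally show "norm (edge_prod x vs) = \<dots>" .
    qed
    also have "\<dots> = (\<Sum>h\<in>hedges. mpow hedges (nmat x) n h h)"
      by (rule trace_closed_paths[OF _ n, symmetric]) (auto simp: nmat_def)
    also have "\<dots> \<le> (\<Sum>h\<in>hedges. r ^ n)"
    proof (rule sum_mono)
      fix h assume h: "h \<in> hedges"
      have "mpow hedges (nmat x) n h h \<le> (\<Sum>g\<in>hedges. mpow hedges (nmat x) n h g)"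
        using h finite_hedges mnn by (intro member_le_sum) auto
      then show "mpow hedges (nmat x) n h h \<le> r ^ n" using pow[OF h, of n] by linarith
    qed
    finally show ?thesis by simp
  qed
  then show thesis by (intro that[OF r0 r1, of "real (card hedges)"]) auto
qed

lemma norm_loop_weight_le:
  assumes "is_loop E l"
  shows "norm (loop_weight x l) \<le> norm (edge_prod x l)"
proof -
  have c: "closed_path E l" "l \<noteq> []" using assms by (auto simp: is_loop_def closed_path_def)
  have "norm (turn_phase l) = 1" using turn_phase_cases[OF c(1)] by auto
  moreover have "real (multiplicity l) \<ge> 1" using card_rots(2)[OF c(2)] by simp
  then have "norm (edge_prod x l) / real (multiplicity l) \<le> norm (edge_prod x l) / 1"
    by (intro divide_left_mono) auto
  ultimately show ?thesis by (simp add: loop_weight_eq norm_divide norm_mult)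
qed

lemma loops_0: "loops 0 = {}"
  by (auto simp: loops_def is_loop_def closed_path_def)

lemma finite_loops: "finite (loops n)"
  using loops_subset finite_closed_paths finite_subset by blast

lemma loop_expansion:
  assumes bound: "\<forall>u v. {u, v} \<in> E \<longrightarrow> dmax E u v = 1 \<or> norm (x {u, v}) < 1 / (real (dmax E u v) - 1)"
  shows "(\<lambda>l. norm (loop_weight x l)) summable_on {l. is_loop E l}"
    and "Zgen V E x = exp (\<Sum>\<^sub>\<infinity>l\<in>{l. is_loop E l}. loop_weight x l)"
proof -
  obtain r C where r: "0 \<le> r" "r < 1" "0 \<le> C"
    and B: "\<And>n. n > 0 \<Longrightarrow> (\<Sum>vs\<in>closed_paths n. norm (edge_prod x vs)) \<le> C * r ^ n"
    using sum_closed_paths_bound[OF bound] by blast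
  have lb: "(\<Sum>l\<in>loops n. norm (loop_weight x l)) \<le> C * r ^ n" for n
  proof (cases "n = 0")
    case True
    then show ?thesis using r by (simp add: loops_0)
  next
    case False
    have "(\<Sum>l\<in>loops n. norm (loop_weight x l)) \<le> (\<Sum>l\<in>loops n. norm (edge_prod x l))"
      by (intro sum_mono norm_loop_weight_le) (simp add: loops_def)
    also have "\<dots> \<le> (\<Sum>l\<in>closed_paths n. norm (edge_prod x l))"
      by (intro sum_mono2 finite_closed_paths loops_subset) auto
    also have "\<dots> \<le> C * r ^ n" using B False by simp
    finally show ?thesis .
  qed
  show summ: "(\<lambda>l. norm (loop_weight x l)) summable_on {l. is_loop E l}"
  proof (rule nonneg_bdd_above_summable_on)
    show "bdd_above (sum (\<lambda>l. norm (loop_weight x l)) ` {F. F \<subseteq> {l. is_loop E l} \<and> finite F})"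
    proof (rule bdd_aboveI2)
      fix F assume "F \<in> {F. F \<subseteq> {l. is_loop E l} \<and> finite F}"
      then have F: "F \<subseteq> {l. is_loop E l}" "finite F" by auto
      define N where "N = Suc (Max (insert 0 (length ` F)))"
      have "length l < N" if "l \<in> F" for l
        unfolding N_def using that F(2) by (auto simp: less_Suc_eq_le intro!: Max_ge)
      then have "F \<subseteq> (\<Union>n<N. loops n)" using F(1) by (auto simp: loops_def)
      then have "(\<Sum>l\<in>F. norm (loop_weight x l)) \<le> (\<Sum>l\<in>(\<Union>n<N. loops n). norm (loop_weight x l))"
        by (intro sum_mono2) (auto simp: finite_loops)
      also have "\<dots> = (\<Sum>n<N. \<Sum>l\<in>loops n. norm (loop_weight x l))"
        by (rule sum.UNION_disjoint) (simp_all add: finite_loops, auto simp: loops_def)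
      also have "\<dots> \<le> (\<Sum>n<N. C * r ^ n)" by (intro sum_mono lb)
      also have "\<dots> \<le> (\<Sum>n. C * r ^ n)"
        using r by (intro sum_le_suminf summable_mult summable_geometric) auto
      finally show "(\<Sum>l\<in>F. norm (loop_weight x l)) \<le> (\<Sum>n. C * r ^ n)" .
    qed
  qed simp
  define b where "b = (\<lambda>n. \<Sum>l\<in>loops n. loop_weight x l)"
  \<comment> \<open>Grading loops by length makes \<open>L\<close> the loop sum for the weights tx,
    as a power series in t.\<close>
  define L where "L = Abs_fps b"
  have nb: "norm (b n) \<le> C * r ^ n" for n
    unfolding b_def using lb[of n] norm_sum[of "loop_weight x" "loops n"] by linarith
  have "b sums (\<Sum>\<^sub>\<infinity>l\<in>{l. is_loop E l}. loop_weight x l)"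
  proof (rule has_sum_imp_sums)
    have hs: "(loop_weight x has_sum (\<Sum>\<^sub>\<infinity>l\<in>{l. is_loop E l}. loop_weight x l)) {l. is_loop E l}"
      by (rule has_sum_infsum[OF abs_summable_summable[OF summ]])
    have "bij_betw snd (Sigma UNIV loops) {l. is_loop E l}"
      by (rule bij_betwI[of _ _ _ "\<lambda>l. (length l, l)"]) (auto simp: loops_def)
    from has_sum_reindex_bij_betw[OF this, of "loop_weight x"] have "((\<lambda>p. loop_weight x (snd p)) has_sum (\<Sum>\<^sub>\<infinity>l\<in>{l. is_loop E l}. loop_weight x l)) (Sigma UNIV loops)"
      using hs by simp
    then show "(b has_sum (\<Sum>\<^sub>\<infinity>l\<in>{l. is_loop E l}. loop_weight x l)) UNIV"
      by (rule has_sum_Sigma[OF isUCont_plus]) (simp add: b_def finite_loops)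
  qed
  then have evL: "eval_fps L 1 = (\<Sum>\<^sub>\<infinity>l\<in>{l. is_loop E l}. loop_weight x l)"
    by (simp add: eval_fps_def L_def sums_iff)
  \<comment> \<open>Any radius above 1 with \<open>r * R < 1\<close> works: evaluation at 1 then
    takes place strictly inside the disc of convergence.\<close>
  define R where "R = 2 / (1 + r)"
  have R: "1 < R" "r * R < 1" "0 < R" using r by (auto simp: R_def field_simps)
  have "ereal (norm (of_real R :: complex)) \<le> conv_radius b"
  proof (rule conv_radius_geI, rule summable_comparison_test')
    show "summable (\<lambda>n. C * (r * R) ^ n)" using r R by (intro summable_mult summable_geometric) auto
    fix n show "norm (b n * of_real R ^ n) \<le> C * (r * R) ^ n"
      using mult_right_mono[OF nb[of n], of "R ^ n"] R(3)
      by (simp add: norm_mult norm_power power_mult_distrib mult.assoc)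
  qed
  then have radL: "ereal R \<le> fps_conv_radius L"
    using R(3) by (simp add: fps_conv_radius_def L_def)
  let ?S = "{F. F \<subseteq> E \<and> even_set V F}"
  have finS: "finite ?S" using finite_E by simp
  note Zp = fps_poly_eval[OF finS, of "\<lambda>F. (-1) ^ crossing_number V F * (\<Prod>e\<in>F. x e)" card, folded Zfps_def]
  have "fps_deriv (Zfps x) = Zfps x * fps_deriv L"
  proof -
    let ?T = "Abs_fps (\<lambda>n. \<Sum>h\<in>hedges. mpow hedges (tmat x) (Suc n) h h)"
    \<comment> \<open>The trace of the power \<open>n + 1\<close> is \<open>-2 * (n + 1)\<close>
      times the loop sum of that length; the factor \<open>n + 1\<close> is the one produced by
      differentiating \<open>L\<close>.\<close>
    have "?T = - (fps_deriv L + fps_deriv L)"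
    proof (rule fps_ext)
      fix n
      have "(\<Sum>h\<in>hedges. mpow hedges (tmat x) (Suc n) h h) = - (2 * of_nat (Suc n) * b (Suc n))"
        using trace_tmat[of "Suc n" x] sum_loops[of "Suc n" x] unfolding b_def by simp
      moreover have "fps_nth (fps_deriv L) n = of_nat (Suc n) * b (Suc n)" by (simp add: L_def)
      ultimately show "fps_nth ?T n = fps_nth (- (fps_deriv L + fps_deriv L)) n"
        by (simp only: fps_neg_nth fps_add_nth fps_nth_Abs_fps) (simp del: mpow.simps)
    qed
    then have "2 * fps_deriv (Zfps x) = 2 * (Zfps x * fps_deriv L)"
      using fps_deriv_Zfps[of x] by (simp add: algebra_simps del: mpow.simps)
    then show ?thesis by (simp only: mult_cancel_left) (metis numeral_neq_fps_zero)
  qed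
  moreover have "ereal R \<le> fps_conv_radius (Zfps x)" using Zp by simp
  moreover have "fps_nth (Zfps x) 0 = 1"
  proof -
    have "fps_nth (Zfps x) 0 = eval_fps (Zfps x) 0" by (simp add: eval_fps_at_0)
    also have "\<dots> = (\<Sum>F\<in>?S. (-1) ^ crossing_number V F * (\<Prod>e\<in>F. x e) * 0 ^ card F)" using Zp by blast
    also have "\<dots> = (\<Sum>F\<in>{{}}. (-1) ^ crossing_number V F * (\<Prod>e\<in>F. x e) * 0 ^ card F)"
    proof (rule sum.mono_neutral_right[OF finS])
      show "{{}} \<subseteq> ?S" by (auto simp: even_set_def deg_def)
      show "\<forall>F\<in>?S - {{}}. (-1) ^ crossing_number V F * (\<Prod>e\<in>F. x e) * 0 ^ card F = 0"
        using finite_E finite_subset by (auto simp: card_gt_0_iff)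
    qed
    also have "\<dots> = 1" by (simp add: crossing_number_def)
    finally show ?thesis .
  qed
  moreover have "fps_nth L 0 = 0" by (simp add: L_def b_def loops_0)
  ultimately have "eval_fps (Zfps x) 1 = exp (eval_fps L 1)"
    using radL R(1) by (intro eval_fps_exp_of_log_deriv[of _ _ R]) auto
  moreover have "eval_fps (Zfps x) 1 = Zgen V E x" using Zp[of 1] by (simp add: Zgen_def)
  ultimately show "Zgen V E x = exp (\<Sum>\<^sub>\<infinity>l\<in>{l. is_loop E l}. loop_weight x l)"
    using evL by simp
qed

end

theorem mainTheorem1:
  fixes V :: "complex set" and E EA :: "complex set set" and x :: "complex set \<Rightarrow> complex"
  assumes "embedded_graph V E"
    and "EA \<subseteq> E" and "acyclic_edges EA"
    and "\<forall>u v. {u, v} \<in> E \<longrightarrow>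
           dmax E u v = 1 \<or> norm (x {u, v}) < 1 / (real (dmax E u v) - 1)"
  shows "Infinite_Sum.abs_summable_on (loop_weight x) {l. is_loop E l} \<and>
           Zgen V E x = exp (\<Sum>\<^sub>\<infinity>l\<in>{l. is_loop E l}. loop_weight x l)"
proof -
  interpret plane_graph V E by unfold_locales (rule assms(1))
  show ?thesis using loop_expansion[OF assms(4)] by blast
qed

end
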